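(* Let $F$ be a graph which has a bipartition $S\cup T$ and a vertex $v^*\in T$ such that $v^*$ is adjacent to all of $S$ and such that every $v\in T\setminus\{v^*\}$ has degree exactly $r$, where $r\ge 2$ is an integer. For each $\mu\subseteq S$, let $N(\mu)\subseteq T$ denote the set of vertices of $T$ that are adjacent to at least one vertex of $\mu$. Suppose that $F$ contains a subgraph isomorphic to some $K_{r,t}$ with $\mathrm{ex}(n,K_{r,t})=\Theta(n^{2-1/r})$, that $F$ is 2-balanced, and that \[\max_{\mu\subseteq S,\ |\mu|\ge 2}\frac{e(F[\mu\cup N(\mu)])-|N(\mu)|}{|\mu|-1}=\frac{e(F)-|T|}{|S|-1}.\] Then there exists a constant $C>0$ such that for every $p=p(n)\in[0,1]$ lying in one of the ranges below, a.a.s. \[\mathrm{ex}(G_{n,p},F)=\begin{cases} \Theta(p^{1-1/r}n^{2-1/r}) & n^{-\frac{|S|-1}{|S|-1+r(|T|-1)}}(\log n)^{C}\le p,\\ n^{2-\frac{|S|+|T|-2}{|S|-1+r(|T|-1)}}(\log n)^{\Theta(1)} & n^{-\frac{|S|+|T|-2}{|S|-1+r(|T|-1)}}\ll p\le n^{-\frac{|S|-1}{|S|-1+r(|T|-1)}}(\log n)^{C},\\ (1+o(1))p\binom n2 & n^{-2}\ll p\ll n^{-\frac{|S|+|T|-2}{|S|-1+r(|T|-1)}}. \end{cases}\]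
   Context: All graphs are finite and simple; $e(\cdot)$, $v(\cdot)$ denote numbers of edges and vertices and $F[\nu]$ is the induced subgraph. For a graph $F$ on at least 3 vertices, $m_2(F)=\max_{F'\subseteq F:\ v(F')\ge 3}\frac{e(F')-1}{v(F')-2}$, and $F$ is 2-balanced if $m_2(F)=\frac{e(F)-1}{v(F)-2}$. $\mathrm{ex}(n,F)$ is the maximum number of edges in an $n$-vertex $F$-free graph. $G_{n,p}$ is the random graph on $n$ vertices in which each possible edge is included independently with probability $p$, and $\mathrm{ex}(G_{n,p},F)$ is the maximum number of edges in an $F$-free subgraph of $G_{n,p}$. A sequence of events $A_n$ holds asymptotically almost surely (a.a.s.) if $\Pr[A_n]\to1$. $f(n)\ll g(n)$ means $f(n)/g(n)\to0$ as $n\to\infty$. For a random variable $X_n$: "a.a.s. $X_n=\Theta(g(n))$" means there is a constant $K>0$ depending only on the fixed data ($F$, $r$) such that a.a.s. $K^{-1}g(n)\le X_n\le Kg(n)$; "a.a.s. $X_n=g(n)(\log n)^{\Theta(1)}$" means there is a constant $C'>0$ depending only on the fixed data such that a.a.s. $g(n)(\log n)^{-C'}\le X_n\le g(n)(\log n)^{C'}$; "a.a.s. $X_n=(1+o(1))g(n)$" means that for every $\varepsilon>0$, a.a.s. $|X_n-g(n)|\le\varepsilon g(n)$. *)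

theory Defs
  imports "HOL-Probability.Probability" "HOL-Library.Ramsey" "HOL-Library.Landau_Symbols"
begin

type_synonym 'a ugraph = "'a set \<times> 'a set set"

abbreviation verts :: "'a ugraph \<Rightarrow> 'a set" where "verts G \<equiv> fst G"
abbreviation edges :: "'a ugraph \<Rightarrow> 'a set set" where "edges G \<equiv> snd G"

abbreviation v_num :: "'a ugraph \<Rightarrow> nat" where "v_num G \<equiv> card (verts G)"
abbreviation e_num :: "'a ugraph \<Rightarrow> nat" where "e_num G \<equiv> card (edges G)"

definition simple_graph :: "'a ugraph \<Rightarrow> bool" where
  "simple_graph G \<longleftrightarrow> finite (verts G) \<and> edges G \<subseteq> nsets (verts G) 2"

definition adjacent :: "'a ugraph \<Rightarrow> 'a \<Rightarrow> 'a \<Rightarrow> bool" where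
  "adjacent G u v \<longleftrightarrow> {u, v} \<in> edges G"

definition vdegree :: "'a ugraph \<Rightarrow> 'a \<Rightarrow> nat" where
  "vdegree G v = card {u \<in> verts G. adjacent G v u}"

definition subgraph :: "'a ugraph \<Rightarrow> 'a ugraph \<Rightarrow> bool" where
  "subgraph H G \<longleftrightarrow> simple_graph H \<and> verts H \<subseteq> verts G \<and> edges H \<subseteq> edges G"

definition induced :: "'a ugraph \<Rightarrow> 'a set \<Rightarrow> 'a ugraph" where
  "induced G W = (W, {e \<in> edges G. e \<subseteq> W})"

definition graph_iso :: "'a ugraph \<Rightarrow> 'b ugraph \<Rightarrow> bool" where
  "graph_iso G H \<longleftrightarrow> (\<exists>f. bij_betw f (verts G) (verts H) \<and> edges H = (\<lambda>e. f ` e) ` edges G)"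

definition contains_copy :: "'a ugraph \<Rightarrow> 'b ugraph \<Rightarrow> bool" where
  "contains_copy G F \<longleftrightarrow> (\<exists>H. subgraph H G \<and> graph_iso H F)"

definition complete_bipartite :: "nat \<Rightarrow> nat \<Rightarrow> (nat + nat) ugraph" where
  "complete_bipartite r t = ({..<r} <+> {..<t}, {{Inl i, Inr j} | i j. i < r \<and> j < t})"

definition bipartition :: "'a ugraph \<Rightarrow> 'a set \<Rightarrow> 'a set \<Rightarrow> bool" where
  "bipartition G S T \<longleftrightarrow> S \<union> T = verts G \<and> S \<inter> T = {} \<and>
     (\<forall>e \<in> edges G. \<exists>s \<in> S. \<exists>t \<in> T. e = {s, t})"

definition nbhd_in :: "'a ugraph \<Rightarrow> 'a set \<Rightarrow> 'a set \<Rightarrow> 'a set" where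
  "nbhd_in G T \<mu> = {v \<in> T. \<exists>u \<in> \<mu>. adjacent G u v}"

definition m2 :: "'a ugraph \<Rightarrow> real" where
  "m2 F = Max {(real (e_num F') - 1) / (real (v_num F') - 2) | F'. subgraph F' F \<and> v_num F' \<ge> 3}"

definition two_balanced :: "'a ugraph \<Rightarrow> bool" where
  "two_balanced F \<longleftrightarrow> v_num F \<ge> 3 \<and> m2 F = (real (e_num F) - 1) / (real (v_num F) - 2)"

text \<open>The sets below are nonempty, so that \<^const>\<open>Max\<close> is meaningful, as soon as \<open>F\<close> has an edge.\<close>

definition ex_num :: "nat \<Rightarrow> 'b ugraph \<Rightarrow> nat" where
  "ex_num n F = Max {e_num G | G :: nat ugraph.
     simple_graph G \<and> verts G = {..<n} \<and> \<not> contains_copy G F}"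

definition ex_in :: "'a ugraph \<Rightarrow> 'b ugraph \<Rightarrow> nat" where
  "ex_in G F = Max {e_num H | H. subgraph H G \<and> \<not> contains_copy H F}"

definition gnp :: "nat \<Rightarrow> real \<Rightarrow> nat ugraph pmf" where
  "gnp n p = map_pmf (\<lambda>f. ({..<n}, {e \<in> nsets {..<n} 2. f e}))
     (Pi_pmf (nsets {..<n} 2) False (\<lambda>_. bernoulli_pmf p))"

definition aas :: "(nat \<Rightarrow> real) \<Rightarrow> (nat \<Rightarrow> nat ugraph \<Rightarrow> bool) \<Rightarrow> bool" where
  "aas p A \<longleftrightarrow> (\<lambda>n. measure_pmf.prob (gnp n (p n)) {G. A n G}) \<longlonglongrightarrow> 1"

end

theory Submission
  imports Defs "HOL-Real_Asymp.Real_Asymp"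
begin

text \<open>
  Write \<open>Z(q)\<close> for the sum of \<open>q ^ card A\<close> over all \<open>F\<close>-free edge sets \<open>A\<close> on \<open>{..<n}\<close>. A union bound
  over the \<open>F\<close>-free sets with at least \<open>m\<close> edges gives \<open>Pr[ex(G(n,p),F) \<ge> m] \<le> Z(2p) / 2 ^ m\<close>
  (\<open>prob_large_free_subset\<close>), so all upper bounds follow from
  \<open>ln Z(q) = O(q powr (1 - 1/r) * n powr (2 - 1/r) + n powr (2 - \<alpha>) * (ln n)\<^sup>2)\<close> (\<open>activity_bound\<close>). The first
  term dominates for \<open>q \<ge> n powr (-\<beta>) * (ln n) ^ 4\<close>, and at that density the two agree up to powers of
  \<open>ln n\<close>. Since \<open>ex(G,F)\<close> is monotone in \<open>G\<close>, this density also controls all smaller ones.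

  The bound on \<open>Z\<close> is a container argument carried out on the partition function itself. Let \<open>Z(E)\<close> be
  the part of \<open>Z\<close> that comes from subsets of \<open>E\<close>. As long as \<open>E\<close> has at least
  \<open>e0 = A * n powr (2 - 1/r) * q powr (-1/r)\<close> edges, some edges can be deleted from \<open>E\<close> with
  \<open>Z(E) \<le> exp (cost) * Z(Y)\<close>, where \<open>Y\<close> is what remains (\<open>container_step\<close>, \<open>graph_container_step\<close>); once fewer
  edges are left, \<open>Z(E) \<le> (1 + q) ^ card E\<close> suffices. To find the deletion, edges of low marginal probability
  are discarded and edges of higher marginal probability are conditioned to be present. If this never
  discards much, one can choose the conditioned edges so as to complete all but one edge of many copies of \<open>F\<close>;
  the missing edges are then forbidden and can be removed for free (\<open>blocking_game\<close>). The choice is made greedily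
  by conditional expectations, against whatever is discarded meanwhile, and works as soon as there is a
  weighted family of copies of \<open>F\<close> in \<open>E\<close> in which no set of edges carries too much weight.

  Such a family comes from picking a vertex \<open>b\<close> of large degree for \<open>v*\<close>, then the images of \<open>S\<close> in its
  neighbourhood, then each other vertex of \<open>T\<close> uniformly among the common neighbours of the images of its
  \<open>r\<close> neighbours. Every vertex of \<open>T - {v*}\<close> being picked uniformly, the weight above partial data is bounded
  by powers of the degree \<open>y\<close> and of the least codegree \<open>\<rho>\<close> (\<open>spread\<close>). What must be verified is one
  inequality for each subset of the edges of \<open>F\<close>. In logarithmic scale the critical case is a linear
  function of the density, nonnegative at one end because \<open>F\<close> is 2-balanced and at the other by the hypothesis
  on \<open>\<mu> \<subseteq> S\<close> (\<open>exponent_inequality\<close>). The costs of the successive deletions are summed by a potential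
  function; the main term sums like a convergent geometric series, so only the secondary term picks up logarithms.

  Lower bounds. For \<open>p\<close> below \<open>n powr (-\<alpha>)\<close> there are few copies of \<open>F\<close>, and deleting an edge of each costs
  little (\<open>deletion_bound\<close>). In the middle range, monotonicity in \<open>p\<close> reduces to \<open>p = n powr (-\<alpha>) / ln n\<close>. In the dense
  range, blow up an extremal \<open>K\<^bsub>r,t\<^esub>\<close>-free graph on about \<open>n * p\<close> vertices to \<open>n\<close> vertices, and keep those
  edges of the random graph that are isolated inside the bipartite block they lie in: a copy of \<open>K\<^bsub>r,t\<^esub>\<close> among
  them would project injectively to the extremal graph (\<open>isolated_edges_free\<close>, \<open>many_isolated_edges\<close>).
\<close>

section \<open>Picking vertices greedily against an adversary\<close>

text \<open>Elements of \<open>\<Omega>\<close> are copies of a fixed structure, and \<open>pos i a\<close> is the \<open>i\<close>-th vertex of the copy \<open>a\<close>. The second moment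
  below measures how strongly the weight \<open>w\<close> concentrates on copies that share the vertices at the positions \<open>L\<close>.\<close>
definition pair_mass :: "'w set \<Rightarrow> (nat \<Rightarrow> 'w \<Rightarrow> 'x) \<Rightarrow> ('w \<Rightarrow> real) \<Rightarrow> nat set \<Rightarrow> real" where
  "pair_mass \<Omega> pos w L = (\<Sum>a\<in>\<Omega>. \<Sum>b\<in>\<Omega>. w a * w b * of_bool (\<forall>l\<in>L. pos l a = pos l b))"

text \<open>For a random set that contains a proportion \<open>\<tau>\<close> of the \<open>N\<close> available vertices, the number of fully picked copies has
  variance governed by the pairs that share the positions \<open>L\<close>, each gaining a factor \<open>\<tau> ^ (- card L)\<close>. The energy is this
  variance, up to the normalisation \<open>N * \<tau>\<close>, restricted to the positions \<open>J\<close> which are still to be picked.\<close>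
definition energy :: "'w set \<Rightarrow> (nat \<Rightarrow> 'w \<Rightarrow> 'x) \<Rightarrow> real \<Rightarrow> real \<Rightarrow> nat set \<Rightarrow> ('w \<Rightarrow> real) \<Rightarrow> real" where
  "energy \<Omega> pos N \<tau> J w = (\<Sum>L\<in>Pow J - {{}}. N * (1/\<tau>) ^ (card L - 1) * pair_mass \<Omega> pos w L)"

lemma pair_mass_nonneg: "(\<And>a. a \<in> \<Omega> \<Longrightarrow> 0 \<le> w a) \<Longrightarrow> 0 \<le> pair_mass \<Omega> pos w L"
  unfolding pair_mass_def by (intro sum_nonneg mult_nonneg_nonneg) auto

lemma pair_mass_scale:
  "pair_mass \<Omega> pos (\<lambda>a. c * w a) L = c\<^sup>2 * pair_mass \<Omega> pos w L"
  unfolding pair_mass_def by (simp add: sum_distrib_left power2_eq_square algebra_simps)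

lemma energy_insert:
  assumes "finite J" "i \<notin> J"
  shows "energy \<Omega> pos N \<tau> (insert i J) w = energy \<Omega> pos N \<tau> J w
     + (\<Sum>L\<in>Pow J - {{}}. N * (1/\<tau>) ^ card L * pair_mass \<Omega> pos w (insert i L)) + N * pair_mass \<Omega> pos w {i}"
proof -
  define f where "f L = N * (1/\<tau>) ^ (card L - 1) * pair_mass \<Omega> pos w L" for L
  have eq: "Pow (insert i J) - {{}} = (Pow J - {{}}) \<union> insert i ` (Pow J - {{}}) \<union> {{i}}"
    by (auto simp: Pow_insert)
  have inj: "inj_on (insert i) (Pow J - {{}})"
    using assms(2) by (intro inj_onI) (metis Diff_iff PowD in_mono insert_ident)
  have "energy \<Omega> pos N \<tau> (insert i J) w = sum f ((Pow J - {{}}) \<union> insert i ` (Pow J - {{}}) \<union> {{i}})"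
    unfolding energy_def f_def eq ..
  also have "\<dots> = sum f ((Pow J - {{}}) \<union> insert i ` (Pow J - {{}})) + sum f {{i}}"
    using assms by (subst sum.union_disjoint) auto
  also have "sum f ((Pow J - {{}}) \<union> insert i ` (Pow J - {{}})) = sum f (Pow J - {{}}) + sum f (insert i ` (Pow J - {{}}))"
    using assms by (subst sum.union_disjoint) auto
  also have "sum f (insert i ` (Pow J - {{}})) = (\<Sum>L\<in>Pow J - {{}}. f (insert i L))"
    by (subst sum.reindex[OF inj]) simp
  also have "\<dots> = (\<Sum>L\<in>Pow J - {{}}. N * (1/\<tau>) ^ card L * pair_mass \<Omega> pos w (insert i L))"
  proof (intro sum.cong refl)
    fix L assume L: "L \<in> Pow J - {{}}"
    have "finite L" "i \<notin> L" using L assms by (auto intro: finite_subset)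
    then show "f (insert i L) = N * (1/\<tau>) ^ card L * pair_mass \<Omega> pos w (insert i L)"
      by (simp add: f_def)
  qed
  finally show ?thesis by (simp add: f_def energy_def)
qed

text \<open>One uniformly random pick, second moments.\<close>
text \<open>One random pick from \<open>C\<close>. The indicator \<open>of_bool (pos i a = v)\<close> has mean at most \<open>1 / card C \<le> \<kappa>\<close>, so lowering
  the weights \<open>z\<close> uniformly by \<open>\<kappa>\<close> pays for the pick, except where two copies are hit by the same \<open>v\<close>; these
  pairs agree at \<open>i\<close> as well and produce the term for \<open>insert i L\<close>.\<close>
lemma average_pair_mass_pick:
  fixes w :: "'w \<Rightarrow> real" and z :: "'x \<Rightarrow> real"
  assumes fin: "finite \<Omega>" "finite C" and w: "\<And>a. a \<in> \<Omega> \<Longrightarrow> 0 \<le> w a"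
    and z: "\<And>v. \<kappa> \<le> z v" and \<kappa>: "0 \<le> \<kappa>" "1 \<le> real (card C) * \<kappa>"
  shows "(\<Sum>v\<in>C. pair_mass \<Omega> pos (\<lambda>a. w a * (z (pos i a) - \<kappa> + of_bool (pos i a = v))) L)
     \<le> real (card C) * (pair_mass \<Omega> pos (\<lambda>a. w a * z (pos i a)) L + \<kappa> * pair_mass \<Omega> pos w (insert i L))"
proof -
  define e :: "'w \<Rightarrow> 'w \<Rightarrow> real" where "e a b = of_bool (\<forall>l\<in>L. pos l a = pos l b)" for a b
  have pt: "(\<Sum>v\<in>C. (x - \<kappa> + of_bool (p = v)) * (y - \<kappa> + of_bool (q = v)))
      \<le> real (card C) * (x * y + \<kappa> * of_bool (p = q))" if "\<kappa> \<le> x" "\<kappa> \<le> y" for x y :: real and p q :: 'x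
  proof -
    define x' y' where "x' = x - \<kappa>" and "y' = y - \<kappa>"
    have xy: "0 \<le> x'" "0 \<le> y'" using that by (auto simp: x'_def y'_def)
    have s1: "(\<Sum>v\<in>C. of_bool (p = v) :: real) = of_bool (p \<in> C)" for p :: 'x
      using fin(2) by (auto simp: of_bool_def)
    have "(\<Sum>v\<in>C. (x - \<kappa> + of_bool (p = v)) * (y - \<kappa> + of_bool (q = v)))
       = (\<Sum>v\<in>C. x' * y' + y' * of_bool (p = v) + x' * of_bool (q = v) + of_bool (p = q) * of_bool (p = v))"
      by (intro sum.cong refl) (auto simp: x'_def y'_def algebra_simps)
    also have "\<dots> = real (card C) * (x' * y') + y' * of_bool (p \<in> C) + x' * of_bool (q \<in> C) + of_bool (p = q) * of_bool (p \<in> C)"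
      by (simp only: sum.distrib sum_distrib_left[symmetric] s1 sum_constant) (simp add: algebra_simps)
    also have "\<dots> \<le> real (card C) * (x' * y') + y' * (real (card C) * \<kappa>) + x' * (real (card C) * \<kappa>) + of_bool (p = q) * (real (card C) * \<kappa>)"
      using xy \<kappa> by (intro add_mono mult_left_mono order.refl) (auto simp: of_bool_def)
    also have "\<dots> \<le> real (card C) * (x * y + \<kappa> * of_bool (p = q))"
      using \<kappa> by (auto simp: x'_def y'_def algebra_simps of_bool_def)
    finally show ?thesis .
  qed
  have swap3: "(\<Sum>v\<in>C. \<Sum>a\<in>\<Omega>. \<Sum>b\<in>\<Omega>. h v a b) = (\<Sum>a\<in>\<Omega>. \<Sum>b\<in>\<Omega>. \<Sum>v\<in>C. h v a b)" for h :: "'x \<Rightarrow> 'w \<Rightarrow> 'w \<Rightarrow> real"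
    by (subst sum.swap) (intro sum.cong refl sum.swap)
  have "(\<Sum>v\<in>C. pair_mass \<Omega> pos (\<lambda>a. w a * (z (pos i a) - \<kappa> + of_bool (pos i a = v))) L)
      = (\<Sum>a\<in>\<Omega>. \<Sum>b\<in>\<Omega>. (w a * w b * e a b) * (\<Sum>v\<in>C. (z (pos i a) - \<kappa> + of_bool (pos i a = v)) * (z (pos i b) - \<kappa> + of_bool (pos i b = v))))"
    unfolding pair_mass_def e_def[symmetric] swap3
    by (intro sum.cong refl) (simp add: sum_distrib_left algebra_simps)
  also have "\<dots> \<le> (\<Sum>a\<in>\<Omega>. \<Sum>b\<in>\<Omega>. (w a * w b * e a b) * (real (card C) * (z (pos i a) * z (pos i b) + \<kappa> * of_bool (pos i a = pos i b))))"
    by (intro sum_mono mult_left_mono pt z mult_nonneg_nonneg w) (auto simp: e_def)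
  also have "\<dots> = real (card C) * ((\<Sum>a\<in>\<Omega>. \<Sum>b\<in>\<Omega>. (w a * z (pos i a)) * (w b * z (pos i b)) * e a b)
      + \<kappa> * (\<Sum>a\<in>\<Omega>. \<Sum>b\<in>\<Omega>. w a * w b * (e a b * of_bool (pos i a = pos i b))))"
    by (simp add: sum_distrib_left sum.distrib[symmetric] algebra_simps)
  also have "\<dots> = real (card C) * (pair_mass \<Omega> pos (\<lambda>a. w a * z (pos i a)) L + \<kappa> * pair_mass \<Omega> pos w (insert i L))"
    unfolding pair_mass_def e_def by (auto simp: of_bool_def intro!: arg_cong2[where f="(+)"] arg_cong2[where f="(*)"] sum.cong)
  finally show ?thesis .
qed

lemma sum_squares_le_pair_mass:
  fixes w :: "'w \<Rightarrow> real"
  assumes fin: "finite \<Omega>" "finite D" and w: "\<And>a. a \<in> \<Omega> \<Longrightarrow> 0 \<le> w a"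
  shows "(\<Sum>v\<in>D. (\<Sum>a | a \<in> \<Omega> \<and> pos i a = v. w a)\<^sup>2) \<le> pair_mass \<Omega> pos w {i}"
proof -
  define d where "d v = (\<Sum>a | a \<in> \<Omega> \<and> pos i a = v. w a)" for v
  have "(\<Sum>v\<in>D. (d v)\<^sup>2) = (\<Sum>v\<in>D. \<Sum>a | a \<in> \<Omega> \<and> pos i a = v. w a * d v)"
    by (simp add: power2_eq_square d_def sum_distrib_right)
  also have "\<dots> = (\<Sum>v\<in>D. \<Sum>a | a \<in> \<Omega> \<and> pos i a = v. w a * d (pos i a))"
    by (intro sum.cong) auto
  also have "\<dots> = (\<Sum>v\<in>D. \<Sum>a | a \<in> {a\<in>\<Omega>. pos i a \<in> D} \<and> pos i a = v. w a * d (pos i a))"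
    by (intro sum.cong) auto
  also have "\<dots> = (\<Sum>a | a\<in>\<Omega> \<and> pos i a \<in> D. w a * d (pos i a))"
    using fin by (intro sum.group) auto
  also have "\<dots> \<le> (\<Sum>a\<in>\<Omega>. w a * d (pos i a))"
    using fin w by (intro sum_mono2) (auto intro!: mult_nonneg_nonneg sum_nonneg simp: d_def)
  also have "\<dots> = pair_mass \<Omega> pos w {i}"
    unfolding pair_mass_def d_def
  proof (intro sum.cong refl)
    fix a assume "a \<in> \<Omega>"
    have "(\<Sum>b | b \<in> \<Omega> \<and> pos i b = pos i a. w b) = (\<Sum>b\<in>\<Omega>. w b * of_bool (pos i a = pos i b))"
      using fin by (simp add: sum.inter_filter[symmetric] of_bool_def if_distrib eq_commute cong: if_cong)
    then show "w a * (\<Sum>b | b \<in> \<Omega> \<and> pos i b = pos i a. w b) = (\<Sum>b\<in>\<Omega>. w a * w b * of_bool (\<forall>l\<in>{i}. pos l a = pos l b))"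
      by (simp add: sum_distrib_left mult.assoc)
  qed
  finally show ?thesis unfolding d_def .
qed

text \<open>A small set of vertices can only carry much weight by concentrating it, which shows in the pair mass. The AM-GM
  inequality \<open>x \<le> \<eta> N x\<^sup>2 + 1 / (4 \<eta> N)\<close> makes the estimate linear in the pair mass, which is the form that a
  potential function needs.\<close>
lemma mass_on_forbidden_set:
  fixes w :: "'w \<Rightarrow> real"
  assumes fin: "finite \<Omega>" "finite D" and w: "\<And>a. a \<in> \<Omega> \<Longrightarrow> 0 \<le> w a"
    and D: "real (card D) \<le> \<delta> * N" and N: "0 < N" and \<eta>: "0 < \<eta>"
  shows "(\<Sum>a | a \<in> \<Omega> \<and> pos i a \<in> D. w a) \<le> \<eta> * N * pair_mass \<Omega> pos w {i} + \<delta> / (4 * \<eta>)"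
proof -
  define d where "d v = (\<Sum>a | a \<in> \<Omega> \<and> pos i a = v. w a)" for v
  have amgm: "x \<le> \<eta> * N * x\<^sup>2 + 1 / (4 * \<eta> * N)" for x
  proof -
    have "0 \<le> (2 * \<eta> * N * x - 1)\<^sup>2 / (4 * \<eta> * N)" using N \<eta> by simp
    also have "\<dots> = \<eta> * N * x\<^sup>2 - x + 1 / (4 * \<eta> * N)"
      using N \<eta> by (simp add: power2_eq_square field_simps)
    finally show ?thesis by simp
  qed
  have pm: "(\<Sum>v\<in>D. (d v)\<^sup>2) \<le> pair_mass \<Omega> pos w {i}"
    unfolding d_def using fin w by (rule sum_squares_le_pair_mass)
  have "(\<Sum>a | a \<in> \<Omega> \<and> pos i a \<in> D. w a) = (\<Sum>v\<in>D. \<Sum>a | a \<in> {a\<in>\<Omega>. pos i a \<in> D} \<and> pos i a = v. w a)"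
    using fin by (intro sum.group[symmetric]) auto
  also have "\<dots> = (\<Sum>v\<in>D. d v)" unfolding d_def by (intro sum.cong) auto
  also have "\<dots> \<le> (\<Sum>v\<in>D. \<eta> * N * (d v)\<^sup>2 + 1 / (4 * \<eta> * N))"
    by (intro sum_mono amgm)
  also have "\<dots> = \<eta> * N * (\<Sum>v\<in>D. (d v)\<^sup>2) + real (card D) / (4 * \<eta> * N)"
    by (simp add: sum.distrib sum_distrib_left)
  also have "\<dots> \<le> \<eta> * N * pair_mass \<Omega> pos w {i} + (\<delta> * N) / (4 * \<eta> * N)"
    using pm N \<eta> D by (intro add_mono mult_left_mono divide_right_mono) auto
  finally show ?thesis using N by simp
qed

text \<open>If \<open>y\<close> counts how often each vertex was picked among \<open>\<tau> N\<close> picks, dividing by \<open>\<tau>\<close> keeps the total weight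
  unchanged on average.\<close>
definition reweigh :: "(nat \<Rightarrow> 'w \<Rightarrow> 'x) \<Rightarrow> real \<Rightarrow> nat \<Rightarrow> ('x \<Rightarrow> real) \<Rightarrow> ('w \<Rightarrow> real) \<Rightarrow> 'w \<Rightarrow> real" where
  "reweigh pos \<tau> i y w = (\<lambda>a. w a * y (pos i a) / \<tau>)"

text \<open>One phase of the game: \<open>M\<close> picks, all used for position \<open>i\<close>. Before each pick an adversary forbids a set \<open>D\<close> of at
  most \<open>\<delta> N\<close> vertices; \<open>P s S\<close> says that the set \<open>S\<close> is a legal outcome of \<open>s\<close> picks. Random picks outside \<open>D\<close> would keep
  the total weight up to the part lying on \<open>D\<close> and would raise the energy by a bounded factor. The method of
  conditional expectations turns this into deterministic picks. Copies keep positive weight only if their \<open>i\<close>-th vertex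
  was picked.\<close>
lemma greedy_phase:
  fixes P :: "nat \<Rightarrow> 'x set \<Rightarrow> bool" and w :: "'w \<Rightarrow> real" and pos :: "nat \<Rightarrow> 'w \<Rightarrow> 'x"
  assumes fin: "finite \<Omega>" "finite V" "finite J" and i: "i \<notin> J"
    and w: "\<And>a. a \<in> \<Omega> \<Longrightarrow> 0 \<le> w a" and posV: "\<And>a. a \<in> \<Omega> \<Longrightarrow> pos i a \<in> V"
    and N: "N = real (card V)" "0 < N" and M: "0 < M" and \<tau>: "\<tau> = real M / N"
    and \<delta>: "0 \<le> \<delta>" "\<delta> \<le> 1/2" and \<eta>: "0 < \<eta>"
    and step: "\<And>s S. P s S \<Longrightarrow> \<exists>D\<subseteq>V. real (card D) \<le> \<delta> * N \<and> (\<forall>v\<in>V-D. P (Suc s) (insert v S))"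
    and start: "P s0 S0"
  shows "\<exists>S y. P (s0 + M) S \<and> S0 \<subseteq> S \<and> (\<forall>v. 0 \<le> y v) \<and> (\<forall>v. y v \<noteq> 0 \<longrightarrow> v \<in> S) \<and>
     sum (reweigh pos \<tau> i y w) \<Omega> - \<eta> * energy \<Omega> pos N \<tau> J (reweigh pos \<tau> i y w)
      \<ge> sum w \<Omega> - 5 * \<eta> * energy \<Omega> pos N \<tau> (insert i J) w - \<delta> / (4 * \<eta>)"
proof -
  define \<kappa> where "\<kappa> = 2 / N"
  define W0 where "W0 = sum w \<Omega> - (\<eta> * N * pair_mass \<Omega> pos w {i} + \<delta> / (4 * \<eta>))"
  define T where "T y = (\<Sum>a\<in>\<Omega>. w a * y (pos i a))" for y :: "'x \<Rightarrow> real"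
  define U where "U z L = pair_mass \<Omega> pos (\<lambda>a. w a * z (pos i a)) L" for z :: "'x \<Rightarrow> real" and L
  define PL where "PL = Pow J - {{}}"
  define g where "g L = N * (1/\<tau>) ^ (card L - 1) / \<tau>\<^sup>2" for L :: "nat set"
  have \<tau>0: "0 < \<tau>" using N M \<tau> by simp
  have \<kappa>0: "0 < \<kappa>" using N by (simp add: \<kappa>_def)
  have g0: "0 \<le> g L" for L using N \<tau>0 by (simp add: g_def)
  \<comment> \<open>With \<open>m\<close> picks left, each is accounted for by adding \<open>\<kappa> = 2 / N\<close>, an upper bound for the probability
    of any one vertex, to all of \<open>y\<close>; the summand with \<open>insert i L\<close> collects the diagonal terms of the future picks.\<close>
  define G where "G m y = T y / \<tau> + real m / (N * \<tau>) * W0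
     - \<eta> * (\<Sum>L\<in>PL. g L * (U (\<lambda>v. y v + real m * \<kappa>) L + real m * \<kappa> * pair_mass \<Omega> pos w (insert i L)))" for m y
  have pick: "\<exists>v\<in>V-D. G m y \<le> G (m - 1) (\<lambda>u. y u + of_bool (u = v))"
    if D: "D \<subseteq> V" "real (card D) \<le> \<delta> * N" and y: "\<And>v. 0 \<le> y v" and m: "0 < m" for D m and y :: "'x \<Rightarrow> real"
  proof -
    define C where "C = V - D"
    define c where "c = real (card C)"
    have finC: "finite C" using fin by (simp add: C_def)
    have "card C = card V - card D" using D fin by (simp add: C_def card_Diff_subset finite_subset)
    moreover have "card D \<le> card V" using D fin by (simp add: card_mono)
    ultimately have cN: "c = N - real (card D)" by (simp add: c_def N)
    have "\<delta> * N \<le> 1/2 * N" using \<delta> N by (intro mult_right_mono) auto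
    then have c: "N / 2 \<le> c" "c \<le> N" using D cN by auto
    have c0: "0 < c" using c N by linarith
    have c\<kappa>: "1 \<le> c * \<kappa>" using c N by (simp add: \<kappa>_def field_simps)
    define z where "z u = y u + real m * \<kappa>" for u
    have z\<kappa>: "\<kappa> \<le> z u" for u
    proof -
      have "1 * \<kappa> \<le> real m * \<kappa>" using m \<kappa>0 by (intro mult_right_mono) auto
      then show ?thesis using y[of u] by (simp add: z_def)
    qed
    define y' where "y' v = (\<lambda>u. y u + of_bool (u = v))" for v
    have znew: "y' v u + real (m - 1) * \<kappa> = z u - \<kappa> + of_bool (u = v)" for u v
      using m by (simp add: y'_def z_def of_nat_diff algebra_simps)
    have Uavg: "(\<Sum>v\<in>C. U (\<lambda>u. y' v u + real (m - 1) * \<kappa>) L) \<le> c * (U z L + \<kappa> * pair_mass \<Omega> pos w (insert i L))" for L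
      unfolding znew U_def c_def
      using fin(1) finC w z\<kappa> \<kappa>0 c\<kappa> by (intro average_pair_mass_pick) (auto simp: c_def)
    have Tavg: "(\<Sum>v\<in>C. T (y' v)) \<ge> c * T y + c / N * W0"
    proof -
      have "(\<Sum>v\<in>C. T (y' v)) = (\<Sum>v\<in>C. T y + (\<Sum>a\<in>\<Omega>. w a * of_bool (pos i a = v)))"
        by (simp add: T_def y'_def sum.distrib algebra_simps)
      also have "\<dots> = c * T y + (\<Sum>a\<in>\<Omega>. \<Sum>v\<in>C. w a * of_bool (pos i a = v))"
        by (simp add: sum.distrib c_def sum.swap[of _ C])
      also have "(\<Sum>a\<in>\<Omega>. \<Sum>v\<in>C. w a * of_bool (pos i a = v)) = (\<Sum>a\<in>\<Omega>. w a * of_bool (pos i a \<in> C))"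
        using finC by (intro sum.cong refl) (simp add: sum_distrib_left[symmetric] of_bool_def)
      finally have 1: "(\<Sum>v\<in>C. T (y' v)) = c * T y + (\<Sum>a\<in>\<Omega>. w a * of_bool (pos i a \<in> C))" .
      define R where "R = (\<Sum>a\<in>\<Omega>. w a * of_bool (pos i a \<in> C))"
      have R0: "0 \<le> R" unfolding R_def using w by (intro sum_nonneg) auto
      have "(\<Sum>a\<in>\<Omega>. w a * of_bool (pos i a \<in> D)) = (\<Sum>a | a \<in> \<Omega> \<and> pos i a \<in> D. w a)"
        using fin(1) by (auto simp: sum.inter_filter of_bool_def if_distrib cong: if_cong)
      also have "\<dots> \<le> \<eta> * N * pair_mass \<Omega> pos w {i} + \<delta> / (4 * \<eta>)"
        using D fin w N \<eta> by (intro mass_on_forbidden_set) (auto intro: finite_subset)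
      finally have "(\<Sum>a\<in>\<Omega>. w a * of_bool (pos i a \<in> D)) \<le> \<eta> * N * pair_mass \<Omega> pos w {i} + \<delta> / (4 * \<eta>)" .
      moreover have "sum w \<Omega> = R + (\<Sum>a\<in>\<Omega>. w a * of_bool (pos i a \<in> D))"
        unfolding R_def sum.distrib[symmetric] using posV D by (intro sum.cong) (auto simp: C_def)
      ultimately have RW: "W0 \<le> R" by (simp add: W0_def)
      have "c / N * W0 \<le> c / N * R" using RW c0 N by (intro mult_left_mono) auto
      also have "\<dots> \<le> 1 * R" using R0 c N by (intro mult_right_mono) auto
      finally show ?thesis using 1 by (simp add: R_def)
    qed
    have sumG: "c * G m y \<le> (\<Sum>v\<in>C. G (m - 1) (y' v))"
    proof -
      define X where "X L = U z L + real m * \<kappa> * pair_mass \<Omega> pos w (insert i L)" for L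
      have A: "(\<Sum>v\<in>C. \<Sum>L\<in>PL. g L * (U (\<lambda>u. y' v u + real (m - 1) * \<kappa>) L + real (m - 1) * \<kappa> * pair_mass \<Omega> pos w (insert i L)))
          \<le> c * (\<Sum>L\<in>PL. g L * X L)"
      proof -
        have "(\<Sum>v\<in>C. \<Sum>L\<in>PL. g L * (U (\<lambda>u. y' v u + real (m - 1) * \<kappa>) L + real (m - 1) * \<kappa> * pair_mass \<Omega> pos w (insert i L)))
          = (\<Sum>L\<in>PL. g L * ((\<Sum>v\<in>C. U (\<lambda>u. y' v u + real (m - 1) * \<kappa>) L) + c * (real (m - 1) * \<kappa> * pair_mass \<Omega> pos w (insert i L))))"
          by (subst sum.swap) (simp add: sum_distrib_left[symmetric] sum.distrib c_def)
        also have "\<dots> \<le> (\<Sum>L\<in>PL. g L * (c * (U z L + \<kappa> * pair_mass \<Omega> pos w (insert i L)) + c * (real (m - 1) * \<kappa> * pair_mass \<Omega> pos w (insert i L))))"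
          by (intro sum_mono mult_left_mono add_mono Uavg g0 order.refl)
        also have "\<dots> = c * (\<Sum>L\<in>PL. g L * X L)"
          using m by (simp add: sum_distrib_left X_def of_nat_diff algebra_simps)
        finally show ?thesis .
      qed
      have "(c * T y + c / N * W0) / \<tau> \<le> (\<Sum>v\<in>C. T (y' v)) / \<tau>"
        using Tavg \<tau>0 by (intro divide_right_mono) auto
      then have Tdiv: "c * T y / \<tau> + c / N * W0 / \<tau> \<le> (\<Sum>v\<in>C. T (y' v)) / \<tau>"
        by (simp only: add_divide_distrib)
      have "c * G m y = c * T y / \<tau> + c / N * W0 / \<tau> + c * (real (m - 1) / (N * \<tau>) * W0) - \<eta> * (c * (\<Sum>L\<in>PL. g L * X L))"
        using m N \<tau>0 unfolding G_def X_def z_def by (simp add: of_nat_diff field_simps)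
      also have "\<dots> \<le> (\<Sum>v\<in>C. T (y' v)) / \<tau> + c * (real (m - 1) / (N * \<tau>) * W0)
         - \<eta> * (\<Sum>v\<in>C. \<Sum>L\<in>PL. g L * (U (\<lambda>u. y' v u + real (m - 1) * \<kappa>) L + real (m - 1) * \<kappa> * pair_mass \<Omega> pos w (insert i L)))"
        using Tdiv mult_left_mono[OF A, of \<eta>] \<eta> by linarith
      also have "\<dots> = (\<Sum>v\<in>C. G (m - 1) (y' v))"
        unfolding G_def by (simp add: sum.distrib sum_subtractf sum_divide_distrib sum_distrib_left c_def)
      finally show ?thesis .
    qed
    show ?thesis
    proof (rule ccontr)
      assume "\<not> ?thesis"
      then have "\<And>v. v \<in> C \<Longrightarrow> G (m - 1) (y' v) < G m y" by (auto simp: C_def y'_def not_le)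
      moreover have "C \<noteq> {}" using c0 by (auto simp: c_def)
      ultimately have "(\<Sum>v\<in>C. G (m - 1) (y' v)) < (\<Sum>v\<in>C. G m y)"
        using finC by (intro sum_strict_mono) auto
      with sumG show False by (simp add: c_def)
    qed
  qed
  have main: "\<exists>S y. P (s0 + t) S \<and> S0 \<subseteq> S \<and> (\<forall>v. 0 \<le> y v) \<and> (\<forall>v. y v \<noteq> 0 \<longrightarrow> v \<in> S) \<and> G M (\<lambda>_. 0) \<le> G (M - t) y"
    if "t \<le> M" for t
    using that
  proof (induction t)
    case 0
    show ?case using start by (intro exI[of _ S0] exI[of _ "\<lambda>_. 0"]) auto
  next
    case (Suc t)
    then obtain S y where Sy: "P (s0 + t) S" "S0 \<subseteq> S" "\<And>v. 0 \<le> y v" "\<And>v. y v \<noteq> 0 \<Longrightarrow> v \<in> S" "G M (\<lambda>_. 0) \<le> G (M - t) y"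
      by auto
    obtain D where D: "D \<subseteq> V" "real (card D) \<le> \<delta> * N" "\<And>v. v\<in>V-D \<Longrightarrow> P (Suc (s0 + t)) (insert v S)"
      using step[OF Sy(1)] by blast
    obtain v where v: "v \<in> V - D" "G (M - t) y \<le> G (M - t - 1) (\<lambda>u. y u + of_bool (u = v))"
      using pick[OF D(1,2), of y "M - t"] Sy(3) Suc.prems by auto
    show ?case
    proof (intro exI[of _ "insert v S"] exI[of _ "\<lambda>u. y u + of_bool (u = v)"] conjI allI impI)
      show "P (s0 + Suc t) (insert v S)" using D(3)[OF v(1)] by simp
      show "S0 \<subseteq> insert v S" using Sy by auto
      show "0 \<le> y u + of_bool (u = v)" for u using Sy(3)[of u] by simp
      show "u \<in> insert v S" if "y u + of_bool (u = v) \<noteq> 0" for u using that Sy(4)[of u] by (cases "u = v") auto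
      show "G M (\<lambda>_. 0) \<le> G (M - Suc t) (\<lambda>u. y u + of_bool (u = v))" using v Sy(5) by simp
    qed
  qed
  obtain S y where Sy: "P (s0 + M) S" "S0 \<subseteq> S" "\<forall>v. 0 \<le> y v" "\<forall>v. y v \<noteq> 0 \<longrightarrow> v \<in> S" "G M (\<lambda>_. 0) \<le> G 0 y"
    using main[of M] by auto
  have rew: "reweigh pos \<tau> i y w = (\<lambda>a. (1/\<tau>) * (w a * y (pos i a)))"
    by (auto simp: reweigh_def)
  have "G 0 y = sum (reweigh pos \<tau> i y w) \<Omega> - \<eta> * energy \<Omega> pos N \<tau> J (reweigh pos \<tau> i y w)"
    unfolding G_def rew energy_def pair_mass_scale PL_def g_def U_def T_def
    by (simp add: sum_divide_distrib sum_distrib_left power_divide algebra_simps)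
  moreover have "G M (\<lambda>_. 0) = sum w \<Omega> - 5 * \<eta> * energy \<Omega> pos N \<tau> (insert i J) w - \<delta> / (4 * \<eta>)
     + \<eta> * (4 * N * pair_mass \<Omega> pos w {i} + (\<Sum>L\<in>PL. N * (1/\<tau>) ^ (card L - 1) * pair_mass \<Omega> pos w L)
        + 3 * (\<Sum>L\<in>PL. N * (1/\<tau>) ^ card L * pair_mass \<Omega> pos w (insert i L)))"
  proof -
    have M\<kappa>: "real M * \<kappa> = 2 * \<tau>" using N by (simp add: \<tau> \<kappa>_def)
    have U2: "U (\<lambda>v. 2 * \<tau>) L = 4 * \<tau>\<^sup>2 * pair_mass \<Omega> pos w L" for L
      using pair_mass_scale[of \<Omega> pos "2*\<tau>" w L] unfolding U_def by (simp add: mult.commute power_mult_distrib)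
    have gg: "g L * (4 * \<tau>\<^sup>2 * a + 2 * \<tau> * b) = 4 * (N * (1/\<tau>) ^ (card L - 1) * a) + 2 * (N * (1/\<tau>) ^ card L * b)"
      if "L \<in> PL" for L a b
    proof -
      have "finite L" "L \<noteq> {}" using that fin(3) by (auto simp: PL_def intro: finite_subset)
      then obtain q where q: "card L = Suc q" by (metis card_eq_0_iff not0_implies_Suc)
      show ?thesis using \<tau>0 by (simp add: g_def q field_simps power2_eq_square)
    qed
    have MN: "real M / (N * \<tau>) = 1" using N M by (simp add: \<tau>)
    have sm: "(\<Sum>L\<in>PL. g L * (U (\<lambda>v. 0 + real M * \<kappa>) L + real M * \<kappa> * pair_mass \<Omega> pos w (insert i L)))
       = (\<Sum>L\<in>PL. 4 * (N * (1/\<tau>) ^ (card L - 1) * pair_mass \<Omega> pos w L) + 2 * (N * (1/\<tau>) ^ card L * pair_mass \<Omega> pos w (insert i L)))"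
      unfolding M\<kappa> by (intro sum.cong refl) (simp only: add_0 U2 gg)
    have en: "energy \<Omega> pos N \<tau> J w = (\<Sum>L\<in>PL. N * (1/\<tau>) ^ (card L - 1) * pair_mass \<Omega> pos w L)"
      by (simp add: energy_def PL_def)
    define X Y Z where "X = (\<Sum>L\<in>PL. N * (1/\<tau>) ^ (card L - 1) * pair_mass \<Omega> pos w L)"
      and "Y = (\<Sum>L\<in>PL. N * (1/\<tau>) ^ card L * pair_mass \<Omega> pos w (insert i L))" and "Z = N * pair_mass \<Omega> pos w {i}"
    have "G M (\<lambda>_. 0) = W0 - \<eta> * (4 * X + 2 * Y)"
      unfolding G_def sm MN X_def Y_def by (simp add: T_def sum.distrib sum_distrib_left)
    moreover have "energy \<Omega> pos N \<tau> (insert i J) w = X + Y + Z"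
      unfolding energy_insert[OF fin(3) i] en PL_def[symmetric] X_def Y_def Z_def by simp
    moreover have "W0 = sum w \<Omega> - (\<eta> * Z + \<delta> / (4 * \<eta>))" by (simp add: W0_def Z_def)
    ultimately show ?thesis unfolding X_def[symmetric] Y_def[symmetric] mult.assoc[of 4 N] Z_def[symmetric]
      by (simp add: algebra_simps)
  qed
  moreover have "0 \<le> \<eta> * (4 * N * pair_mass \<Omega> pos w {i} + (\<Sum>L\<in>PL. N * (1/\<tau>) ^ (card L - 1) * pair_mass \<Omega> pos w L)
        + 3 * (\<Sum>L\<in>PL. N * (1/\<tau>) ^ card L * pair_mass \<Omega> pos w (insert i L)))"
    using \<eta> N \<tau>0 by (intro mult_nonneg_nonneg add_nonneg_nonneg sum_nonneg pair_mass_nonneg w) auto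
  ultimately show ?thesis using Sy by (intro exI[of _ S] exI[of _ y]) auto
qed

text \<open>Playing one phase for each of the positions \<open>0, \<dots>, k - 2\<close> leaves weight only on copies whose first \<open>k - 1\<close> vertices
  have all been picked. The potential, total weight minus \<open>5 ^ (k - j) * \<eta>\<close> times the energy of the remaining
  positions, drops by at most \<open>\<delta> / (4 * \<eta>)\<close> per phase, so a positive proportion of the weight survives while the pair mass
  at the last position stays small. By Cauchy-Schwarz this weight is spread over at least \<open>\<delta> N\<close> last vertices.\<close>
lemma blocking_game:
  fixes P :: "nat \<Rightarrow> 'x set \<Rightarrow> bool" and w :: "'w \<Rightarrow> real" and pos :: "nat \<Rightarrow> 'w \<Rightarrow> 'x"
  assumes fin: "finite \<Omega>" "finite V" and k: "2 \<le> k"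
    and w: "\<And>a. a \<in> \<Omega> \<Longrightarrow> 0 \<le> w a" and posV: "\<And>i a. i < k \<Longrightarrow> a \<in> \<Omega> \<Longrightarrow> pos i a \<in> V"
    and N: "N = real (card V)" "0 < N" and M: "0 < M" and \<tau>: "\<tau> = real M / N"
    and \<delta>: "0 \<le> \<delta>" "\<delta> \<le> 1/2" and \<eta>: "0 < \<eta>"
    and W: "\<omega> \<le> sum w \<Omega>" "0 < \<omega>" and E: "5 ^ k * \<eta> * energy \<Omega> pos N \<tau> {..<k} w \<le> \<omega> / 4"
    and \<delta>\<eta>: "real k * \<delta> \<le> \<eta> * \<omega>"
    and step: "\<And>s S. P s S \<Longrightarrow> \<exists>D\<subseteq>V. real (card D) \<le> \<delta> * N \<and> (\<forall>v\<in>V-D. P (Suc s) (insert v S))"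
    and start: "P 0 {}"
  shows "\<exists>S. P ((k - 1) * M) S \<and>
     \<delta> * N \<le> real (card {u\<in>V. \<exists>a\<in>\<Omega>. w a \<noteq> 0 \<and> (\<forall>i<k-1. pos i a \<in> S) \<and> pos (k-1) a = u})"
proof -
  have \<tau>0: "0 < \<tau>" using N M \<tau> by simp
  have phases: "\<exists>S w'. P (j * M) S \<and> (\<forall>a\<in>\<Omega>. 0 \<le> w' a \<and> (w' a \<noteq> 0 \<longrightarrow> w a \<noteq> 0 \<and> (\<forall>i<j. pos i a \<in> S))) \<and>
     sum w \<Omega> - 5 ^ k * \<eta> * energy \<Omega> pos N \<tau> {..<k} w - real j * (\<delta> / (4 * \<eta>))
      \<le> sum w' \<Omega> - 5 ^ (k - j) * \<eta> * energy \<Omega> pos N \<tau> {j..<k} w'" if "j \<le> k" for j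
    using that
  proof (induction j)
    case 0
    show ?case using start w by (intro exI[of _ "{}"] exI[of _ w]) (auto simp: lessThan_atLeast0)
  next
    case (Suc j)
    then obtain S w' where Sw: "P (j * M) S" "\<And>a. a \<in> \<Omega> \<Longrightarrow> 0 \<le> w' a"
      "\<And>a. a \<in> \<Omega> \<Longrightarrow> w' a \<noteq> 0 \<Longrightarrow> w a \<noteq> 0 \<and> (\<forall>i<j. pos i a \<in> S)"
      "sum w \<Omega> - 5 ^ k * \<eta> * energy \<Omega> pos N \<tau> {..<k} w - real j * (\<delta> / (4 * \<eta>))
      \<le> sum w' \<Omega> - 5 ^ (k - j) * \<eta> * energy \<Omega> pos N \<tau> {j..<k} w'" by fastforce
    define \<eta>' where "\<eta>' = 5 ^ (k - Suc j) * \<eta>"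
    have \<eta>': "\<eta> \<le> \<eta>'" using \<eta> by (simp add: \<eta>'_def)
    have ins: "insert j {Suc j..<k} = {j..<k}" using Suc.prems by auto
    obtain S' y where Sy: "P (j * M + M) S'" "S \<subseteq> S'" "\<forall>v. 0 \<le> y v" "\<forall>v. y v \<noteq> 0 \<longrightarrow> v \<in> S'"
      "sum w' \<Omega> - 5 * \<eta>' * energy \<Omega> pos N \<tau> {j..<k} w' - \<delta> / (4 * \<eta>')
       \<le> sum (reweigh pos \<tau> j y w') \<Omega> - \<eta>' * energy \<Omega> pos N \<tau> {Suc j..<k} (reweigh pos \<tau> j y w')"
      using greedy_phase[where J="{Suc j..<k}" and i=j and w=w' and \<Omega>=\<Omega> and V=V and P=P and \<eta>=\<eta>' and pos=pos and \<delta>=\<delta>,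
        OF fin _ _ Sw(2) posV N M \<tau> \<delta> _ step Sw(1)] \<eta> \<eta>' Suc.prems unfolding ins by auto
    have "\<delta> / (4 * \<eta>') \<le> \<delta> / (4 * \<eta>)" using \<delta> \<eta> \<eta>' by (intro divide_left_mono) auto
    moreover have e5: "5 * \<eta>' = 5 ^ (k - j) * \<eta>" using Suc.prems by (simp add: \<eta>'_def Suc_diff_Suc[symmetric])
    moreover have "real (Suc j) * (\<delta> / (4 * \<eta>)) = real j * (\<delta> / (4 * \<eta>)) + \<delta> / (4 * \<eta>)"
      by (simp only: of_nat_Suc distrib_right mult_1_left add.commute)
    ultimately have "sum w \<Omega> - 5 ^ k * \<eta> * energy \<Omega> pos N \<tau> {..<k} w - real (Suc j) * (\<delta> / (4 * \<eta>))
       \<le> sum (reweigh pos \<tau> j y w') \<Omega> - \<eta>' * energy \<Omega> pos N \<tau> {Suc j..<k} (reweigh pos \<tau> j y w')"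
      using Sw(4) Sy(5)[unfolded e5] by linarith
    moreover have "0 \<le> reweigh pos \<tau> j y w' a" if "a \<in> \<Omega>" for a
      using that Sw(2) Sy(3) \<tau>0 by (simp add: reweigh_def)
    moreover have "w a \<noteq> 0 \<and> (\<forall>i<Suc j. pos i a \<in> S')" if "a \<in> \<Omega>" "reweigh pos \<tau> j y w' a \<noteq> 0" for a
    proof -
      have "w' a \<noteq> 0" "y (pos j a) \<noteq> 0" using that by (auto simp: reweigh_def)
      then show ?thesis using Sw(3)[OF that(1)] Sy(2,4) by (auto simp: less_Suc_eq)
    qed
    ultimately show ?case using Sy(1) unfolding \<eta>'_def
      by (intro exI[of _ S'] exI[of _ "reweigh pos \<tau> j y w'"]) (simp add: add.commute)
  qed
  obtain S w' where Sw: "P ((k-1) * M) S" "\<And>a. a \<in> \<Omega> \<Longrightarrow> 0 \<le> w' a"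
      "\<And>a. a \<in> \<Omega> \<Longrightarrow> w' a \<noteq> 0 \<Longrightarrow> w a \<noteq> 0 \<and> (\<forall>i<k-1. pos i a \<in> S)"
      "sum w \<Omega> - 5 ^ k * \<eta> * energy \<Omega> pos N \<tau> {..<k} w - real (k-1) * (\<delta> / (4 * \<eta>))
      \<le> sum w' \<Omega> - 5 ^ (k - (k-1)) * \<eta> * energy \<Omega> pos N \<tau> {k-1..<k} w'"
    using phases[of "k-1"] by fastforce
  define B where "B = {u\<in>V. \<exists>a\<in>\<Omega>. w a \<noteq> 0 \<and> (\<forall>i<k-1. pos i a \<in> S) \<and> pos (k-1) a = u}"
  define d where "d v = (\<Sum>a | a \<in> \<Omega> \<and> pos (k-1) a = v. w' a)" for v
  define Q where "Q = pair_mass \<Omega> pos w' {k-1}"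
  have kk: "{k-1..<k} = {k-1}" using k by auto
  have en: "energy \<Omega> pos N \<tau> {k-1..<k} w' = N * Q"
  proof -
    have "Pow {k-1} - {{}} = {{k-1}}" by auto
    then show ?thesis unfolding kk energy_def Q_def by simp
  qed
  have Q0: "0 \<le> Q" unfolding Q_def using Sw(2) by (intro pair_mass_nonneg) auto
  have kd: "real (k-1) * (\<delta> / (4 * \<eta>)) \<le> \<omega> / 4"
  proof -
    have "real (k-1) * \<delta> \<le> real k * \<delta>" using \<delta> by (intro mult_right_mono) auto
    then have "real (k-1) * \<delta> \<le> \<eta> * \<omega>" using \<delta>\<eta> by linarith
    then show ?thesis using \<eta> by (simp add: field_simps)
  qed
  have fW: "\<omega> / 2 \<le> sum w' \<Omega> - 5 * \<eta> * (N * Q)"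
    using Sw(4) kd E W(1) k unfolding en by simp
  have sumd: "sum w' \<Omega> = (\<Sum>v\<in>B. d v)"
  proof -
    have "sum w' \<Omega> = (\<Sum>v\<in>V. d v)"
      unfolding d_def using fin posV[of "k-1"] k by (intro sum.group[symmetric]) auto
    also have "\<dots> = (\<Sum>v\<in>B. d v)"
    proof (intro sum.mono_neutral_right ballI)
      fix v assume v: "v \<in> V - B"
      have "w' a = 0" if "a \<in> \<Omega>" "pos (k-1) a = v" for a
        using Sw(3)[OF that(1)] that v unfolding B_def by auto
      then show "d v = 0" by (simp add: d_def)
    qed (auto simp: B_def fin)
    finally show ?thesis .
  qed
  have sqd: "(\<Sum>v\<in>B. (d v)\<^sup>2) \<le> Q"
    unfolding d_def Q_def using fin Sw(2) by (intro sum_squares_le_pair_mass) (auto simp: B_def)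
  have "(sum w' \<Omega>)\<^sup>2 \<le> real (card B) * Q"
  proof -
    have "(sum w' \<Omega>)\<^sup>2 = (\<Sum>v\<in>B. 1 * d v)\<^sup>2" by (simp add: sumd)
    also have "\<dots> \<le> (\<Sum>v\<in>B. 1\<^sup>2) * (\<Sum>v\<in>B. (d v)\<^sup>2)" by (rule Cauchy_Schwarz_ineq_sum)
    also have "\<dots> \<le> real (card B) * Q" using sqd by (simp add: mult_left_mono)
    finally show ?thesis .
  qed
  moreover have "5 * \<eta> * (N * Q) \<le> sum w' \<Omega>" using fW W by linarith
  moreover have W2: "\<omega> / 2 \<le> sum w' \<Omega>"
    using fW Q0 \<eta> N(2) by (smt (verit) mult_nonneg_nonneg)
  ultimately have "5 * \<eta> * N * (sum w' \<Omega>)\<^sup>2 \<le> real (card B) * sum w' \<Omega>"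
  proof -
    assume a: "(sum w' \<Omega>)\<^sup>2 \<le> real (card B) * Q" and b: "5 * \<eta> * (N * Q) \<le> sum w' \<Omega>"
    have "5 * \<eta> * N * (sum w' \<Omega>)\<^sup>2 \<le> 5 * \<eta> * N * (real (card B) * Q)"
      using a \<eta> N(2) by (intro mult_left_mono) auto
    also have "\<dots> = real (card B) * (5 * \<eta> * (N * Q))" by simp
    also have "\<dots> \<le> real (card B) * sum w' \<Omega>" using b by (intro mult_left_mono) auto
    finally show ?thesis .
  qed
  then have "(5 * \<eta> * N * sum w' \<Omega>) * sum w' \<Omega> \<le> real (card B) * sum w' \<Omega>" by (simp add: power2_eq_square mult.assoc)
  then have "5 * \<eta> * N * sum w' \<Omega> \<le> real (card B)" using W2 W(2) by (simp add: mult_le_cancel_right)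
  moreover have "\<delta> * N \<le> 5 * \<eta> * N * sum w' \<Omega>"
  proof -
    have "\<delta> \<le> real k * \<delta>" using k \<delta> mult_right_mono[of 1 "real k" \<delta>] by simp
    also have "\<dots> \<le> \<eta> * \<omega>" by fact
    also have "\<dots> \<le> \<eta> * (2 * sum w' \<Omega>)" using W2 \<eta> by (intro mult_left_mono) auto
    also have "\<dots> \<le> 5 * \<eta> * sum w' \<Omega>" using W2 W(2) \<eta> by simp
    finally have "\<delta> * N \<le> 5 * \<eta> * sum w' \<Omega> * N" using N(2) by (intro mult_right_mono) auto
    then show ?thesis by (simp add: mult_ac)
  qed
  ultimately show ?thesis using Sw(1) unfolding B_def by (intro exI[of _ S]) auto
qed

text \<open>The partition function of the hard-core type model on the family \<open>\<I>\<close> at activity \<open>q\<close>, restricted to the sets which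
  contain \<open>S\<close> and lie in \<open>C\<close>.\<close>
definition activity_sum :: "'x set set \<Rightarrow> real \<Rightarrow> 'x set \<Rightarrow> 'x set \<Rightarrow> real" where
  "activity_sum \<I> q S C = (\<Sum>A | A \<in> \<I> \<and> S \<subseteq> A \<and> A \<subseteq> C. q ^ card A)"

lemma activity_sum_nonneg: "0 \<le> q \<Longrightarrow> 0 \<le> activity_sum \<I> q S C"
  unfolding activity_sum_def by (intro sum_nonneg) auto

lemma finite_activity: "finite C \<Longrightarrow> finite {A. A \<in> \<I> \<and> S \<subseteq> A \<and> A \<subseteq> C}"
  by (rule finite_subset[of _ "Pow C"]) auto

lemma activity_sum_mono: "finite C' \<Longrightarrow> 0 \<le> q \<Longrightarrow> C \<subseteq> C' \<Longrightarrow> activity_sum \<I> q S C \<le> activity_sum \<I> q S C'"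
  unfolding activity_sum_def by (intro sum_mono2 finite_activity) auto

lemma activity_sum_split:
  assumes "finite C"
  shows "activity_sum \<I> q S C = activity_sum \<I> q S (C - {v}) + activity_sum \<I> q (insert v S) C"
proof -
  have "{A. A \<in> \<I> \<and> S \<subseteq> A \<and> A \<subseteq> C} = {A. A \<in> \<I> \<and> S \<subseteq> A \<and> A \<subseteq> C - {v}} \<union> {A. A \<in> \<I> \<and> insert v S \<subseteq> A \<and> A \<subseteq> C}"
    by auto
  then show ?thesis unfolding activity_sum_def
    by (simp only:, intro sum.union_disjoint finite_activity) (use assms in auto)
qed

text \<open>Removing \<open>S\<close> from a member of a family closed under subsets gives another member, and each \<open>A \<supseteq> S\<close> is recovered from
  \<open>A - S\<close>. Conditioning on \<open>S\<close> therefore gains a factor \<open>q ^ card S\<close>.\<close>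
lemma activity_sum_link:
  assumes down: "\<And>A B. A \<in> \<I> \<Longrightarrow> B \<subseteq> A \<Longrightarrow> B \<in> \<I>" and C: "finite C" and q: "0 \<le> q"
  shows "activity_sum \<I> q S C \<le> q ^ card S * activity_sum \<I> q {} C"
proof -
  define \<A> where "\<A> = {A. A \<in> \<I> \<and> S \<subseteq> A \<and> A \<subseteq> C}"
  have inj: "inj_on (\<lambda>A. A - S) \<A>" by (rule inj_onI) (auto simp: \<A>_def)
  have "activity_sum \<I> q S C = (\<Sum>A\<in>\<A>. q ^ card S * q ^ card (A - S))"
    unfolding activity_sum_def \<A>_def[symmetric]
  proof (intro sum.cong refl)
    fix A assume "A \<in> \<A>"
    then have "S \<subseteq> A" "finite A" using C by (auto simp: \<A>_def intro: finite_subset)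
    then have "card A = card S + card (A - S)"
      by (metis card_Diff_subset card_mono finite_subset le_add_diff_inverse)
    then show "q ^ card A = q ^ card S * q ^ card (A - S)" by (simp add: power_add)
  qed
  also have "\<dots> = q ^ card S * (\<Sum>A\<in>(\<lambda>A. A - S) ` \<A>. q ^ card A)"
    by (simp add: sum.reindex[OF inj] sum_distrib_left)
  also have "(\<Sum>A\<in>(\<lambda>A. A - S) ` \<A>. q ^ card A) \<le> activity_sum \<I> q {} C"
    unfolding activity_sum_def using C q by (intro sum_mono2 finite_activity) (auto simp: \<A>_def intro: down)
  finally show ?thesis using q by (simp add: mult_left_mono)
qed

text \<open>The adversary of the game is played by the partition function. Starting from \<open>S = D = {}\<close>, a vertex whose marginal given
  \<open>S\<close> is below \<open>\<tau>\<close> is moved to the discarded set \<open>D\<close>, losing a factor \<open>1 - \<tau>\<close>, while any other vertex may be added to \<open>S\<close>,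
  losing a factor \<open>\<tau>\<close> that is nearly recovered through \<open>activity_sum_link\<close>. As \<open>card D \<le> N\<close> and \<open>card S \<le> k * M\<close>, the total
  loss is at most \<open>exp (M * (2 + k * ln (q / \<tau>)))\<close>. Either \<open>D\<close> reaches size \<open>\<delta> N\<close>, or the picks can follow
  \<open>blocking_game\<close>; then no member of \<open>\<I>\<close> that contains \<open>S\<close> meets the set of last vertices, which is large and is removed.\<close>
theorem container_step:
  fixes w :: "'w \<Rightarrow> real" and pos :: "nat \<Rightarrow> 'w \<Rightarrow> 'x" and \<I> :: "'x set set"
  assumes fin: "finite \<Omega>" "finite X" "V \<subseteq> X" and k: "2 \<le> k"
    and w: "\<And>a. a \<in> \<Omega> \<Longrightarrow> 0 \<le> w a" and posV: "\<And>i a. i < k \<Longrightarrow> a \<in> \<Omega> \<Longrightarrow> pos i a \<in> V"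
    and N: "N = real (card V)" "0 < N" and M: "0 < M" and \<tau>: "\<tau> = real M / N" "\<tau> \<le> 1/2" "\<tau> \<le> q"
    and \<delta>: "0 \<le> \<delta>" "\<delta> \<le> 1/2" and \<eta>: "0 < \<eta>"
    and W: "\<omega> \<le> sum w \<Omega>" "0 < \<omega>" and E: "5 ^ k * \<eta> * energy \<Omega> pos N \<tau> {..<k} w \<le> \<omega> / 4"
    and \<delta>\<eta>: "real k * \<delta> \<le> \<eta> * \<omega>"
    and down: "\<And>A B. A \<in> \<I> \<Longrightarrow> B \<subseteq> A \<Longrightarrow> B \<in> \<I>"
    and indep: "\<And>a. a \<in> \<Omega> \<Longrightarrow> w a \<noteq> 0 \<Longrightarrow> (\<lambda>i. pos i a) ` {..<k} \<notin> \<I>"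
  shows "\<exists>Y\<subseteq>X. \<delta> * N \<le> real (card (X - Y)) \<and>
     activity_sum \<I> q {} X \<le> exp (real M * (2 + real k * ln (q / \<tau>))) * activity_sum \<I> q {} Y"
proof (rule ccontr)
  assume neg: "\<not> ?thesis"
  have \<tau>0: "0 < \<tau>" using N M \<tau> by simp
  have q0: "0 < q" using \<tau>0 \<tau> by linarith
  have finV: "finite V" using fin finite_subset by blast
  \<comment> \<open>the loss accumulated when \<open>S\<close> has been picked and \<open>D\<close> discarded\<close>
  define c where "c S D = (1/\<tau>) ^ card S * (1/(1-\<tau>)) ^ card D" for S D :: "'x set"
  define R where "R s S D \<longleftrightarrow> S \<subseteq> V \<and> D \<subseteq> V \<and> card S \<le> s \<and> real (card D) \<le> \<delta> * N \<and>
     activity_sum \<I> q {} X \<le> c S D * activity_sum \<I> q S (X - D)" for s S D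
  have c0: "0 \<le> c S D" for S D using \<tau>(2) \<tau>0 by (simp add: c_def)
  have cost: "c S D * q ^ card S \<le> exp (real M * (2 + real k * ln (q / \<tau>)))" if "D \<subseteq> V" "card S \<le> k * M" for S D
  proof -
    have l2: "1 / (1 - \<tau>) \<le> exp (2 * \<tau>)"
    proof -
      have "0 \<le> \<tau> * (1 - 2 * \<tau>)" using \<tau>0 \<tau>(2) by (intro mult_nonneg_nonneg) auto
      then have "1 / (1 - \<tau>) \<le> 1 + 2 * \<tau>" using \<tau>0 \<tau>(2) by (simp add: pos_divide_le_eq algebra_simps)
      also have "\<dots> \<le> exp (2 * \<tau>)" by (rule exp_ge_add_one_self)
      finally show ?thesis .
    qed
    have "(1/(1-\<tau>)) ^ card D \<le> exp (2 * \<tau>) ^ card D"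
      using \<tau>0 \<tau>(2) by (intro power_mono[OF l2]) auto
    also have "\<dots> = exp (2 * \<tau> * real (card D))" by (simp add: exp_of_nat_mult[symmetric] mult.commute)
    also have "\<dots> \<le> exp (2 * \<tau> * N)" using that(1) finV \<tau>0 N by (simp add: card_mono)
    also have "2 * \<tau> * N = real M * 2" using \<tau> N by simp
    finally have A: "(1/(1-\<tau>)) ^ card D \<le> exp (real M * 2)" .
    have "(q/\<tau>) ^ card S \<le> (q/\<tau>) ^ (k * M)" using \<tau>0 \<tau>(3) that by (intro power_increasing) auto
    also have "\<dots> = exp (ln (q/\<tau>)) ^ (k * M)" using q0 \<tau>0 by simp
    also have "\<dots> = exp (real M * (real k * ln (q/\<tau>)))" by (simp only: exp_of_nat_mult[symmetric]) (simp add: mult_ac)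
    finally have B: "(q/\<tau>) ^ card S \<le> exp (real M * (real k * ln (q/\<tau>)))" .
    have "c S D * q ^ card S = (1/(1-\<tau>)) ^ card D * (q/\<tau>) ^ card S" by (simp add: c_def power_divide)
    also have "\<dots> \<le> exp (real M * 2) * exp (real M * (real k * ln (q/\<tau>)))"
      using A B q0 \<tau>0 by (intro mult_mono) auto
    also have "\<dots> = exp (real M * (2 + real k * ln (q/\<tau>)))" by (simp add: exp_add[symmetric] distrib_left)
    finally show ?thesis .
  qed
  have stop: "real (card (X - Y)) < \<delta> * N" if "Y \<subseteq> X" "D \<subseteq> V" "card S \<le> k * M" "activity_sum \<I> q {} X \<le> c S D * activity_sum \<I> q S Y" for S D Y
  proof (rule ccontr)
    assume a: "\<not> real (card (X - Y)) < \<delta> * N"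
    have fY: "finite Y" using that(1) fin finite_subset by blast
    have link: "activity_sum \<I> q S Y \<le> q ^ card S * activity_sum \<I> q {} Y"
      using down fY q0 by (intro activity_sum_link) auto
    have "activity_sum \<I> q {} X \<le> c S D * (q ^ card S * activity_sum \<I> q {} Y)"
      using that(4) mult_left_mono[OF link c0[of S D]] by linarith
    also have "\<dots> \<le> exp (real M * (2 + real k * ln (q / \<tau>))) * activity_sum \<I> q {} Y"
      unfolding mult.assoc[symmetric] using cost[OF that(2,3)] q0 by (intro mult_right_mono activity_sum_nonneg) auto
    finally show False using neg a that(1) by auto
  qed
  \<comment> \<open>Beyond \<open>k * M\<close> picks the position is declared legal, which makes the game total without affecting its first
    \<open>(k - 1) * M\<close> rounds.\<close>
  define P where "P s S \<longleftrightarrow> (s \<le> k * M \<longrightarrow> (\<exists>D. R s S D))" for s S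
  have start: "P 0 {}" using N \<delta> by (auto simp: P_def R_def c_def intro!: exI[of _ "{}"])
  have step: "\<exists>D\<subseteq>V. real (card D) \<le> \<delta> * N \<and> (\<forall>v\<in>V-D. P (Suc s) (insert v S))" if PsS: "P s S" for s S
  proof (cases "Suc s \<le> k * M")
    case False
    then show ?thesis using N \<delta> by (intro exI[of _ "{}"]) (auto simp: P_def)
  next
    case True
    then obtain D0 where "R s S D0" using PsS by (auto simp: P_def)
    moreover have "\<forall>D. R s S D \<longrightarrow> card D < Suc (card V)" using finV by (auto simp: R_def less_Suc_eq_le intro: card_mono)
    \<comment> \<open>A discarded set of maximal size leaves only vertices of marginal at least \<open>\<tau>\<close> outside it.\<close>
    ultimately have "\<exists>D. R s S D \<and> (\<forall>D'. R s S D' \<longrightarrow> card D' \<le> card D)"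
      by (rule Lattices_Big.ex_has_greatest_nat)
    then obtain D where D: "R s S D" "\<And>D'. R s S D' \<Longrightarrow> card D' \<le> card D" by auto
    have DV: "D \<subseteq> V" "S \<subseteq> V" "card S \<le> s" "real (card D) \<le> \<delta> * N"
      "activity_sum \<I> q {} X \<le> c S D * activity_sum \<I> q S (X - D)" using D(1) by (auto simp: R_def)
    have finS: "finite S" "finite D" using DV finV finite_subset by blast+
    have "R (Suc s) (insert v S) D" if v: "v \<in> V - D" for v
    proof (cases "v \<in> S")
      case True
      then show ?thesis using D(1) by (auto simp: R_def insert_absorb)
    next
      case vS: False
      have sp: "activity_sum \<I> q S (X - D) = activity_sum \<I> q S (X - insert v D) + activity_sum \<I> q (insert v S) (X - D)"
        using activity_sum_split[of "X - D" \<I> q S v] fin by (simp add: Diff_insert[symmetric])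
      have "\<not> activity_sum \<I> q (insert v S) (X - D) < \<tau> * activity_sum \<I> q S (X - D)"
      proof
        assume "activity_sum \<I> q (insert v S) (X - D) < \<tau> * activity_sum \<I> q S (X - D)"
        then have "(1 - \<tau>) * activity_sum \<I> q S (X - D) \<le> activity_sum \<I> q S (X - insert v D)"
          using sp by (simp add: algebra_simps)
        then have "activity_sum \<I> q S (X - D) \<le> 1 / (1 - \<tau>) * activity_sum \<I> q S (X - insert v D)"
          using \<tau>(2) by (simp add: pos_le_divide_eq mult.commute)
        then have "c S D * activity_sum \<I> q S (X - D) \<le> c S D * (1 / (1 - \<tau>) * activity_sum \<I> q S (X - insert v D))"
          using c0 by (intro mult_left_mono) auto
        also have "\<dots> = c S (insert v D) * activity_sum \<I> q S (X - insert v D)"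
          using v finS by (simp add: c_def)
        finally have ub: "activity_sum \<I> q {} X \<le> c S (insert v D) * activity_sum \<I> q S (X - insert v D)"
          using DV(5) by linarith
        have "X - (X - insert v D) = insert v D" using DV v fin(3) by auto
        then have "real (card (insert v D)) < \<delta> * N"
          using stop[of "X - insert v D" "insert v D" S] ub DV v True by auto
        then have "R s S (insert v D)" using ub DV v by (auto simp: R_def)
        then show False using D(2) v finS by fastforce
      qed
      then have le: "activity_sum \<I> q S (X - D) \<le> 1 / \<tau> * activity_sum \<I> q (insert v S) (X - D)"
        using \<tau>0 by (simp add: field_simps)
      have "c S D * activity_sum \<I> q S (X - D) \<le> c S D * (1 / \<tau> * activity_sum \<I> q (insert v S) (X - D))"
        using c0 le by (intro mult_left_mono) auto
      also have "\<dots> = c (insert v S) D * activity_sum \<I> q (insert v S) (X - D)"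
        using vS finS by (simp add: c_def)
      finally have "activity_sum \<I> q {} X \<le> c (insert v S) D * activity_sum \<I> q (insert v S) (X - D)"
        using DV(5) by linarith
      then show ?thesis using DV v vS finS by (auto simp: R_def)
    qed
    then show ?thesis using DV by (intro exI[of _ D]) (auto simp: P_def)
  qed
  obtain S where S: "P ((k - 1) * M) S"
    "\<delta> * N \<le> real (card {u\<in>V. \<exists>a\<in>\<Omega>. w a \<noteq> 0 \<and> (\<forall>i<k-1. pos i a \<in> S) \<and> pos (k-1) a = u})"
    using blocking_game[where P=P, OF fin(1) finV k w posV N M \<tau>(1) \<delta> \<eta> W E \<delta>\<eta> step start] by auto
  define B where "B = {u\<in>V. \<exists>a\<in>\<Omega>. w a \<noteq> 0 \<and> (\<forall>i<k-1. pos i a \<in> S) \<and> pos (k-1) a = u}"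
  have km: "(k - 1) * M \<le> k * M" by simp
  obtain D where D: "R ((k - 1) * M) S D" using S(1) km by (auto simp: P_def)
  have dis: "A \<inter> B = {}" if "A \<in> \<I>" "S \<subseteq> A" for A
  proof (rule ccontr)
    assume "A \<inter> B \<noteq> {}"
    then obtain a where a: "a \<in> \<Omega>" "w a \<noteq> 0" "\<And>i. i < k - 1 \<Longrightarrow> pos i a \<in> S" "pos (k-1) a \<in> A"
      by (auto simp: B_def)
    have "(\<lambda>i. pos i a) ` {..<k} \<subseteq> A"
    proof (clarify)
      fix i assume "i < k"
      then show "pos i a \<in> A" using a(3)[of i] a(4) that(2) by (cases "i = k - 1") auto
    qed
    then show False using indep[OF a(1,2)] down[OF that(1)] by auto
  qed
  have "activity_sum \<I> q S (X - D) = activity_sum \<I> q S (X - (D \<union> B))"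
    unfolding activity_sum_def by (intro sum.cong) (use dis in auto)
  then have "real (card (X - (X - (D \<union> B)))) < \<delta> * N"
    using D le_trans[OF _ km] by (intro stop[of _ D S]) (auto simp: R_def simp del: One_nat_def)
  moreover have "card B \<le> card (X - (X - (D \<union> B)))"
    using fin by (intro card_mono) (auto simp: B_def)
  ultimately show False using S(2) unfolding B_def[symmetric] by linarith
qed

section \<open>Weighted copies of a rooted bipartite graph\<close>

text \<open>Choosing the values one at a time, at most \<open>card I + card Z\<close> of the candidates are excluded, which is never more than
  half of them.\<close>
lemma card_injective_choices:
  fixes A :: "'i \<Rightarrow> 'v set"
  assumes "finite I" "finite Z" "\<And>i. i \<in> I \<Longrightarrow> finite (A i) \<and> 2 * (card I + card Z) \<le> card (A i)"
  shows "(\<Prod>i\<in>I. real (card (A i)) / 2) \<le> real (card {g \<in> PiE I A. inj_on g I \<and> g ` I \<inter> Z = {}})"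
  using assms(1,3)
proof (induction I rule: finite_induct)
  case empty
  then show ?case by simp
next
  case (insert i I)
  define Gd where "Gd I = {g \<in> PiE I A. inj_on g I \<and> g ` I \<inter> Z = {}}" for I
  have finG: "finite (Gd J)" if "J \<subseteq> insert i I" for J
    unfolding Gd_def using insert that by (intro finite_Collect_conjI disjI1) (auto intro!: finite_PiE intro: finite_subset)
  define h where "h = (\<lambda>(g, a). (g :: 'i \<Rightarrow> 'v)(i := a))"
  have inj: "inj_on h (Sigma (Gd I) (\<lambda>g. A i - (Z \<union> g ` I)))"
  proof (rule inj_onI)
    fix ga ga' assume p: "ga \<in> Sigma (Gd I) (\<lambda>g. A i - (Z \<union> g ` I))" "ga' \<in> Sigma (Gd I) (\<lambda>g. A i - (Z \<union> g ` I))" "h ga = h ga'"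
    obtain g a g' a' where ga: "ga = (g, a)" "ga' = (g', a')" by (cases ga, cases ga') auto
    have g: "g \<in> Gd I" "g' \<in> Gd I" and e: "h (g, a) = h (g', a')" using p unfolding ga by auto
    have "a = a'" using fun_cong[OF e, of i] by (simp add: h_def)
    moreover have "g x = g' x" for x
    proof (cases "x = i")
      case True
      then show ?thesis using g insert.hyps(2) by (auto simp: Gd_def PiE_def extensional_def)
    next
      case False
      then show ?thesis using fun_cong[OF e, of x] by (simp add: h_def)
    qed
    ultimately show "ga = ga'" by (auto simp: ga)
  qed
  have sub: "h ` Sigma (Gd I) (\<lambda>g. A i - (Z \<union> g ` I)) \<subseteq> Gd (insert i I)"
  proof (rule image_subsetI)
    fix ga assume p: "ga \<in> Sigma (Gd I) (\<lambda>g. A i - (Z \<union> g ` I))"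
    obtain g a where ga: "ga = (g, a)" by (cases ga)
    have g: "g \<in> Gd I" and a: "a \<in> A i" "a \<notin> Z \<union> g ` I" using p unfolding ga by auto
    have "g(i := a) ` I = g ` I" using insert.hyps(2) by (intro image_cong) auto
    moreover have "inj_on (g(i := a)) I" using g insert.hyps(2) by (auto simp: Gd_def inj_on_def)
    ultimately show "h ga \<in> Gd (insert i I)" using g a insert.hyps(2)
      by (auto simp: ga h_def Gd_def PiE_insert_eq)
  qed
  have per: "real (card (A i)) / 2 \<le> real (card (A i - (Z \<union> g ` I)))" for g
  proof -
    have "card (Z \<union> g ` I) \<le> card Z + card I"
      using card_Un_le[of Z "g ` I"] card_image_le[OF insert.hyps(1), of g] by simp
    moreover have "card (A i) - card (Z \<union> g ` I) \<le> card (A i - (Z \<union> g ` I))"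
      using assms(2) insert.hyps(1) by (intro diff_card_le_card_Diff) auto
    moreover have "2 * (card (insert i I) + card Z) \<le> card (A i)" using insert.prems by blast
    ultimately have "card (A i) \<le> 2 * card (A i - (Z \<union> g ` I))" using insert.hyps by simp
    then show ?thesis by linarith
  qed
  have "(\<Prod>j\<in>insert i I. real (card (A j)) / 2) = real (card (A i)) / 2 * (\<Prod>j\<in>I. real (card (A j)) / 2)"
    using insert.hyps by simp
  also have "\<dots> \<le> real (card (A i)) / 2 * real (card (Gd I))"
  proof (intro mult_left_mono)
    show "(\<Prod>j\<in>I. real (card (A j)) / 2) \<le> real (card (Gd I))"
      unfolding Gd_def
    proof (rule insert.IH)
      fix j assume "j \<in> I"
      then show "finite (A j) \<and> 2 * (card I + card Z) \<le> card (A j)"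
        using insert.prems[of j] insert.hyps by auto
    qed
  qed auto
  also have "\<dots> = (\<Sum>g\<in>Gd I. real (card (A i)) / 2)" by simp
  also have "\<dots> \<le> (\<Sum>g\<in>Gd I. real (card (A i - (Z \<union> g ` I))))" by (intro sum_mono per)
  also have "\<dots> = real (card (Sigma (Gd I) (\<lambda>g. A i - (Z \<union> g ` I))))"
    using finG insert.prems by (subst card_SigmaI) auto
  also have "\<dots> = real (card (h ` Sigma (Gd I) (\<lambda>g. A i - (Z \<union> g ` I))))"
    using inj by (simp add: card_image)
  also have "\<dots> \<le> real (card (Gd (insert i I)))"
    using sub finG[of "insert i I"] by (simp add: card_mono)
  finally show ?case by (simp add: Gd_def)
qed

text \<open>
  The graph \<open>F\<close> stripped down to what counting needs: for each \<open>v \<in> T\<close> its neighbourhood \<open>nb v \<subseteq> S\<close>, where \<open>root\<close> is the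
  vertex \<open>v*\<close> adjacent to all of \<open>S\<close>.
\<close>
locale rooted_template =
  fixes S T :: "'a set" and nb :: "'a \<Rightarrow> 'a set" and root :: 'a and r :: nat
  assumes finS: "finite S" and finT: "finite T" and disj: "S \<inter> T = {}"
    and root: "root \<in> T" and nb_root: "nb root = S"
    and nb: "\<And>v. v \<in> T - {root} \<Longrightarrow> nb v \<subseteq> S \<and> card (nb v) = r"
    and S2: "2 \<le> card S" and T2: "2 \<le> card T" and r2: "2 \<le> r"
begin

definition T' where "T' = T - {root}"

lemma finT': "finite T'" by (simp add: T'_def finT)
lemma T_eq: "T = insert root T'" "root \<notin> T'" using root by (auto simp: T'_def)
lemma T_iff: "x \<in> T \<longleftrightarrow> x = root \<or> x \<in> T'" using root by (auto simp: T'_def)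
lemma nbT': "v \<in> T' \<Longrightarrow> nb v \<subseteq> S" "v \<in> T' \<Longrightarrow> card (nb v) = r" using nb by (auto simp: T'_def)
lemma nbT: "v \<in> T \<Longrightarrow> nb v \<subseteq> S" using nb nb_root by (cases "v = root") auto
lemma rS: "r \<le> card S"
proof -
  have "card T' = card T - 1" using root finT by (simp add: T'_def)
  then have "T' \<noteq> {}" using T2 by auto
  then obtain v where "v \<in> T'" by auto
  then show ?thesis using nbT'[of v] finS card_mono by metis
qed

end

text \<open>
  The host graph enters through a set \<open>B\<close> of vertices of degree at least \<open>y\<close>, each with a selection \<open>out b\<close> of exactly \<open>y\<close>
  neighbours. Cutting all neighbourhoods to the same size makes the choice of a vertex of \<open>B\<close> and of images for \<open>S\<close> uniform.
  Codegrees below \<open>\<rho>\<close> are considered too small.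
\<close>
locale template_host = rooted_template S T nb root r for S T :: "'a set" and nb root r +
  fixes U B :: "'v set" and out :: "'v \<Rightarrow> 'v set" and y :: nat and \<rho> :: real
  assumes finU: "finite U" and BU: "B \<subseteq> U" and outU: "\<And>b. b \<in> B \<Longrightarrow> out b \<subseteq> U"
    and out_irrefl: "\<And>b. b \<in> B \<Longrightarrow> b \<notin> out b" and card_out: "\<And>b. b \<in> B \<Longrightarrow> card (out b) = y"
    and y0: "0 < y" and \<rho>: "2 * (real (card S) + real (card T)) \<le> \<rho>"
begin

lemma finB: "finite B" using finU BU finite_subset by blast
lemma fin_out: "b \<in> B \<Longrightarrow> finite (out b)" using finU outU finite_subset by blast
lemma \<rho>1: "1 \<le> \<rho>"
proof -
  have "2 \<le> real (card S)" using S2 by simp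
  then show ?thesis using \<rho> by simp
qed

text \<open>
  Vertices of \<open>T\<close> are mapped into \<open>B\<close>, so \<open>com W\<close> is the set of candidates for a vertex whose neighbours are sent to \<open>W\<close>.
\<close>
definition com where "com W = {b \<in> B. W \<subseteq> out b}"
definition cod where "cod W = real (card (com W))"

definition stars where "stars = Sigma B (\<lambda>b. PiE S (\<lambda>_. out b))"

definition copies where
  "copies = {\<phi> \<in> PiE (S \<union> T) (\<lambda>_. U). inj_on \<phi> (S \<union> T) \<and> (\<forall>v\<in>T. \<phi> v \<in> B \<and> \<phi> ` nb v \<subseteq> out (\<phi> v))
      \<and> (\<forall>v\<in>T'. \<rho> \<le> cod (\<phi> ` nb v))}"

text \<open>
  The probability of the values of \<open>\<phi>\<close> on \<open>T'\<close> if each is drawn uniformly from its candidates.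
\<close>
definition wt where "wt \<phi> = (\<Prod>v\<in>T'. 1 / cod (\<phi> ` nb v))" for \<phi> :: "'a \<Rightarrow> 'v"

lemma fin_com: "finite (com W)" using finB by (simp add: com_def)
lemma cod_nonneg: "0 \<le> cod W" by (simp add: cod_def)
lemma cod_antimono: "W \<subseteq> W' \<Longrightarrow> cod W' \<le> cod W"
  unfolding cod_def com_def using finB by (auto intro!: card_mono)
lemma finite_copies: "finite copies"
  unfolding copies_def using finS finT finU by (intro finite_Collect_conjI disjI1) (auto intro!: finite_PiE)
lemma finite_stars: "finite stars"
  unfolding stars_def using finB fin_out finS by (intro finite_SigmaI finite_PiE) auto
lemma card_stars: "card stars = card B * y ^ card S"
  unfolding stars_def using finB fin_out finS
  by (subst card_SigmaI) (auto intro!: finite_PiE simp: card_PiE card_out)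
lemma wt_nonneg: "0 \<le> wt \<phi>" unfolding wt_def by (intro prod_nonneg) (simp add: cod_nonneg)

text \<open>Once \<open>f\<close> is known on \<open>J\<close>, the centre must be a common neighbour of \<open>f ` J\<close>, and each other vertex of \<open>S\<close> has \<open>y\<close> choices.\<close>
lemma star_fiber:
  assumes "J \<subseteq> S"
  shows "real (card {bf \<in> stars. restrict (snd bf) J = f1}) \<le> cod (f1 ` J) * real y ^ card (S - J)"
proof -
  define X where "X = {bf \<in> stars. restrict (snd bf) J = f1}"
  define h where "h = (\<lambda>(b, f). (b, restrict f (S - J)) :: 'v \<times> ('a \<Rightarrow> 'v))"
  have inj: "inj_on h X"
  proof (rule inj_onI, clarify)
    fix b f b' f' assume a: "(b, f) \<in> X" "(b', f') \<in> X" "h (b, f) = h (b', f')"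
    have bb: "b = b'" and ff: "restrict f (S - J) = restrict f' (S - J)" using a(3) by (auto simp: h_def)
    have fJ: "restrict f J = restrict f' J" using a(1,2) by (auto simp: X_def)
    have "f x = f' x" for x
    proof (cases "x \<in> S")
      case True
      then show ?thesis using fun_cong[OF ff, of x] fun_cong[OF fJ, of x] by (cases "x \<in> J") auto
    next
      case False
      then show ?thesis using a(1,2) by (auto simp: X_def stars_def PiE_def extensional_def)
    qed
    then show "b = b' \<and> f = f'" using bb by auto
  qed
  have "h ` X \<subseteq> Sigma (com (f1 ` J)) (\<lambda>b. PiE (S - J) (\<lambda>_. out b))"
  proof (rule image_subsetI)
    fix x assume a: "x \<in> X"
    obtain b f where x: "x = (b, f)" by (cases x)
    have bf: "b \<in> B" "f \<in> PiE S (\<lambda>_. out b)" "restrict f J = f1" using a x by (auto simp: X_def stars_def)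
    have "f1 ` J \<subseteq> out b" using bf(2) assms unfolding bf(3)[symmetric] by auto
    then show "h x \<in> Sigma (com (f1 ` J)) (\<lambda>b. PiE (S - J) (\<lambda>_. out b))"
      using bf by (auto simp: x h_def com_def)
  qed
  moreover have fs: "finite (Sigma (com (f1 ` J)) (\<lambda>b. PiE (S - J) (\<lambda>_. out b)))"
    using finS by (intro finite_SigmaI fin_com finite_PiE fin_out) (auto simp: com_def)
  ultimately have "card X \<le> card (Sigma (com (f1 ` J)) (\<lambda>b. PiE (S - J) (\<lambda>_. out b)))"
    using inj by (metis card_image card_mono)
  also have "\<dots> = (\<Sum>b\<in>com (f1 ` J). card (PiE (S - J) (\<lambda>_. out b)))"
    using finS by (subst card_SigmaI) (auto intro!: finite_PiE fin_out simp: com_def finB)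
  also have "\<dots> = (\<Sum>b\<in>com (f1 ` J). y ^ card (S - J))"
    using finS by (intro sum.cong refl) (auto simp: card_PiE com_def card_out)
  finally have "card X \<le> card (com (f1 ` J)) * y ^ card (S - J)" by simp
  then have "real (card X) \<le> real (card (com (f1 ` J)) * y ^ card (S - J))" by (rule of_nat_mono)
  then show ?thesis by (simp add: X_def cod_def)
qed

text \<open>There are at most \<open>card U ^ r\<close> images of \<open>nb v\<close>, and by \<open>star_fiber\<close> those of codegree less than \<open>\<rho>\<close> extend to few stars each.\<close>
lemma poor_stars:
  assumes v: "v \<in> T'"
  shows "real (card {bf \<in> stars. cod (snd bf ` nb v) < \<rho>}) \<le> \<rho> * real (card U) ^ r * real y ^ (card S - r)"
proof -
  define X where "X = {bf \<in> stars. cod (snd bf ` nb v) < \<rho>}"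
  define R where "R = (\<lambda>bf :: 'v \<times> ('a \<Rightarrow> 'v). restrict (snd bf) (nb v))"
  have finX: "finite X" using finite_stars by (simp add: X_def)
  have finnb: "finite (nb v)" using nbT'[OF v] finS finite_subset by blast
  have im: "R ` X \<subseteq> PiE (nb v) (\<lambda>_. U)"
    using nbT'(1)[OF v] outU by (fastforce simp: R_def X_def stars_def PiE_def extensional_def)
  have "real (card X) = (\<Sum>bf\<in>X. 1)" by simp
  also have "\<dots> = (\<Sum>f1\<in>R ` X. \<Sum>bf | bf \<in> X \<and> R bf = f1. 1)"
    using finX by (intro sum.group[symmetric]) auto
  also have "\<dots> \<le> (\<Sum>f1\<in>R ` X. \<rho> * real y ^ (card S - r))"
  proof (intro sum_mono)
    fix f1 assume "f1 \<in> R ` X"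
    then obtain bf where bf: "bf \<in> X" "f1 = R bf" by auto
    have f1: "f1 ` nb v = snd bf ` nb v" using bf by (auto simp: R_def)
    have "(\<Sum>bf | bf \<in> X \<and> R bf = f1. 1) = real (card {bf \<in> X. R bf = f1})" by simp
    also have "\<dots> \<le> real (card {bf \<in> stars. restrict (snd bf) (nb v) = f1})"
      using finite_stars by (intro of_nat_mono card_mono) (auto simp: X_def R_def)
    also have "\<dots> \<le> cod (f1 ` nb v) * real y ^ card (S - nb v)"
      using nbT'[OF v] by (intro star_fiber) auto
    also have "\<dots> \<le> \<rho> * real y ^ (card S - r)"
      unfolding f1 using bf(1) nbT'[OF v] finnb by (auto simp: X_def card_Diff_subset intro!: mult_right_mono)
    finally show "(\<Sum>bf | bf \<in> X \<and> R bf = f1. 1) \<le> \<rho> * real y ^ (card S - r)" .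
  qed
  also have "\<dots> = real (card (R ` X)) * (\<rho> * real y ^ (card S - r))" by simp
  also have "\<dots> \<le> real (card (PiE (nb v) (\<lambda>_. U))) * (\<rho> * real y ^ (card S - r))"
    using im finnb finU \<rho>1 by (intro mult_right_mono of_nat_mono card_mono finite_PiE) auto
  also have "card (PiE (nb v) (\<lambda>_. U)) = card U ^ r" using finnb nbT'[OF v] by (simp add: card_PiE)
  finally show ?thesis by (simp add: X_def mult_ac)
qed

text \<open>If two vertices of \<open>S\<close> have the same image, the star is determined by its centre and \<open>card S - 1\<close> neighbours.\<close>
lemma degenerate_stars:
  assumes u: "u \<in> S" "u' \<in> S" "u \<noteq> u'"
  shows "real (card {bf \<in> stars. snd bf u = snd bf u'}) \<le> real (card B) * real y ^ (card S - 1)"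
proof -
  define X where "X = {bf \<in> stars. snd bf u = snd bf u'}"
  define h where "h = (\<lambda>(b, f). (b, restrict f (S - {u})) :: 'v \<times> ('a \<Rightarrow> 'v))"
  have inj: "inj_on h X"
  proof (rule inj_onI, clarify)
    fix b f b' f' assume a: "(b, f) \<in> X" "(b', f') \<in> X" "h (b, f) = h (b', f')"
    have bb: "b = b'" and ff: "restrict f (S - {u}) = restrict f' (S - {u})" using a(3) by (auto simp: h_def)
    have "f x = f' x" for x
    proof -
      consider "x \<in> S" "x \<noteq> u" | "x = u" | "x \<notin> S" by blast
      then show ?thesis
      proof cases
        case 1 then show ?thesis using fun_cong[OF ff, of x] by auto
      next
        case 2 then show ?thesis using fun_cong[OF ff, of u'] u a(1,2) by (auto simp: X_def)
      next
        case 3 then show ?thesis using a(1,2) by (auto simp: X_def stars_def PiE_def extensional_def)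
      qed
    qed
    then show "b = b' \<and> f = f'" using bb by auto
  qed
  have "h ` X \<subseteq> Sigma B (\<lambda>b. PiE (S - {u}) (\<lambda>_. out b))"
  proof (rule image_subsetI)
    fix x assume "x \<in> X"
    moreover obtain b f where "x = (b, f)" by (cases x)
    ultimately show "h x \<in> Sigma B (\<lambda>b. PiE (S - {u}) (\<lambda>_. out b))"
      by (auto simp: h_def X_def stars_def PiE_iff)
  qed
  moreover have "finite (Sigma B (\<lambda>b. PiE (S - {u}) (\<lambda>_. out b)))"
    using finS finB by (intro finite_SigmaI finite_PiE fin_out) auto
  ultimately have "card X \<le> card (Sigma B (\<lambda>b. PiE (S - {u}) (\<lambda>_. out b)))"
    using inj by (metis card_image card_mono)
  also have "\<dots> = card B * y ^ (card S - 1)"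
    using finB fin_out finS u by (subst card_SigmaI) (auto intro!: finite_PiE simp: card_PiE card_out)
  finally have "real (card X) \<le> real (card B * y ^ (card S - 1))" by (rule of_nat_mono)
  then show ?thesis by (simp add: X_def)
qed

definition good_stars where
  "good_stars = {bf \<in> stars. inj_on (snd bf) S \<and> (\<forall>v\<in>T'. \<rho> \<le> cod (snd bf ` nb v))}"

lemma many_good_stars:
  assumes rich: "4 * real (card T) * \<rho> * real (card U) ^ r \<le> real (card B) * real y ^ r"
    and large: "4 * (card S)\<^sup>2 \<le> y"
  shows "real (card B) * real y ^ card S / 2 \<le> real (card good_stars)"
proof -
  define D where "D = (\<Union>uv\<in>{uv\<in>S\<times>S. fst uv \<noteq> snd uv}. {bf \<in> stars. snd bf (fst uv) = snd bf (snd uv)})"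
  define P where "P = (\<Union>v\<in>T'. {bf \<in> stars. cod (snd bf ` nb v) < \<rho>})"
  have "stars \<subseteq> good_stars \<union> (D \<union> P)"
  proof
    fix bf assume bf: "bf \<in> stars"
    show "bf \<in> good_stars \<union> (D \<union> P)"
    proof (rule ccontr)
      assume n: "bf \<notin> good_stars \<union> (D \<union> P)"
      then have "inj_on (snd bf) S" using bf by (intro inj_onI) (auto simp: D_def)
      then show False using n bf by (auto simp: good_stars_def P_def not_less)
    qed
  qed
  then have "card stars \<le> card (good_stars \<union> (D \<union> P))"
    using finite_stars by (intro card_mono) (auto simp: good_stars_def D_def P_def finS finT')
  also have "\<dots> \<le> card good_stars + (card D + card P)"
    using card_Un_le[of good_stars "D \<union> P"] card_Un_le[of D P] by simp
  finally have 1: "real (card B) * real y ^ card S \<le> real (card good_stars) + real (card D) + real (card P)"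
    unfolding card_stars by (simp flip: of_nat_add of_nat_mult of_nat_power)
  have "real (card D) \<le> (\<Sum>uv\<in>{uv\<in>S\<times>S. fst uv \<noteq> snd uv}. real (card {bf \<in> stars. snd bf (fst uv) = snd bf (snd uv)}))"
    unfolding D_def using finS by (simp flip: of_nat_sum add: card_UN_le)
  also have "\<dots> \<le> (\<Sum>uv\<in>{uv\<in>S\<times>S. fst uv \<noteq> snd uv}. real (card B) * real y ^ (card S - 1))"
    by (intro sum_mono degenerate_stars) auto
  also have "\<dots> \<le> (\<Sum>uv\<in>S\<times>S. real (card B) * real y ^ (card S - 1))"
    using finS by (intro sum_mono2) auto
  also have "\<dots> = real ((card S)\<^sup>2) * (real (card B) * real y ^ (card S - 1))"
    by (simp add: card_cartesian_product power2_eq_square)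
  also have "\<dots> \<le> real y / 4 * (real (card B) * real y ^ (card S - 1))"
  proof (intro mult_right_mono)
    have "real (4 * (card S)\<^sup>2) \<le> real y" using large by (rule of_nat_mono)
    then show "real ((card S)\<^sup>2) \<le> real y / 4" by simp
  qed auto
  also have "\<dots> = real (card B) * real y ^ card S / 4"
    using S2 by (cases "card S") auto
  finally have D: "real (card D) \<le> real (card B) * real y ^ card S / 4" .
  have "real (card P) \<le> (\<Sum>v\<in>T'. real (card {bf \<in> stars. cod (snd bf ` nb v) < \<rho>}))"
    unfolding P_def using finT' by (simp flip: of_nat_sum add: card_UN_le)
  also have "\<dots> \<le> (\<Sum>v\<in>T'. \<rho> * real (card U) ^ r * real y ^ (card S - r))"
    by (intro sum_mono poor_stars)
  also have "\<dots> \<le> real (card T) * (\<rho> * real (card U) ^ r * real y ^ (card S - r))"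
    using \<rho>1 finT by (simp add: T'_def mult_right_mono card_mono)
  also have "\<dots> = (4 * real (card T) * \<rho> * real (card U) ^ r) * real y ^ (card S - r) / 4" by simp
  also have "\<dots> \<le> (real (card B) * real y ^ r) * real y ^ (card S - r) / 4"
    by (intro divide_right_mono mult_right_mono rich) auto
  also have "\<dots> = real (card B) * real y ^ card S / 4"
    using rS by (simp add: mult.assoc power_add[symmetric])
  finally show ?thesis using 1 D by linarith
qed

text \<open>At least half of the stars are injective with all relevant codegrees at least \<open>\<rho>\<close>, and then at least half of the
  candidates are available for each vertex of \<open>T'\<close> in turn. As the weight of an extension is the reciprocal of the number of
  unrestricted extensions, each good star contributes at least \<open>1 / 2 ^ card T'\<close>.\<close>
lemma total_weight:
  assumes rich: "4 * real (card T) * \<rho> * real (card U) ^ r \<le> real (card B) * real y ^ r"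
    and large: "4 * (card S)\<^sup>2 \<le> y"
  shows "real (card B) * real y ^ card S / 2 ^ card T \<le> (\<Sum>\<phi>\<in>copies. wt \<phi>)"
proof -
  \<comment> \<open>injective choices for \<open>T'\<close> above a star, and the weight they all share\<close>
  define ext where "ext bf = {g \<in> PiE T' (\<lambda>v. com (snd bf ` nb v)). inj_on g T' \<and> g ` T' \<inter> (snd bf ` S \<union> {fst bf}) = {}}"
    for bf :: "'v \<times> ('a \<Rightarrow> 'v)"
  define wf where "wf bf = (\<Prod>v\<in>T'. 1 / cod (snd bf ` nb v))" for bf :: "'v \<times> ('a \<Rightarrow> 'v)"
  define h where "h = (\<lambda>(bf :: 'v \<times> ('a \<Rightarrow> 'v), g :: 'a \<Rightarrow> 'v) x. if x \<in> S then snd bf x else if x = root then fst bf else if x \<in> T' then g x else undefined)"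
  have ST: "S \<inter> T' = {}" "root \<notin> S" using disj root by (auto simp: T'_def)
  have hS: "h (bf, g) ` W = snd bf ` W" if "W \<subseteq> S" for bf g W using that by (intro image_cong) (auto simp: h_def)
  have inj: "inj_on h (Sigma good_stars ext)"
  proof (rule inj_onI)
    fix p p' assume pp: "p \<in> Sigma good_stars ext" "p' \<in> Sigma good_stars ext" "h p = h p'"
    obtain b f g b' f' g' where p: "p = ((b, f), g)" "p' = ((b', f'), g')"
      by (metis prod.exhaust)
    have a: "(b, f) \<in> good_stars" "(b', f') \<in> good_stars" "g \<in> ext (b, f)" "g' \<in> ext (b', f')" "h ((b, f), g) = h ((b', f'), g')"
      using pp unfolding p by auto
    have bb: "b = b'" using fun_cong[OF a(5), of root] ST by (simp add: h_def)
    have "f x = f' x" for x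
      using fun_cong[OF a(5), of x] a(1,2) by (cases "x \<in> S") (auto simp: h_def good_stars_def stars_def PiE_def extensional_def)
    moreover have "g x = g' x" for x
    proof (cases "x \<in> T'")
      case True
      then have "x \<notin> S" "x \<noteq> root" using ST T_eq(2) by auto
      then show ?thesis using fun_cong[OF a(5), of x] True by (simp add: h_def)
    qed (use a(3,4) in \<open>auto simp: ext_def PiE_def extensional_def\<close>)
    ultimately show "p = p'" using bb by (auto simp: p)
  qed
  have sub: "h ` Sigma good_stars ext \<subseteq> copies"
  proof (rule image_subsetI)
    fix p assume pp: "p \<in> Sigma good_stars ext"
    obtain b f g where p: "p = ((b, f), g)" by (metis prod.exhaust)
    have bf: "(b, f) \<in> good_stars" and g: "g \<in> ext (b, f)" using pp unfolding p by auto
    have b: "b \<in> B" and f: "f \<in> PiE S (\<lambda>_. out b)" "inj_on f S" "\<And>v. v \<in> T' \<Longrightarrow> \<rho> \<le> cod (f ` nb v)"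
      using bf by (auto simp: good_stars_def stars_def)
    have gc: "\<And>v. v \<in> T' \<Longrightarrow> g v \<in> com (f ` nb v)" "inj_on g T'" "g ` T' \<inter> f ` S = {}" "b \<notin> g ` T'"
      using g by (auto simp: ext_def)
    define \<phi> where "\<phi> = h ((b, f), g)"
    have \<phi>S: "\<phi> x = f x" if "x \<in> S" for x using that by (simp add: \<phi>_def h_def)
    have \<phi>r: "\<phi> root = b" using ST by (simp add: \<phi>_def h_def)
    have \<phi>T: "\<phi> x = g x" if "x \<in> T'" for x using that ST T_eq(2) by (auto simp: \<phi>_def h_def)
    have im: "\<phi> ` nb v = f ` nb v" if "v \<in> T" for v unfolding \<phi>_def by (subst hS[OF nbT[OF that]]) simp
    have fU: "f x \<in> out b" if "x \<in> S" for x using f(1) that by auto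
    have "\<phi> x \<in> U" if "x \<in> S \<union> T" for x
      using that fU outU[OF b] BU b gc(1) by (auto simp: T_iff \<phi>S \<phi>r \<phi>T com_def)
    moreover have "\<phi> x = undefined" if "x \<notin> S \<union> T" for x using that by (auto simp: \<phi>_def h_def T_iff)
    ultimately have P: "\<phi> \<in> PiE (S \<union> T) (\<lambda>_. U)" by auto
    have i: "inj_on \<phi> (S \<union> T)"
    proof -
      have "inj_on \<phi> S" using f(2) \<phi>S by (simp cong: inj_on_cong)
      moreover have "inj_on \<phi> T'" using gc(2) \<phi>T by (simp cong: inj_on_cong)
      moreover have "\<phi> ` S = f ` S" "\<phi> ` T' = g ` T'" using \<phi>S \<phi>T by (auto intro: image_cong)
      moreover have "b \<notin> f ` S" using fU out_irrefl[OF b] by auto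
      moreover have "\<phi> x \<noteq> \<phi> z" if "x \<in> S" "z \<in> T'" for x z using gc(3) that by (auto simp: \<phi>S \<phi>T)
      ultimately show ?thesis using gc(3,4) \<phi>r ST T_eq(2)
        by (subst T_eq(1)) (auto simp: inj_on_Un inj_on_insert)
    qed
    have "\<phi> v \<in> B \<and> \<phi> ` nb v \<subseteq> out (\<phi> v)" if "v \<in> T" for v
    proof (cases "v = root")
      case True
      then show ?thesis using im[OF that] b fU \<phi>r nb_root by auto
    next
      case False
      then have "v \<in> T'" using that by (simp add: T'_def)
      then show ?thesis using im[OF that] gc(1)[of v] \<phi>T by (auto simp: com_def)
    qed
    moreover have "\<rho> \<le> cod (\<phi> ` nb v)" if "v \<in> T'" for v using f(3)[OF that] im[of v] that by (auto simp: T'_def)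
    ultimately show "h p \<in> copies" using P i unfolding p \<phi>_def[symmetric] by (auto simp: copies_def)
  qed
  have fing: "finite good_stars" using finite_stars by (simp add: good_stars_def)
  have fine: "finite (ext bf)" for bf
    unfolding ext_def using finT' fin_com by (intro finite_Collect_conjI disjI1) (auto intro!: finite_PiE)
  have wh: "wt (h (bf, g)) = wf bf" for bf g
    unfolding wt_def wf_def using nbT' by (intro prod.cong refl) (simp add: hS)
  have T'1: "card T' + 1 = card T" using root finT T2 by (simp add: T'_def)
  have each: "1 / 2 ^ card T' \<le> real (card (ext bf)) * wf bf" if bf: "bf \<in> good_stars" for bf
  proof -
    have cd: "\<rho> \<le> cod (snd bf ` nb v)" if "v \<in> T'" for v using bf that by (auto simp: good_stars_def)
    have "(\<Prod>v\<in>T'. real (card (com (snd bf ` nb v))) / 2) \<le> real (card (ext bf))"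
      unfolding ext_def
    proof (rule card_injective_choices)
      fix v assume v: "v \<in> T'"
      have "card (snd bf ` S \<union> {fst bf}) \<le> card S + 1"
        using card_Un_le[of "snd bf ` S" "{fst bf}"] card_image_le[OF finS, of "snd bf"] by simp
      then have "2 * (card T' + card (snd bf ` S \<union> {fst bf})) \<le> 2 * (card S + card T)" using T'1 by simp
      then have "real (2 * (card T' + card (snd bf ` S \<union> {fst bf}))) \<le> real (2 * (card S + card T))" by (rule of_nat_mono)
      also have "\<dots> \<le> cod (snd bf ` nb v)" using cd[OF v] \<rho> by simp
      finally show "finite (com (snd bf ` nb v)) \<and> 2 * (card T' + card (snd bf ` S \<union> {fst bf})) \<le> card (com (snd bf ` nb v))"
        using fin_com by (simp add: cod_def)
    qed (use finT' finS in auto)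
    then have "(\<Prod>v\<in>T'. cod (snd bf ` nb v) / 2) * wf bf \<le> real (card (ext bf)) * wf bf"
      unfolding cod_def[symmetric] by (intro mult_right_mono) (auto simp: wf_def cod_nonneg intro: prod_nonneg)
    moreover have "(\<Prod>v\<in>T'. cod (snd bf ` nb v) / 2) * wf bf = (\<Prod>v\<in>T'. 1 / 2)"
      unfolding wf_def prod.distrib[symmetric]
    proof (intro prod.cong refl)
      fix v assume "v \<in> T'"
      then have "cod (snd bf ` nb v) \<noteq> 0" using cd \<rho>1 by fastforce
      then show "cod (snd bf ` nb v) / 2 * (1 / cod (snd bf ` nb v)) = 1 / 2" by simp
    qed
    ultimately show ?thesis by (simp add: power_one_over)
  qed
  have "real (card B) * real y ^ card S / 2 ^ card T = (real (card B) * real y ^ card S / 2) * (1 / 2 ^ card T')"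
    using T'1[symmetric] by simp
  also have "\<dots> \<le> real (card good_stars) * (1 / 2 ^ card T')"
    by (intro mult_right_mono many_good_stars rich large) auto
  also have "\<dots> = (\<Sum>bf\<in>good_stars. 1 / 2 ^ card T')" by simp
  also have "\<dots> \<le> (\<Sum>bf\<in>good_stars. real (card (ext bf)) * wf bf)" by (intro sum_mono each)
  also have "\<dots> = (\<Sum>bf\<in>good_stars. \<Sum>g\<in>ext bf. wf bf)" by simp
  also have "\<dots> = (\<Sum>(bf, g)\<in>Sigma good_stars ext. wf bf)" using fing fine by (subst sum.Sigma) auto
  also have "\<dots> = (\<Sum>x\<in>Sigma good_stars ext. wt (h x))" by (intro sum.cong) (auto simp: wh)
  also have "\<dots> = (\<Sum>\<phi>\<in>h ` Sigma good_stars ext. wt \<phi>)" by (simp add: sum.reindex[OF inj])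
  also have "\<dots> \<le> (\<Sum>\<phi>\<in>copies. wt \<phi>)" using sub finite_copies wt_nonneg by (intro sum_mono2) auto
  finally show ?thesis .
qed

text \<open>Being adjacent to all of \<open>S\<close>, the root together with \<open>S\<close> always forms a star.\<close>
lemma copy_restriction:
  assumes "\<phi> \<in> copies"
  shows "(\<phi> root, restrict \<phi> S) \<in> stars" "\<And>v. v \<in> T' \<Longrightarrow> \<rho> \<le> cod (\<phi> ` nb v)"
proof -
  have "\<phi> root \<in> B" "\<phi> ` S \<subseteq> out (\<phi> root)" using assms root nb_root by (auto simp: copies_def)
  then show "(\<phi> root, restrict \<phi> S) \<in> stars" by (auto simp: stars_def)
qed (use assms in \<open>auto simp: copies_def\<close>)

text \<open>Fix the values of a copy on \<open>\<mu> \<subseteq> S\<close> and \<open>\<nu> \<subseteq> T\<close>, and sum over the star formed by the root and \<open>S\<close>. A free vertex of \<open>T'\<close>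
  has as many choices as the reciprocal of its factor in the weight, so it contributes 1, and a fixed one contributes at most
  \<open>1 / \<rho>\<close>. If the root is fixed, the star has \<open>y ^ (card S - card \<mu>)\<close> possibilities. If it is not, one vertex \<open>v0 \<in> \<nu>\<close> replaces it:
  its value forces the images of \<open>nb v0\<close> into a set of \<open>y\<close> vertices, and its factor \<open>1 / cod\<close> is not bounded by
  \<open>1 / \<rho>\<close> but used to cancel the number of choices for the root.\<close>
lemma spread:
  assumes \<mu>: "\<mu> \<subseteq> S" and \<nu>: "\<nu> \<subseteq> T" "\<nu> \<noteq> {}"
  shows "(\<Sum>\<phi> | \<phi> \<in> copies \<and> (\<forall>x\<in>\<mu> \<union> \<nu>. \<phi> x = \<psi> x). wt \<phi>) \<le> real y ^ (card S - card \<mu>) / \<rho> ^ (card \<nu> - 1)"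
proof -
  define A where "A = {\<phi> \<in> copies. \<forall>x\<in>\<mu> \<union> \<nu>. \<phi> x = \<psi> x}"
  define p where "p \<phi> = (\<phi> root, restrict \<phi> S)" for \<phi> :: "'a \<Rightarrow> 'v"
  have finA: "finite A" using finite_copies by (simp add: A_def)
  have fin\<mu>: "finite \<mu>" "finite \<nu>" using \<mu> \<nu> finS finT finite_subset by blast+
  have pst: "p ` A \<subseteq> stars" using copy_restriction by (auto simp: p_def A_def)
  have finp: "finite (p ` A)" using finA by simp
  have p\<mu>: "snd bf x = \<psi> x" if "bf \<in> p ` A" "x \<in> \<mu>" for bf x
    using that \<mu> by (auto simp: p_def A_def)
  have pcod: "\<rho> \<le> cod (snd bf ` nb v)" if bv: "bf \<in> p ` A" "v \<in> T'" for bf v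
  proof -
    obtain \<phi> where \<phi>: "\<phi> \<in> A" "bf = p \<phi>" using bv by auto
    have "snd bf ` nb v = \<phi> ` nb v" using nbT'(1)[OF bv(2)] \<phi> by (auto simp: p_def intro!: image_cong)
    then show ?thesis using copy_restriction(2)[of \<phi> v] \<phi> bv by (auto simp: A_def)
  qed
  \<comment> \<open>summing over the values at the free vertices of \<open>T'\<close> with the star fixed\<close>
  have fiber: "(\<Sum>\<phi> | \<phi> \<in> A \<and> p \<phi> = bf. wt \<phi>) \<le> (\<Prod>v\<in>T' \<inter> \<nu>. 1 / cod (snd bf ` nb v))" if bf: "bf \<in> p ` A" for bf
  proof -
    define X where "X = {\<phi> \<in> A. p \<phi> = bf}"
    define h where "h \<phi> = restrict \<phi> (T' - \<nu>)" for \<phi> :: "'a \<Rightarrow> 'v"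
    have im: "\<phi> ` nb v = snd bf ` nb v" if "\<phi> \<in> X" "v \<in> T'" for \<phi> v
      using nbT'(1)[OF that(2)] that(1) by (auto simp: X_def p_def intro!: image_cong)
    have inj: "inj_on h X"
    proof (rule inj_onI)
      fix \<phi> \<phi>' assume a: "\<phi> \<in> X" "\<phi>' \<in> X" "h \<phi> = h \<phi>'"
      show "\<phi> = \<phi>'"
      proof
        fix x
        consider "x \<in> S" | "x = root" | "x \<in> T' - \<nu>" | "x \<in> T' \<inter> \<nu>" | "x \<notin> S \<union> T" by (auto simp: T_iff)
        then show "\<phi> x = \<phi>' x"
        proof cases
          case 1
          have "p \<phi> = p \<phi>'" using a(1,2) by (simp add: X_def)
          then have "restrict \<phi> S = restrict \<phi>' S" by (simp add: p_def)
          then show ?thesis using 1 by (metis restrict_apply')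
        next
          case 2 then show ?thesis using a(1,2) by (auto simp: X_def p_def)
        next
          case 3 then show ?thesis using fun_cong[OF a(3), of x] by (simp add: h_def)
        next
          case 4 then show ?thesis using a(1,2) by (auto simp: X_def A_def)
        next
          case 5 then show ?thesis using a(1,2) by (auto simp: X_def A_def copies_def PiE_def extensional_def)
        qed
      qed
    qed
    have "h ` X \<subseteq> PiE (T' - \<nu>) (\<lambda>v. com (snd bf ` nb v))"
    proof (rule image_subsetI)
      fix \<phi> assume \<phi>: "\<phi> \<in> X"
      have "\<phi> v \<in> com (snd bf ` nb v)" if "v \<in> T'" for v
        using \<phi> that unfolding im[OF \<phi> that, symmetric] by (auto simp: X_def A_def copies_def com_def T'_def)
      then show "h \<phi> \<in> PiE (T' - \<nu>) (\<lambda>v. com (snd bf ` nb v))" by (auto simp: h_def)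
    qed
    then have "card X \<le> card (PiE (T' - \<nu>) (\<lambda>v. com (snd bf ` nb v)))"
      using inj finT' fin_com by (metis card_image card_mono finite_Diff finite_PiE)
    also have "\<dots> = (\<Prod>v\<in>T' - \<nu>. card (com (snd bf ` nb v)))" using finT' by (simp add: card_PiE)
    finally have cX: "real (card X) \<le> (\<Prod>v\<in>T' - \<nu>. cod (snd bf ` nb v))"
      unfolding cod_def of_nat_prod[symmetric] by (rule of_nat_mono)
    define wf where "wf = (\<Prod>v\<in>T'. 1 / cod (snd bf ` nb v))"
    have wf0: "0 \<le> wf" unfolding wf_def by (intro prod_nonneg) (simp add: cod_nonneg)
    have "(\<Sum>\<phi>\<in>X. wt \<phi>) = (\<Sum>\<phi>\<in>X. wf)"
      unfolding wt_def wf_def by (intro sum.cong prod.cong refl) (simp add: im)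
    also have "\<dots> = real (card X) * wf" by simp
    also have "\<dots> \<le> (\<Prod>v\<in>T' - \<nu>. cod (snd bf ` nb v)) * wf" using cX wf0 by (rule mult_right_mono)
    also have "wf = (\<Prod>v\<in>T' - \<nu>. 1 / cod (snd bf ` nb v)) * (\<Prod>v\<in>T' \<inter> \<nu>. 1 / cod (snd bf ` nb v))"
      unfolding wf_def using finT' by (subst prod.union_disjoint[symmetric]) (auto intro!: prod.cong)
    also have "(\<Prod>v\<in>T' - \<nu>. cod (snd bf ` nb v)) * \<dots> = (\<Prod>v\<in>T' - \<nu>. 1) * (\<Prod>v\<in>T' \<inter> \<nu>. 1 / cod (snd bf ` nb v))"
      unfolding mult.assoc[symmetric] prod.distrib[symmetric]
    proof (intro arg_cong2[where f="(*)"] prod.cong refl)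
      fix v assume "v \<in> T' - \<nu>"
      then have "\<rho> \<le> cod (snd bf ` nb v)" using pcod[OF bf] by auto
      then show "cod (snd bf ` nb v) * (1 / cod (snd bf ` nb v)) = 1" using \<rho>1 by simp
    qed
    finally show ?thesis by (simp add: X_def)
  qed
  have "(\<Sum>\<phi>\<in>A. wt \<phi>) = (\<Sum>bf\<in>p ` A. \<Sum>\<phi> | \<phi> \<in> A \<and> p \<phi> = bf. wt \<phi>)"
    using finA by (intro sum.group[symmetric]) auto
  also have "\<dots> \<le> (\<Sum>bf\<in>p ` A. \<Prod>v\<in>T' \<inter> \<nu>. 1 / cod (snd bf ` nb v))"
    by (intro sum_mono fiber)
  also have "\<dots> \<le> real y ^ (card S - card \<mu>) / \<rho> ^ (card \<nu> - 1)"
  proof (cases "root \<in> \<nu>")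
    case True
    have cT: "card (T' \<inter> \<nu>) = card \<nu> - 1"
    proof -
      have "T' \<inter> \<nu> = \<nu> - {root}" using \<nu> by (auto simp: T'_def)
      then show ?thesis using True by simp
    qed
    have "(\<Sum>bf\<in>p ` A. \<Prod>v\<in>T' \<inter> \<nu>. 1 / cod (snd bf ` nb v)) \<le> (\<Sum>bf\<in>p ` A. \<Prod>v\<in>T' \<inter> \<nu>. 1 / \<rho>)"
    proof (intro sum_mono prod_mono conjI)
      fix bf v assume "bf \<in> p ` A" "v \<in> T' \<inter> \<nu>"
      then have "\<rho> \<le> cod (snd bf ` nb v)" using pcod by auto
      then show "1 / cod (snd bf ` nb v) \<le> 1 / \<rho>" using \<rho>1 by (intro divide_left_mono) auto
    qed (simp add: cod_nonneg)
    also have "\<dots> = real (card (p ` A)) / \<rho> ^ (card \<nu> - 1)" by (simp add: cT power_one_over)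
    also have "\<dots> \<le> real (y ^ (card S - card \<mu>)) / \<rho> ^ (card \<nu> - 1)"
    proof (intro divide_right_mono of_nat_mono)
      show "card (p ` A) \<le> y ^ (card S - card \<mu>)"
      proof (cases "A = {}")
        case False
        then obtain \<phi> where "\<phi> \<in> A" by auto
        then have bB: "\<psi> root \<in> B" using True root by (force simp: A_def copies_def)
        define Y where "Y = PiE S (\<lambda>u. if u \<in> \<mu> then {\<psi> u} else out (\<psi> root))"
        have "p ` A \<subseteq> {\<psi> root} \<times> Y"
        proof (rule image_subsetI)
          fix \<phi> assume \<phi>: "\<phi> \<in> A"
          have r: "\<phi> root = \<psi> root" using \<phi> True by (auto simp: A_def)
          have "\<phi> ` nb root \<subseteq> out (\<phi> root)" using \<phi> root by (auto simp: A_def copies_def)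
          then have o: "\<phi> x \<in> out (\<psi> root)" if "x \<in> S" for x using that r nb_root by auto
          have m: "\<phi> x = \<psi> x" if "x \<in> \<mu>" for x using \<phi> that by (auto simp: A_def)
          have "restrict \<phi> S \<in> Y" unfolding Y_def using o m by (auto simp: PiE_iff)
          then show "p \<phi> \<in> {\<psi> root} \<times> Y" by (simp add: p_def r)
        qed
        moreover have "finite Y" unfolding Y_def using finS fin_out[OF bB] by (intro finite_PiE) auto
        ultimately have "card (p ` A) \<le> card ({\<psi> root} \<times> Y)" by (intro card_mono) auto
        also have "\<dots> = card Y" by (simp add: card_cartesian_product)
        also have "\<dots> = (\<Prod>u\<in>S. if u \<in> \<mu> then 1 else y)"
          unfolding Y_def using finS bB by (subst card_PiE) (auto intro!: prod.cong simp: card_out)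
        also have "\<dots> = (\<Prod>u\<in>S - \<mu>. y)"
          using finS by (intro prod.mono_neutral_cong_right) auto
        also have "\<dots> = y ^ (card S - card \<mu>)" using fin\<mu> \<mu> by (simp add: card_Diff_subset)
        finally show ?thesis .
      qed simp
    qed (use \<rho>1 in auto)
    finally show ?thesis by simp
  next
    case False
    then obtain v0 where v0: "v0 \<in> \<nu>" "v0 \<in> T'" using \<nu> by (auto simp: T'_def)
    define J where "J = nb v0 \<union> \<mu>"
    have JS: "J \<subseteq> S" using \<mu> nbT'(1)[OF v0(2)] by (auto simp: J_def)
    have finJ: "finite J" using JS finS finite_subset by blast
    have T\<nu>: "T' \<inter> \<nu> = insert v0 (\<nu> - {v0})" using False \<nu> v0 by (auto simp: T'_def)
    define R where "R = (\<lambda>bf :: 'v \<times> ('a \<Rightarrow> 'v). restrict (snd bf) J)"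
    have "(\<Sum>bf\<in>p ` A. \<Prod>v\<in>T' \<inter> \<nu>. 1 / cod (snd bf ` nb v)) \<le> (\<Sum>bf\<in>p ` A. 1 / cod (snd bf ` nb v0) * (1 / \<rho>) ^ (card \<nu> - 1))"
    proof (intro sum_mono)
      fix bf assume bf: "bf \<in> p ` A"
      have "(\<Prod>v\<in>\<nu> - {v0}. 1 / cod (snd bf ` nb v)) \<le> (\<Prod>v\<in>\<nu> - {v0}. 1 / \<rho>)"
      proof (intro prod_mono conjI)
        fix v assume "v \<in> \<nu> - {v0}"
        then have "v \<in> T'" using T\<nu> by auto
        then have "\<rho> \<le> cod (snd bf ` nb v)" using pcod bf by auto
        then show "1 / cod (snd bf ` nb v) \<le> 1 / \<rho>" using \<rho>1 by (intro divide_left_mono) auto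
      qed (simp add: cod_nonneg)
      then show "(\<Prod>v\<in>T' \<inter> \<nu>. 1 / cod (snd bf ` nb v)) \<le> 1 / cod (snd bf ` nb v0) * (1 / \<rho>) ^ (card \<nu> - 1)"
      proof -
        assume le: "(\<Prod>v\<in>\<nu> - {v0}. 1 / cod (snd bf ` nb v)) \<le> (\<Prod>v\<in>\<nu> - {v0}. 1 / \<rho>)"
        have "(\<Prod>v\<in>T' \<inter> \<nu>. 1 / cod (snd bf ` nb v)) = 1 / cod (snd bf ` nb v0) * (\<Prod>v\<in>\<nu> - {v0}. 1 / cod (snd bf ` nb v))"
          unfolding T\<nu> using fin\<mu> by (subst prod.insert) auto
        also have "\<dots> \<le> 1 / cod (snd bf ` nb v0) * (\<Prod>v\<in>\<nu> - {v0}. 1 / \<rho>)"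
          using le by (intro mult_left_mono) (auto simp: cod_nonneg)
        also have "(\<Prod>v\<in>\<nu> - {v0}. 1 / \<rho>) = (1 / \<rho>) ^ (card \<nu> - 1)" using v0 by simp
        finally show ?thesis .
      qed
    qed
    also have "\<dots> = (\<Sum>bf\<in>p ` A. 1 / cod (snd bf ` nb v0)) / \<rho> ^ (card \<nu> - 1)"
      by (simp add: sum_divide_distrib power_one_over)
    also have "(\<Sum>bf\<in>p ` A. 1 / cod (snd bf ` nb v0)) = (\<Sum>f1\<in>R ` p ` A. \<Sum>bf | bf \<in> p ` A \<and> R bf = f1. 1 / cod (snd bf ` nb v0))"
      using finp by (intro sum.group[symmetric]) auto
    also have "\<dots> \<le> (\<Sum>f1\<in>R ` p ` A. real y ^ card (S - J))"
    proof (intro sum_mono)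
      fix f1 assume f1: "f1 \<in> R ` p ` A"
      then obtain bf0 where bf0: "bf0 \<in> p ` A" "f1 = R bf0" by auto
      have im: "snd bf ` nb v0 = f1 ` nb v0" if "R bf = f1" for bf
        unfolding that[symmetric] by (auto simp: R_def J_def intro!: image_cong)
      have cpos: "\<rho> \<le> cod (f1 ` nb v0)" using pcod[OF bf0(1) v0(2)] im[of bf0] bf0(2) by simp
      have "(\<Sum>bf | bf \<in> p ` A \<and> R bf = f1. 1 / cod (snd bf ` nb v0)) = (\<Sum>bf | bf \<in> p ` A \<and> R bf = f1. 1 / cod (f1 ` nb v0))"
        by (intro sum.cong refl) (simp add: im)
      also have "\<dots> = real (card {bf \<in> p ` A. R bf = f1}) / cod (f1 ` nb v0)" by simp
      also have "\<dots> \<le> (cod (f1 ` nb v0) * real y ^ card (S - J)) / cod (f1 ` nb v0)"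
      proof (intro divide_right_mono cod_nonneg)
        have "real (card {bf \<in> p ` A. R bf = f1}) \<le> real (card {bf \<in> stars. restrict (snd bf) J = f1})"
          using finite_stars pst by (intro of_nat_mono card_mono) (auto simp: R_def)
        also have "\<dots> \<le> cod (f1 ` J) * real y ^ card (S - J)" by (rule star_fiber[OF JS])
        also have "\<dots> \<le> cod (f1 ` nb v0) * real y ^ card (S - J)"
          by (intro mult_right_mono cod_antimono) (auto simp: J_def)
        finally show "real (card {bf \<in> p ` A. R bf = f1}) \<le> cod (f1 ` nb v0) * real y ^ card (S - J)" .
      qed
      finally show "(\<Sum>bf | bf \<in> p ` A \<and> R bf = f1. 1 / cod (snd bf ` nb v0)) \<le> real y ^ card (S - J)"
        using cpos \<rho>1 by simp
    qed
    also have "\<dots> = real (card (R ` p ` A)) * real y ^ card (S - J)" by simp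
    also have "\<dots> \<le> real (y ^ card (J - \<mu>)) * real y ^ card (S - J)"
    proof (intro mult_right_mono of_nat_mono)
      show "card (R ` p ` A) \<le> y ^ card (J - \<mu>)"
      proof (cases "A = {}")
        case False
        then obtain \<phi> where "\<phi> \<in> A" by auto
        then have bB: "\<psi> v0 \<in> B" using v0 by (force simp: A_def copies_def T'_def)
        define Y where "Y = PiE J (\<lambda>u. if u \<in> \<mu> then {\<psi> u} else out (\<psi> v0))"
        have "R ` p ` A \<subseteq> Y"
          unfolding image_image
        proof (rule image_subsetI)
          fix \<phi> assume \<phi>: "\<phi> \<in> A"
          have v0T: "v0 \<in> T" using v0 by (simp add: T'_def)
          then have "\<phi> ` nb v0 \<subseteq> out (\<phi> v0)" using \<phi> by (auto simp: A_def copies_def)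
          then have "\<phi> ` nb v0 \<subseteq> out (\<psi> v0)" using \<phi> v0(1) by (auto simp: A_def)
          moreover have "\<And>x. x \<in> \<mu> \<Longrightarrow> \<phi> x = \<psi> x" using \<phi> by (auto simp: A_def)
          moreover have "\<And>x. x \<in> J \<Longrightarrow> x \<in> S" using JS by auto
          ultimately show "R (p \<phi>) \<in> Y" unfolding Y_def R_def p_def by (auto simp: PiE_iff J_def)
        qed
        moreover have "finite Y" unfolding Y_def using finJ fin_out[OF bB] by (intro finite_PiE) auto
        ultimately have "card (R ` p ` A) \<le> card Y" by (intro card_mono) auto
        also have "\<dots> = (\<Prod>u\<in>J. if u \<in> \<mu> then 1 else y)"
          unfolding Y_def using finJ bB by (subst card_PiE) (auto intro!: prod.cong simp: card_out)
        also have "\<dots> = (\<Prod>u\<in>J - \<mu>. y)"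
          using finJ by (intro prod.mono_neutral_cong_right) auto
        finally show ?thesis by simp
      qed simp
    qed auto
    also have "\<dots> = real y ^ (card S - card \<mu>)"
    proof -
      have "card (J - \<mu>) + card (S - J) = card ((J - \<mu>) \<union> (S - J))" using finJ finS by (intro card_Un_disjoint[symmetric]) auto
      also have "(J - \<mu>) \<union> (S - J) = S - \<mu>" using JS by (auto simp: J_def)
      also have "card (S - \<mu>) = card S - card \<mu>" using \<mu> fin\<mu> by (simp add: card_Diff_subset)
      finally show ?thesis by (simp add: power_add[symmetric])
    qed
    finally show ?thesis using \<rho>1 by (simp add: divide_right_mono)
  qed
  finally show ?thesis by (simp add: A_def)
qed

end

section \<open>Degrees and the energy of the copy measure\<close>

definition nbrs :: "nat set set \<Rightarrow> nat \<Rightarrow> nat set" where "nbrs E v = {u. {u, v} \<in> E}"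

lemma nbrs_bound: "E \<subseteq> nsets {..<n} 2 \<Longrightarrow> nbrs E v \<subseteq> {..<n} - {v}"
proof
  fix u assume "E \<subseteq> nsets {..<n} 2" "u \<in> nbrs E v"
  then have "{u, v} \<in> nsets {..<n} 2" unfolding nbrs_def by blast
  then have "card {u, v} = 2" "u < n" unfolding nsets_def by auto
  then show "u \<in> {..<n} - {v}" by (cases "u = v") auto
qed

lemma finite_nbrs: "E \<subseteq> nsets {..<n} 2 \<Longrightarrow> finite (nbrs E v)"
  by (rule finite_subset[OF nbrs_bound]) auto

lemma sum_degrees:
  assumes E: "E \<subseteq> nsets {..<n} 2"
  shows "(\<Sum>v<n. card (nbrs E v)) = 2 * card E"
proof -
  have finE: "finite E" using E finite_subset[OF E] by (simp add: finite_imp_finite_nsets)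
  have deg: "card (nbrs E v) = card {e\<in>E. v \<in> e}" for v
  proof -
    have "inj_on (\<lambda>u. {u, v}) (nbrs E v)" by (auto simp: inj_on_def doubleton_eq_iff)
    moreover have "(\<lambda>u. {u, v}) ` nbrs E v = {e\<in>E. v \<in> e}"
    proof (intro equalityI subsetI)
      fix e assume e: "e \<in> {e\<in>E. v \<in> e}"
      then have "card e = 2" "v \<in> e" using E by (auto simp: nsets_def)
      then obtain u where "e = {u, v}" by (auto simp: card_2_iff doubleton_eq_iff insert_commute)
      then show "e \<in> (\<lambda>u. {u, v}) ` nbrs E v" using e by (auto simp: nbrs_def)
    qed (auto simp: nbrs_def)
    ultimately show ?thesis by (metis card_image)
  qed
  have "(\<Sum>v<n. card (nbrs E v)) = (\<Sum>v<n. \<Sum>e\<in>E. if v \<in> e then 1 else 0)"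
    unfolding deg using finE by (intro sum.cong refl) (simp add: sum.If_cases Int_def)
  also have "\<dots> = (\<Sum>e\<in>E. \<Sum>v<n. if v \<in> e then 1 else 0)" by (rule sum.swap)
  also have "\<dots> = (\<Sum>e\<in>E. 2)"
  proof (intro sum.cong refl)
    fix e assume "e \<in> E"
    then have e: "e \<subseteq> {..<n}" "card e = 2" using E by (auto simp: nsets_def)
    have "(\<Sum>v<n. if v \<in> e then 1 else 0) = card ({..<n} \<inter> e)" by (simp add: sum.If_cases)
    also have "{..<n} \<inter> e = e" using e by auto
    finally show "(\<Sum>v<n. if v \<in> e then 1 else (0::nat)) = 2" using e by simp
  qed
  finally show ?thesis by simp
qed

lemma card_pairs_le_square:
  assumes "E \<subseteq> nsets {..<n} 2"
  shows "card E \<le> n * n"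
proof -
  have "card E \<le> card (nsets {..<n} 2)" using assms by (intro card_mono finite_imp_finite_nsets) auto
  also have "\<dots> = n choose 2" by (simp add: card_nsets)
  also have "\<dots> \<le> n * n" unfolding choose_two by (rule order_trans[OF div_le_dividend]) simp
  finally show ?thesis .
qed

text \<open>Compare with the telescoping sum of \<open>1 / (y - 1) - 1 / y\<close>.\<close>
lemma sum_inverse_squares:
  assumes "0 < x" "x \<le> m"
  shows "(\<Sum>y\<in>{x<..m}. 1 / (real y)\<^sup>2) \<le> 1 / real x - 1 / real m"
  using assms(2)
proof (induction m rule: dec_induct)
  case (step m)
  have m0: "0 < m" using assms step by linarith
  have "{x<..Suc m} = insert (Suc m) {x<..m}" using step by auto
  then have "(\<Sum>y\<in>{x<..Suc m}. 1 / (real y)\<^sup>2) = 1 / (real (Suc m))\<^sup>2 + (\<Sum>y\<in>{x<..m}. 1 / (real y)\<^sup>2)"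
    by simp
  moreover have "1 / (real (Suc m))\<^sup>2 \<le> 1 / real m - 1 / real (Suc m)"
  proof -
    have "1 / real m - 1 / real (Suc m) = 1 / (real m * real (Suc m))" using m0 by (simp add: field_simps)
    moreover have "1 / (real (Suc m) * real (Suc m)) \<le> 1 / (real m * real (Suc m))"
      using m0 by (intro divide_left_mono mult_right_mono) auto
    ultimately show ?thesis by (simp only: power2_eq_square)
  qed
  ultimately show ?case using step by linarith
qed (simp add: assms)

text \<open>Some degree threshold \<open>y\<close> is reached by as many vertices as if the graph were regular of degree \<open>x\<close>, measured with the
  weight \<open>y ^ r\<close>. Otherwise the number of vertices of degree at least \<open>y\<close> decays at least as fast as \<open>n * x\<^sup>2 / y\<^sup>2\<close>, because \<open>r \<ge> 2\<close>,
  and summing over \<open>y\<close> leaves at most \<open>n * x\<close> edges.\<close>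
lemma degree_level:
  assumes E: "E \<subseteq> nsets {..<n} 2" and x: "0 < x" "n * x < card E" and r: "2 \<le> r"
  shows "\<exists>y\<ge>x. n * x ^ r \<le> card {v. v < n \<and> y \<le> card (nbrs E v)} * y ^ r"
proof (rule ccontr)
  assume neg: "\<not> ?thesis"
  define c where "c y = card {v. v < n \<and> y \<le> card (nbrs E v)}" for y
  have c: "real (c y) \<le> real n * (real x)\<^sup>2 * (1 / (real y)\<^sup>2)" if y: "x \<le> y" for y
  proof -
    have "c y * y ^ r < n * x ^ r" using neg y unfolding c_def by (metis not_le)
    moreover have "y ^ r = y\<^sup>2 * y ^ (r - 2)" "x ^ r = x\<^sup>2 * x ^ (r - 2)" using r by (simp_all only: power_add[symmetric] le_add_diff_inverse)
    moreover have "x ^ (r - 2) \<le> y ^ (r - 2)" using y by (intro power_mono) auto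
    then have "c y * (y\<^sup>2 * x ^ (r - 2)) \<le> c y * (y\<^sup>2 * y ^ (r - 2))" by simp
    ultimately have "c y * (y\<^sup>2 * x ^ (r - 2)) < n * (x\<^sup>2 * x ^ (r - 2))" by (simp only:)
    then have "(c y * y\<^sup>2) * x ^ (r - 2) < (n * x\<^sup>2) * x ^ (r - 2)" by (simp only: mult.assoc)
    then have "c y * y\<^sup>2 < n * x\<^sup>2" using mult_less_cancel2 by blast
    then have "real (c y * y\<^sup>2) \<le> real (n * x\<^sup>2)" by (intro of_nat_mono) simp
    then show ?thesis using x y by (simp add: field_simps)
  qed
  have n0: "0 < n"
  proof (rule ccontr)
    assume "\<not> 0 < n"
    then have "E = {}" using E by (auto simp: nsets_def)
    then show False using x by simp
  qed
  have degn: "card (nbrs E v) \<le> n" for v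
    using card_mono[of "{..<n}" "nbrs E v"] nbrs_bound[OF E, of v] by auto
  \<comment> \<open>a degree is \<open>x\<close> plus the number of thresholds above \<open>x\<close> that it reaches\<close>
  have d: "card (nbrs E v) \<le> x + (\<Sum>y\<in>{x<..n}. if y \<le> card (nbrs E v) then 1 else 0)" for v
  proof -
    have "(\<Sum>y\<in>{x<..n}. if y \<le> card (nbrs E v) then 1 else 0) = card ({x<..n} \<inter> {y. y \<le> card (nbrs E v)})"
      by (simp add: sum.If_cases)
    also have "{x<..n} \<inter> {y. y \<le> card (nbrs E v)} = {x<..card (nbrs E v)}" using degn[of v] by auto
    finally show ?thesis by simp
  qed
  have "2 * card E \<le> (\<Sum>v<n. x + (\<Sum>y\<in>{x<..n}. if y \<le> card (nbrs E v) then 1 else 0))"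
    unfolding sum_degrees[OF E, symmetric] by (intro sum_mono d)
  also have "\<dots> = n * x + (\<Sum>y\<in>{x<..n}. \<Sum>v<n. if y \<le> card (nbrs E v) then 1 else 0)"
    by (simp add: sum.distrib sum.swap[of _ "{..<n}"])
  also have "(\<Sum>y\<in>{x<..n}. \<Sum>v<n. if y \<le> card (nbrs E v) then 1 else 0) = (\<Sum>y\<in>{x<..n}. c y)"
    by (intro sum.cong refl) (simp add: sum.If_cases c_def Int_def)
  finally have "real (2 * card E) \<le> real (n * x + (\<Sum>y\<in>{x<..n}. c y))" by (rule of_nat_mono)
  also have "\<dots> = real (n * x) + (\<Sum>y\<in>{x<..n}. real (c y))" by simp
  also have "(\<Sum>y\<in>{x<..n}. real (c y)) \<le> (\<Sum>y\<in>{x<..n}. real n * (real x)\<^sup>2 * (1 / (real y)\<^sup>2))"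
    by (intro sum_mono c) auto
  also have "\<dots> = real n * (real x)\<^sup>2 * (\<Sum>y\<in>{x<..n}. 1 / (real y)\<^sup>2)" by (simp add: sum_distrib_left)
  also have "\<dots> \<le> real n * (real x)\<^sup>2 * (1 / real x)"
  proof (intro mult_left_mono)
    show "(\<Sum>y\<in>{x<..n}. 1 / (real y)\<^sup>2) \<le> 1 / real x"
    proof (cases "x \<le> n")
      case True
      then have "(\<Sum>y\<in>{x<..n}. 1 / (real y)\<^sup>2) \<le> 1 / real x - 1 / real n" by (rule sum_inverse_squares[OF x(1)])
      moreover have "0 \<le> 1 / real n" by simp
      ultimately show ?thesis by linarith
    qed simp
  qed auto
  also have "\<dots> = real (n * x)" using x by (simp add: power2_eq_square)
  finally have "real (2 * card E) \<le> real (n * x) + real (n * x)" by simp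
  then have "2 * card E \<le> n * x + n * x" by (simp only: of_nat_add[symmetric] of_nat_le_iff)
  then show False using x by linarith
qed

context rooted_template begin

definition tedges where "tedges = {{u, v} | u v. v \<in> T \<and> u \<in> nb v}"
definition coverS where "coverS D = S \<inter> \<Union>D"
definition coverT where "coverT D = T \<inter> \<Union>D"
text \<open>
  Edge sets without a copy of the template. This is stated for arbitrary families of sets, so that closure under subsets is
  immediate.
\<close>
definition free_sets :: "'v set \<Rightarrow> 'v set set set" where
  "free_sets U = {A. \<not> (\<exists>\<phi>. inj_on \<phi> (S \<union> T) \<and> \<phi> ` (S \<union> T) \<subseteq> U \<and> (\<forall>e\<in>tedges. \<phi> ` e \<in> A))}"

lemma free_sets_down: "A \<in> free_sets U \<Longrightarrow> A' \<subseteq> A \<Longrightarrow> A' \<in> free_sets U"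
proof -
  assume A: "A \<in> free_sets U" "A' \<subseteq> A"
  show "A' \<in> free_sets U"
    unfolding free_sets_def mem_Collect_eq
  proof
    assume "\<exists>\<phi>. inj_on \<phi> (S \<union> T) \<and> \<phi> ` (S \<union> T) \<subseteq> U \<and> (\<forall>e\<in>tedges. \<phi> ` e \<in> A')"
    then obtain \<phi> where "inj_on \<phi> (S \<union> T)" "\<phi> ` (S \<union> T) \<subseteq> U" "\<forall>e\<in>tedges. \<phi> ` e \<in> A'" by auto
    moreover then have "\<forall>e\<in>tedges. \<phi> ` e \<in> A" using A(2) by auto
    ultimately have "\<exists>\<phi>. inj_on \<phi> (S \<union> T) \<and> \<phi> ` (S \<union> T) \<subseteq> U \<and> (\<forall>e\<in>tedges. \<phi> ` e \<in> A)"
      by (intro exI[of _ \<phi>] conjI)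
    then show False using A(1) by (simp only: free_sets_def mem_Collect_eq not_True_eq_False)
  qed
qed

lemma tedges_sub: "e \<in> tedges \<Longrightarrow> e \<subseteq> S \<union> T"
proof -
  assume "e \<in> tedges"
  then obtain u v where "e = {u, v}" "v \<in> T" "u \<in> nb v" unfolding tedges_def by blast
  then show ?thesis using nbT[of v] by auto
qed
lemma finite_tedges: "finite tedges"
proof (rule finite_subset)
  show "tedges \<subseteq> Pow (S \<union> T)" by (intro subsetI PowI tedges_sub)
  show "finite (Pow (S \<union> T))" using finS finT by simp
qed
lemma tedges_cover: "D \<subseteq> tedges \<Longrightarrow> D \<noteq> {} \<Longrightarrow> coverT D \<noteq> {} \<and> coverS D \<noteq> {}"
proof -
  assume D: "D \<subseteq> tedges" "D \<noteq> {}"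
  then obtain e where "e \<in> D" by auto
  then obtain u v where uv: "e = {u, v}" "v \<in> T" "u \<in> nb v" using D unfolding tedges_def by blast
  then have "v \<in> coverT D" "u \<in> coverS D" using nbT[OF uv(2)] \<open>e \<in> D\<close> by (auto simp: coverS_def coverT_def)
  then show ?thesis by auto
qed
lemma tedges_2: "2 \<le> card tedges"
proof -
  have "(\<lambda>u. {u, root}) ` S \<subseteq> tedges" using root nb_root by (auto simp: tedges_def)
  then have "card ((\<lambda>u. {u, root}) ` S) \<le> card tedges" using finite_tedges by (intro card_mono)
  moreover have "inj_on (\<lambda>u. {u, root}) S" by (auto simp: inj_on_def doubleton_eq_iff)
  ultimately show ?thesis using S2 by (simp add: card_image)
qed

end

lemma sum_UN_le:
  fixes f :: "'b \<Rightarrow> real"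
  assumes "finite I" "\<And>i. i \<in> I \<Longrightarrow> finite (A i)" "\<And>x. 0 \<le> f x"
  shows "sum f (\<Union>i\<in>I. A i) \<le> (\<Sum>i\<in>I. sum f (A i))"
  using assms(1,2)
proof (induction I rule: finite_induct)
  case (insert i I)
  have "sum f (A i \<union> (\<Union>i\<in>I. A i)) + sum f (A i \<inter> (\<Union>i\<in>I. A i)) = sum f (A i) + sum f (\<Union>i\<in>I. A i)"
    using insert by (intro sum.union_inter) auto
  moreover have "0 \<le> sum f (A i \<inter> (\<Union>i\<in>I. A i))" using assms(3) by (intro sum_nonneg) auto
  ultimately show ?case using insert by simp
qed simp

context template_host begin

text \<open>A bound for the number of maps from a subset of \<open>S \<union> T\<close> to its image under a fixed map.\<close>
definition vv where "vv = real ((card S + card T) ^ (card S + card T))"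

text \<open>Agreement on edges is agreement of sets: the vertices of an edge may be interchanged. Summing \<open>spread\<close> over all ways in which
  the touched vertices can be mapped costs the constant \<open>vv\<close>.\<close>
lemma agree_mass:
  assumes D: "D \<subseteq> tedges" "D \<noteq> {}" and \<phi>0: "\<phi>0 \<in> copies"
  shows "(\<Sum>\<phi> | \<phi> \<in> copies \<and> (\<forall>e\<in>D. \<phi> ` e = \<phi>0 ` e). wt \<phi>)
     \<le> vv * (real y ^ (card S - card (coverS D)) / \<rho> ^ (card (coverT D) - 1))"
proof -
  define W where "W = \<Union>D"
  define X where "X = {\<phi> \<in> copies. \<forall>e\<in>D. \<phi> ` e = \<phi>0 ` e}"
  define \<Psi> where "\<Psi> = PiE W (\<lambda>_. \<phi>0 ` W)"
  have WST: "W \<subseteq> S \<union> T" using D tedges_sub by (auto simp: W_def)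
  have finW: "finite W" using WST finS finT finite_subset by blast
  have cover: "coverS D \<union> coverT D = W" using WST by (auto simp: coverS_def coverT_def W_def)
  have fin\<Psi>: "finite \<Psi>" unfolding \<Psi>_def using finW by (intro finite_PiE) auto
  have sub: "X \<subseteq> (\<Union>\<psi>\<in>\<Psi>. {\<phi> \<in> copies. \<forall>x\<in>coverS D \<union> coverT D. \<phi> x = \<psi> x})"
  proof
    fix \<phi> assume \<phi>: "\<phi> \<in> X"
    have "restrict \<phi> W \<in> \<Psi>" using \<phi> by (fastforce simp: \<Psi>_def X_def W_def)
    moreover have "\<forall>x\<in>coverS D \<union> coverT D. \<phi> x = restrict \<phi> W x" by (simp add: cover)
    moreover have "\<phi> \<in> copies" using \<phi> by (simp add: X_def)
    ultimately show "\<phi> \<in> (\<Union>\<psi>\<in>\<Psi>. {\<phi> \<in> copies. \<forall>x\<in>coverS D \<union> coverT D. \<phi> x = \<psi> x})" by blast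
  qed
  have "(\<Sum>\<phi>\<in>X. wt \<phi>) \<le> (\<Sum>\<phi>\<in>(\<Union>\<psi>\<in>\<Psi>. {\<phi> \<in> copies. \<forall>x\<in>coverS D \<union> coverT D. \<phi> x = \<psi> x}). wt \<phi>)"
    using sub fin\<Psi> finite_copies wt_nonneg by (intro sum_mono2) auto
  also have "\<dots> \<le> (\<Sum>\<psi>\<in>\<Psi>. \<Sum>\<phi> | \<phi> \<in> copies \<and> (\<forall>x\<in>coverS D \<union> coverT D. \<phi> x = \<psi> x). wt \<phi>)"
    using fin\<Psi> finite_copies wt_nonneg by (intro sum_UN_le) auto
  also have "\<dots> \<le> (\<Sum>\<psi>\<in>\<Psi>. real y ^ (card S - card (coverS D)) / \<rho> ^ (card (coverT D) - 1))"
    using tedges_cover[OF D] by (intro sum_mono spread) (auto simp: coverS_def coverT_def)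
  also have "\<dots> = real (card \<Psi>) * (real y ^ (card S - card (coverS D)) / \<rho> ^ (card (coverT D) - 1))" by simp
  also have "\<dots> \<le> vv * (real y ^ (card S - card (coverS D)) / \<rho> ^ (card (coverT D) - 1))"
  proof (intro mult_right_mono)
    have cW: "card W \<le> card S + card T" using card_mono[OF _ WST] finS finT card_Un_le[of S T] by simp
    have "card \<Psi> = card (\<phi>0 ` W) ^ card W" unfolding \<Psi>_def using finW by (simp add: card_PiE)
    also have "\<dots> \<le> (card S + card T) ^ card W"
      using cW card_image_le[OF finW, of \<phi>0] by (intro power_mono) auto
    also have "\<dots> \<le> (card S + card T) ^ (card S + card T)" using cW S2 by (intro power_increasing) auto
    finally show "real (card \<Psi>) \<le> vv" unfolding vv_def by (rule of_nat_mono)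
  qed (use \<rho>1 in auto)
  finally show ?thesis by (simp add: X_def)
qed

lemma total_weight_le: "(\<Sum>\<phi>\<in>copies. wt \<phi>) \<le> real (card B) * real y ^ card S"
proof -
  have "(\<Sum>\<phi>\<in>copies. wt \<phi>) = (\<Sum>b\<in>B. \<Sum>\<phi> | \<phi> \<in> copies \<and> \<phi> root = b. wt \<phi>)"
    using finite_copies finB root by (intro sum.group[symmetric]) (auto simp: copies_def)
  also have "\<dots> \<le> (\<Sum>b\<in>B. real y ^ card S)"
  proof (intro sum_mono)
    fix b assume "b \<in> B"
    show "(\<Sum>\<phi> | \<phi> \<in> copies \<and> \<phi> root = b. wt \<phi>) \<le> real y ^ card S"
      using spread[of "{}" "{root}" "\<lambda>_. b"] root by simp
  qed
  finally show ?thesis by simp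
qed

text \<open>A pair mass is the average of \<open>agree_mass\<close> over the first copy of the pair. Since \<open>N \<le> card B * y\<close>, after normalisation the
  term of an edge set \<open>D\<close> is at most \<open>vv\<close> divided by the quantity that \<open>big\<close> bounds from below.\<close>
lemma energy_bound:
  assumes idx: "bij_betw idx {..<k} tedges" and B0: "B \<noteq> {}" and N: "0 \<le> N" "N \<le> real (card B) * real y"
    and \<tau>: "0 < \<tau>"
    and big: "\<And>D. D \<subseteq> tedges \<Longrightarrow> D \<noteq> {} \<Longrightarrow>
       1 \<le> \<tau> ^ (card D - 1) * real y ^ (card (coverS D) - 1) * \<rho> ^ (card (coverT D) - 1)"
  shows "energy copies (\<lambda>i \<phi>. \<phi> ` idx i) N \<tau> {..<k} (\<lambda>\<phi>. wt \<phi> / (real (card B) * real y ^ card S)) \<le> 2 ^ k * vv"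
proof -
  define c where "c = real (card B) * real y ^ card S"
  have cB: "0 < real (card B)" using B0 finB by (simp add: card_gt_0_iff)
  have c0: "0 < c" using cB y0 by (simp add: c_def)
  have vv0: "0 \<le> vv" by (simp add: vv_def)
  have each: "N * (1 / \<tau>) ^ (card L - 1) * pair_mass copies (\<lambda>i \<phi>. \<phi> ` idx i) (\<lambda>\<phi>. wt \<phi> / c) L \<le> vv"
    if L: "L \<in> Pow {..<k} - {{}}" for L
  proof -
    define D where "D = idx ` L"
    have D: "D \<subseteq> tedges" "D \<noteq> {}" using L idx by (auto simp: D_def bij_betw_def)
    have cD: "card D = card L" unfolding D_def using idx L by (intro card_image) (auto simp: bij_betw_def intro: inj_on_subset)
    define m where "m = real y ^ (card S - card (coverS D)) / \<rho> ^ (card (coverT D) - 1)"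
    have m0: "0 \<le> m" using \<rho>1 by (simp add: m_def)
    have cS: "card (coverS D) \<le> card S" "1 \<le> card (coverS D)"
    proof -
      show "card (coverS D) \<le> card S" using finS by (intro card_mono) (auto simp: coverS_def)
      have "finite (coverS D)" using finS by (simp add: coverS_def)
      then show "1 \<le> card (coverS D)" using tedges_cover[OF D] by (simp add: Suc_le_eq card_gt_0_iff)
    qed
    have "pair_mass copies (\<lambda>i \<phi>. \<phi> ` idx i) (\<lambda>\<phi>. wt \<phi> / c) L
       = (\<Sum>a\<in>copies. wt a / c * ((\<Sum>b | b \<in> copies \<and> (\<forall>e\<in>D. b ` e = a ` e). wt b) / c))"
      unfolding pair_mass_def
    proof (intro sum.cong refl)
      fix a assume "a \<in> copies"
      have "(\<Sum>b | b \<in> copies \<and> (\<forall>e\<in>D. b ` e = a ` e). wt b) = (\<Sum>b\<in>copies. wt b * of_bool (\<forall>l\<in>L. a ` idx l = b ` idx l))"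
        using finite_copies by (simp add: sum.inter_filter of_bool_def if_distrib D_def eq_commute cong: if_cong)
      then show "(\<Sum>b\<in>copies. wt a / c * (wt b / c) * of_bool (\<forall>l\<in>L. a ` idx l = b ` idx l))
         = wt a / c * ((\<Sum>b | b \<in> copies \<and> (\<forall>e\<in>D. b ` e = a ` e). wt b) / c)"
        by (simp add: sum_distrib_left sum_divide_distrib mult_ac)
    qed
    also have "\<dots> \<le> (\<Sum>a\<in>copies. wt a / c * (vv * m / c))"
      unfolding m_def using c0 wt_nonneg by (intro sum_mono mult_left_mono divide_right_mono agree_mass D) auto
    also have "\<dots> = (\<Sum>a\<in>copies. wt a) / c * (vv * m / c)" by (simp add: sum_distrib_right sum_divide_distrib)
    also have "\<dots> \<le> 1 * (vv * m / c)"
      using total_weight_le c0 vv0 m0 by (intro mult_right_mono) (auto simp: c_def)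
    finally have pm: "pair_mass copies (\<lambda>i \<phi>. \<phi> ` idx i) (\<lambda>\<phi>. wt \<phi> / c) L \<le> vv * m / c" by simp
    have Nm: "N * m / c \<le> 1 / (real y ^ (card (coverS D) - 1) * \<rho> ^ (card (coverT D) - 1))"
    proof -
      have "N * m / c \<le> real (card B) * real y * m / c" using N c0 m0 by (intro divide_right_mono mult_right_mono) auto
      also have "real (card B) * real y * m / c = (real y * real y ^ (card S - card (coverS D))) / (real y ^ card S * \<rho> ^ (card (coverT D) - 1))"
        using cB by (simp add: m_def c_def)
      also have "real y ^ card S = (real y * real y ^ (card S - card (coverS D))) * real y ^ (card (coverS D) - 1)"
        using cS by (simp add: power_add[symmetric] power_Suc[symmetric] del: power_Suc)
      also have "(real y * real y ^ (card S - card (coverS D))) / ((real y * real y ^ (card S - card (coverS D))) * real y ^ (card (coverS D) - 1) * \<rho> ^ (card (coverT D) - 1))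
         = 1 / (real y ^ (card (coverS D) - 1) * \<rho> ^ (card (coverT D) - 1))"
        using y0 by simp
      finally show ?thesis .
    qed
    have "N * (1 / \<tau>) ^ (card L - 1) * pair_mass copies (\<lambda>i \<phi>. \<phi> ` idx i) (\<lambda>\<phi>. wt \<phi> / c) L
       \<le> N * (1 / \<tau>) ^ (card L - 1) * (vv * m / c)"
      using pm N \<tau> by (intro mult_left_mono) auto
    also have "\<dots> = vv * (1 / \<tau>) ^ (card L - 1) * (N * m / c)" by simp
    also have "\<dots> \<le> vv * (1 / \<tau>) ^ (card L - 1) * (1 / (real y ^ (card (coverS D) - 1) * \<rho> ^ (card (coverT D) - 1)))"
      using Nm vv0 \<tau> by (intro mult_left_mono) auto
    also have "\<dots> = vv / (\<tau> ^ (card D - 1) * real y ^ (card (coverS D) - 1) * \<rho> ^ (card (coverT D) - 1))"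
      by (simp add: cD power_one_over)
    also have "\<dots> \<le> vv / 1" using big[OF D] vv0 by (intro divide_left_mono) auto
    finally show ?thesis by simp
  qed
  have "energy copies (\<lambda>i \<phi>. \<phi> ` idx i) N \<tau> {..<k} (\<lambda>\<phi>. wt \<phi> / c) \<le> (\<Sum>L\<in>Pow {..<k} - {{}}. vv)"
    unfolding energy_def by (intro sum_mono each)
  also have "\<dots> = real (card (Pow {..<k} - {{}})) * vv" by simp
  also have "\<dots> \<le> 2 ^ k * vv"
  proof (intro mult_right_mono vv0)
    have "card (Pow {..<k} - {{}}) \<le> card (Pow {..<k})" by (intro card_mono) auto
    then have "real (card (Pow {..<k} - {{}})) \<le> real (2 ^ k)" by (intro of_nat_mono) (simp add: card_Pow)
    then show "real (card (Pow {..<k} - {{}})) \<le> 2 ^ k" by simp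
  qed
  finally show ?thesis by (simp add: c_def)
qed

end

section \<open>The container step for graphs\<close>

context rooted_template begin

text \<open>
  Constants for \<open>container_step\<close>: \<open>\<omega>0\<close> is the total weight guaranteed by \<open>total_weight\<close>, \<open>\<eta>0\<close> turns the energy
  bound \<open>2 ^ kk * vv\<close> into the required \<open>\<omega>0 / 4\<close>, and \<open>\<delta>0\<close> is the largest admissible proportion for these.
\<close>
definition kk where "kk = card tedges"
definition \<omega>0 :: real where "\<omega>0 = 1 / 2 ^ card T"
definition \<eta>0 :: real where "\<eta>0 = \<omega>0 / (4 * 10 ^ kk * real ((card S + card T) ^ (card S + card T)))"
definition \<delta>0 :: real where "\<delta>0 = \<eta>0 * \<omega>0 / real kk"

lemma constants: "0 < \<omega>0" "0 < \<eta>0" "0 < \<delta>0" "\<delta>0 \<le> 1/8"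
proof -
  show w: "0 < \<omega>0" by (simp add: \<omega>0_def)
  have w1: "\<omega>0 \<le> 1" by (simp add: \<omega>0_def)
  have k2: "2 \<le> real kk" using tedges_2 by (simp add: kk_def)
  have vv: "1 \<le> real ((card S + card T) ^ (card S + card T))" using S2 by simp
  show e: "0 < \<eta>0" using w vv unfolding \<eta>0_def by (intro divide_pos_pos mult_pos_pos) auto
  show "0 < \<delta>0" using e w k2 by (simp add: \<delta>0_def)
  have "1 \<le> (10::real) ^ kk" by simp
  then have "4 * 1 * 1 \<le> 4 * 10 ^ kk * real ((card S + card T) ^ (card S + card T))"
    using vv by (intro mult_mono) auto
  then have "\<eta>0 \<le> 1 / 4" using w1 w unfolding \<eta>0_def by (intro frac_le) auto
  then have "\<eta>0 * \<omega>0 \<le> 1/4 * 1" using w1 w e by (intro mult_mono) auto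
  then show "\<delta>0 \<le> 1/8" using k2 e w unfolding \<delta>0_def by (simp add: field_simps)
qed

text \<open>Here \<open>x\<close> is at most a quarter of the average degree and \<open>\<sigma>\<close> the density of the picks. The host structure is taken at the level \<open>y \<ge> x\<close>
  supplied by \<open>degree_level\<close>; the conditions only improve from \<open>x\<close> to \<open>y\<close>. The vertices of the game are the edges \<open>{b, u}\<close> with
  \<open>u \<in> out b\<close>. Removing exactly \<open>\<delta>0 * N\<close> of them, rounded up, expresses the cost per removed edge.\<close>
theorem graph_container_step:
  assumes E: "E \<subseteq> nsets {..<n} 2" and n: "0 < n" and x: "0 < x" "2 * n * x \<le> card E"
    and \<rho>: "2 * (real (card S) + real (card T)) \<le> \<rho>"
    and rich: "4 * real (card T) * \<rho> * real n ^ r \<le> real n * real x ^ r" and large: "4 * (card S)\<^sup>2 \<le> x"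
    and \<sigma>: "1 / \<rho> \<le> \<sigma>" "4 * \<sigma> \<le> 1" "2 * \<sigma> \<le> q"
    and big: "\<And>D. D \<subseteq> tedges \<Longrightarrow> D \<noteq> {} \<Longrightarrow>
       1 \<le> \<sigma> ^ (card D - 1) * real x ^ (card (coverS D) - 1) * \<rho> ^ (card (coverT D) - 1)"
  shows "\<exists>Y\<subseteq>E. 0 < card (E - Y) \<and> 2 * card (E - Y) \<le> card E \<and>
    activity_sum (free_sets {..<n}) q {} E
     \<le> exp (2 / \<delta>0 * \<sigma> * (2 + real kk * ln (q / \<sigma>)) * real (card (E - Y))) * activity_sum (free_sets {..<n}) q {} Y"
proof -
  have "n * x < card E" using x n by (smt (verit) mult.assoc mult_2 nat_0_less_mult_iff add_less_same_cancel1 less_le_trans less_add_same_cancel1)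
  then obtain y where y: "x \<le> y" "n * x ^ r \<le> card {v. v < n \<and> y \<le> card (nbrs E v)} * y ^ r"
    using degree_level[OF E x(1) _ r2] by blast
  define B where "B = {v. v < n \<and> y \<le> card (nbrs E v)}"
  define out where "out v = (SOME W. W \<subseteq> nbrs E v \<and> card W = y)" for v
  have out: "out v \<subseteq> nbrs E v" "card (out v) = y" if "v \<in> B" for v
  proof -
    have "\<exists>W. W \<subseteq> nbrs E v \<and> card W = y"
      using that obtain_subset_with_card_n[of y "nbrs E v"] by (auto simp: B_def)
    then have "out v \<subseteq> nbrs E v \<and> card (out v) = y" unfolding out_def by (rule someI_ex)
    then show "out v \<subseteq> nbrs E v" "card (out v) = y" by auto
  qed
  have finE: "finite E" using E by (rule finite_subset) (simp add: finite_imp_finite_nsets)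
  interpret H: template_host S T nb root r "{..<n}" B out y \<rho>
  proof
    show "\<And>b. b \<in> B \<Longrightarrow> out b \<subseteq> {..<n}" "\<And>b. b \<in> B \<Longrightarrow> b \<notin> out b"
      using out(1) nbrs_bound[OF E] by blast+
    show "0 < y" using x y by linarith
  qed (use out \<rho> in \<open>auto simp: B_def\<close>)
  have nx: "0 < n * x ^ r" using n x by simp
  have B0: "B \<noteq> {}" using y(2) nx unfolding B_def[symmetric] by (cases "B = {}") auto
  have yn: "y \<le> n"
  proof -
    obtain b where "b \<in> B" using B0 by auto
    then have "card (out b) \<le> card {..<n}" using H.outU by (intro card_mono) auto
    then show ?thesis using \<open>b \<in> B\<close> out(2) by simp
  qed
  define Sg where "Sg = Sigma B out"
  define f where "f = (\<lambda>(b :: nat, u). {b, u})"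
  define V where "V = f ` Sg"
  define N where "N = real (card V)"
  have finSg: "finite Sg" unfolding Sg_def using H.finB H.fin_out by (intro finite_SigmaI) auto
  have cSg: "card Sg = card B * y" unfolding Sg_def using H.finB H.fin_out by (subst card_SigmaI) (auto simp: out(2))
  have N1: "N \<le> real (card B) * real y"
  proof -
    have "card V \<le> card B * y" unfolding V_def cSg[symmetric] by (rule card_image_le[OF finSg])
    then have "real (card V) \<le> real (card B * y)" by (rule of_nat_mono)
    then show ?thesis by (simp add: N_def)
  qed
  \<comment> \<open>an edge arises from at most two pairs \<open>(b, u)\<close>\<close>
  have N2: "real (card B) * real y \<le> 2 * N"
  proof -
    have card2: "card {x, y'} \<le> 2" for x y' :: "nat \<times> nat" by (cases "x = y'") auto
    have "card Sg = (\<Sum>e\<in>V. card {p \<in> Sg. f p = e})"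
      unfolding card_eq_sum V_def using finSg by (intro sum.group[symmetric]) auto
    also have "\<dots> \<le> (\<Sum>e\<in>V. 2)"
    proof (intro sum_mono)
      fix e assume "e \<in> V"
      then obtain b u where e: "e = {b, u}" by (auto simp: V_def f_def)
      have "{p \<in> Sg. f p = e} \<subseteq> {(b, u), (u, b)}"
      proof
        fix p assume "p \<in> {p \<in> Sg. f p = e}"
        moreover obtain c d where p: "p = (c, d)" by (cases p)
        ultimately have "{c, d} = {b, u}" by (simp add: f_def e)
        then show "p \<in> {(b, u), (u, b)}" unfolding p by (auto simp only: doubleton_eq_iff insert_iff)
      qed
      then have "card {p \<in> Sg. f p = e} \<le> card {(b, u), (u, b)}" by (intro card_mono) auto
      also have "\<dots> \<le> 2" by (rule card2)
      finally show "card {p \<in> Sg. f p = e} \<le> 2" .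
    qed
    finally have "card B * y \<le> 2 * card V" by (simp add: cSg)
    then have "real (card B * y) \<le> real (2 * card V)" by (rule of_nat_mono)
    then show ?thesis by (simp add: N_def)
  qed
  have VE: "V \<subseteq> E"
  proof
    fix e assume "e \<in> V"
    then obtain b u where "b \<in> B" "u \<in> out b" "e = {b, u}" by (auto simp: V_def f_def Sg_def)
    then show "e \<in> E" using out(1)[of b] by (auto simp: nbrs_def insert_commute)
  qed
  have "2 \<le> real (card S)" "2 \<le> real (card T)" using S2 T2 by auto
  then have "2 * (2 + 2) \<le> 2 * (real (card S) + real (card T))" by (intro mult_left_mono add_mono) auto
  then have \<rho>1: "8 \<le> \<rho>" using \<rho> by simp
  have richB: "4 * real (card T) * \<rho> * real n ^ r \<le> real (card B) * real y ^ r"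
  proof -
    have "real (n * x ^ r) \<le> real (card B * y ^ r)" using y(2) unfolding B_def by (rule of_nat_mono)
    then show ?thesis using rich by simp
  qed
  have N\<rho>: "\<rho> \<le> N"
  proof -
    have r: "real m ^ r = real m * real m ^ (r - 1)" for m using r2 by (cases r) auto
    have "4 * real (card T) * \<rho> * real n * real n ^ (r - 1) \<le> real (card B) * real y * real y ^ (r - 1)"
      using richB by (simp only: r mult.assoc)
    also have "\<dots> \<le> real (card B) * real y * real n ^ (r - 1)" using yn by (intro mult_left_mono power_mono) auto
    finally have "4 * real (card T) * \<rho> * real n \<le> real (card B) * real y" using n by (simp add: mult_le_cancel_right)
    moreover have "2 * 1 * \<rho> * 1 \<le> 4 * real (card T) * \<rho> * real n"
      using T2 n \<rho>1 by (intro mult_mono) auto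
    ultimately show ?thesis using N2 by linarith
  qed
  have N0: "0 < N" "8 \<le> N" using N\<rho> \<rho>1 by auto
  have \<sigma>0: "0 < \<sigma>" using \<sigma>(1) \<rho>1 by (smt (verit) divide_pos_pos)
  have \<sigma>N: "1 \<le> \<sigma> * N"
  proof -
    have "1 = 1 / \<rho> * \<rho>" using \<rho>1 by simp
    also have "\<dots> \<le> \<sigma> * N" using \<sigma>(1) N\<rho> \<rho>1 \<sigma>0 by (intro mult_mono) auto
    finally show ?thesis .
  qed
  \<comment> \<open>rounding \<open>\<sigma> * N \<ge> 1\<close> up changes the density by a factor of at most 2\<close>
  define M where "M = nat \<lceil>\<sigma> * N\<rceil>"
  have M: "\<sigma> * N \<le> real M" "real M \<le> 2 * (\<sigma> * N)" "0 < M" using \<sigma>N by (auto simp: M_def) linarith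
  define \<tau> where "\<tau> = real M / N"
  have \<tau>: "\<sigma> \<le> \<tau>" "\<tau> \<le> 2 * \<sigma>" using M N0 by (auto simp: \<tau>_def field_simps)
  have \<tau>0: "0 < \<tau>" using \<tau> \<sigma>0 by linarith
  obtain idx where "bij_betw idx {0..<card tedges} tedges" using ex_bij_betw_nat_finite[OF finite_tedges] by blast
  then have idx: "bij_betw idx {..<kk} tedges" by (simp add: kk_def lessThan_atLeast0)
  define w where "w \<phi> = H.wt \<phi> / (real (card B) * real y ^ card S)" for \<phi>
  have cB: "0 < real (card B) * real y ^ card S" using B0 H.finB H.y0 by (simp add: card_gt_0_iff)
  have En: "energy H.copies (\<lambda>i \<phi>. \<phi> ` idx i) N \<tau> {..<kk} w \<le> 2 ^ kk * H.vv"
    unfolding w_def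
  proof (rule H.energy_bound[OF idx B0 _ N1 \<tau>0])
    fix D assume D: "D \<subseteq> tedges" "D \<noteq> {}"
    have "1 \<le> \<sigma> ^ (card D - 1) * real x ^ (card (coverS D) - 1) * \<rho> ^ (card (coverT D) - 1)" by (rule big[OF D])
    also have "\<dots> \<le> \<tau> ^ (card D - 1) * real y ^ (card (coverS D) - 1) * \<rho> ^ (card (coverT D) - 1)"
      using \<tau> \<sigma>0 y \<rho>1 by (intro mult_mono power_mono) auto
    finally show "1 \<le> \<tau> ^ (card D - 1) * real y ^ (card (coverS D) - 1) * \<rho> ^ (card (coverT D) - 1)" .
  qed (use N0 in auto)
  have k2: "2 \<le> kk" using tedges_2 by (simp add: kk_def)
  have "\<exists>Y\<subseteq>E. \<delta>0 * N \<le> real (card (E - Y)) \<and>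
     activity_sum (free_sets {..<n}) q {} E \<le> exp (real M * (2 + real kk * ln (q / \<tau>))) * activity_sum (free_sets {..<n}) q {} Y"
  proof (rule container_step[where \<Omega>=H.copies and pos="\<lambda>i \<phi>. \<phi> ` idx i" and w=w and V=V and N=N and \<eta>=\<eta>0 and \<omega>=\<omega>0])
    show "finite H.copies" by (rule H.finite_copies)
    show "0 \<le> w a" for a using cB H.wt_nonneg by (simp add: w_def)
    show "\<phi> ` idx i \<in> V" if "i < kk" "\<phi> \<in> H.copies" for i \<phi>
    proof -
      have "idx i \<in> tedges" using idx that(1) by (auto simp: bij_betw_def)
      then obtain u v where uv: "idx i = {u, v}" "v \<in> T" "u \<in> nb v" unfolding tedges_def by blast
      then have "\<phi> v \<in> B" "\<phi> ` nb v \<subseteq> out (\<phi> v)" using that(2) by (auto simp: H.copies_def)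
      then have "\<phi> v \<in> B" "\<phi> u \<in> out (\<phi> v)" using uv(3) by blast+
      then have "f (\<phi> v, \<phi> u) \<in> V" unfolding V_def Sg_def by (intro imageI) auto
      then show ?thesis by (simp add: f_def uv insert_commute)
    qed
    show "\<omega>0 \<le> sum w H.copies"
    proof -
      have "real (card B) * real y ^ card S / 2 ^ card T \<le> (\<Sum>\<phi>\<in>H.copies. H.wt \<phi>)"
        using richB large y(1) by (intro H.total_weight) auto
      then show ?thesis
        unfolding w_def sum_divide_distrib[symmetric] pos_le_divide_eq[OF cB] \<omega>0_def by simp
    qed
    show "5 ^ kk * \<eta>0 * energy H.copies (\<lambda>i \<phi>. \<phi> ` idx i) N \<tau> {..<kk} w \<le> \<omega>0 / 4"
    proof -
      have "5 ^ kk * \<eta>0 * energy H.copies (\<lambda>i \<phi>. \<phi> ` idx i) N \<tau> {..<kk} w \<le> 5 ^ kk * \<eta>0 * (2 ^ kk * H.vv)"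
        using En constants by (intro mult_left_mono) auto
      also have "\<dots> = (5 * 2) ^ kk * \<eta>0 * H.vv" by (simp only: power_mult_distrib mult_ac)
      also have "\<dots> = \<omega>0 / 4"
      proof -
        have "H.vv \<noteq> 0" using S2 by (simp add: H.vv_def)
        then show ?thesis unfolding \<eta>0_def H.vv_def[symmetric] by simp
      qed
      finally show ?thesis .
    qed
    show "A' \<in> free_sets {..<n}" if "A \<in> free_sets {..<n}" "A' \<subseteq> A" for A A' using that by (rule free_sets_down)
    show "(\<lambda>i. \<phi> ` idx i) ` {..<kk} \<notin> free_sets {..<n}" if "\<phi> \<in> H.copies" for \<phi>
    proof -
      have "(\<lambda>i. \<phi> ` idx i) ` {..<kk} = image \<phi> ` (idx ` {..<kk})" by (simp add: image_image)
      then have "(\<lambda>i. \<phi> ` idx i) ` {..<kk} = image \<phi> ` tedges" using idx by (simp add: bij_betw_def)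
      then have "\<forall>e\<in>tedges. \<phi> ` e \<in> (\<lambda>i. \<phi> ` idx i) ` {..<kk}" by simp
      moreover have "inj_on \<phi> (S \<union> T)" "\<phi> ` (S \<union> T) \<subseteq> {..<n}" using that by (auto simp: H.copies_def)
      ultimately have "\<exists>\<phi>. inj_on \<phi> (S \<union> T) \<and> \<phi> ` (S \<union> T) \<subseteq> {..<n} \<and> (\<forall>e\<in>tedges. \<phi> ` e \<in> (\<lambda>i. \<phi>' ` idx i) ` {..<kk})"
        if "\<phi>' = \<phi>" for \<phi>' unfolding that by (intro exI[of _ \<phi>] conjI)
      then show ?thesis by (simp only: free_sets_def mem_Collect_eq not_not refl)
    qed
    show "\<tau> \<le> 1/2" "\<tau> \<le> q" using \<tau>(2) \<sigma>(2,3) by linarith+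
    show "0 \<le> \<delta>0" "\<delta>0 \<le> 1/2" "0 < \<eta>0" "0 < \<omega>0" using constants by linarith+
    show "real kk * \<delta>0 \<le> \<eta>0 * \<omega>0" using k2 by (simp add: \<delta>0_def)
  qed (use VE finE k2 N0 M(3) in \<open>auto simp: N_def \<tau>_def\<close>)
  then obtain Y0 where Y0: "Y0 \<subseteq> E" "\<delta>0 * N \<le> real (card (E - Y0))"
     "activity_sum (free_sets {..<n}) q {} E \<le> exp (real M * (2 + real kk * ln (q / \<tau>))) * activity_sum (free_sets {..<n}) q {} Y0"
    by blast
  \<comment> \<open>Put edges back into \<open>Y0\<close> until exactly \<open>j\<close> are missing; the activity sum only grows.\<close>
  define j where "j = nat \<lceil>\<delta>0 * N\<rceil>"
  have \<delta>N: "0 < \<delta>0 * N" using constants N0 by simp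
  have j: "\<delta>0 * N \<le> real j" "0 < j" "real j \<le> \<delta>0 * N + 1" using \<delta>N by (auto simp: j_def)
  have "j \<le> card (E - Y0)" using Y0(2) unfolding j_def by (simp add: nat_le_iff ceiling_le_iff)
  then obtain W where W: "W \<subseteq> E - Y0" "card W = j" by (meson obtain_subset_with_card_n)
  have EW: "E - (E - W) = W" using W by auto
  have q0: "0 < q" using \<sigma> \<sigma>0 by linarith
  have NE: "N \<le> real (card E)" using VE finE by (simp add: N_def card_mono)
  have "real j \<le> 1/8 * real (card E) + 1"
    using j(3) constants(3,4) NE N0 mult_mono[of \<delta>0 "1/8" N "real (card E)"] by simp
  then have j2: "2 * j \<le> card E" using NE N0 by linarith
  have cost: "real M * (2 + real kk * ln (q / \<tau>)) \<le> 2 / \<delta>0 * \<sigma> * (2 + real kk * ln (q / \<sigma>)) * real j"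
  proof -
    have l0: "0 \<le> ln (q / \<sigma>)" using \<sigma> \<sigma>0 by simp
    have "ln (q / \<tau>) \<le> ln (q / \<sigma>)" using \<tau> \<tau>0 \<sigma>0 q0 by (simp add: frac_le)
    then have "real M * (2 + real kk * ln (q / \<tau>)) \<le> real M * (2 + real kk * ln (q / \<sigma>))"
      by (intro mult_left_mono add_left_mono) auto
    also have "\<dots> \<le> 2 * (\<sigma> * N) * (2 + real kk * ln (q / \<sigma>))" using M l0 by (intro mult_right_mono) auto
    also have "\<dots> = 2 / \<delta>0 * \<sigma> * (2 + real kk * ln (q / \<sigma>)) * (\<delta>0 * N)" using constants(3) by simp
    also have "\<dots> \<le> 2 / \<delta>0 * \<sigma> * (2 + real kk * ln (q / \<sigma>)) * real j"
      using j l0 \<sigma>0 constants(3) by (intro mult_left_mono) auto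
    finally show ?thesis .
  qed
  have "activity_sum (free_sets {..<n}) q {} E \<le> exp (real M * (2 + real kk * ln (q / \<tau>))) * activity_sum (free_sets {..<n}) q {} Y0" by fact
  also have "\<dots> \<le> exp (2 / \<delta>0 * \<sigma> * (2 + real kk * ln (q / \<sigma>)) * real j) * activity_sum (free_sets {..<n}) q {} (E - W)"
    using cost q0 finE W Y0(1) by (intro mult_mono activity_sum_mono activity_sum_nonneg) auto
  finally show ?thesis using W j j2 by (intro exI[of _ "E - W"]) (auto simp: EW)
qed

end

section \<open>Two balance conditions and the summation of costs\<close>

lemma activity_sum_le_exp:
  assumes "finite E" "0 \<le> q"
  shows "activity_sum \<I> q {} E \<le> exp (q * real (card E))"
proof -
  have pw: "(\<Sum>A\<in>Pow E. q ^ card A) = (1 + q) ^ card E"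
    using assms(1)
  proof (induction E rule: finite_induct)
    case (insert x E)
    have inj: "inj_on (insert x) (Pow E)" using insert by (auto simp: inj_on_def)
    have "(\<Sum>A\<in>Pow (insert x E). q ^ card A) = (\<Sum>A\<in>Pow E. q ^ card A) + (\<Sum>A\<in>insert x ` Pow E. q ^ card A)"
      unfolding Pow_insert using insert by (intro sum.union_disjoint) auto
    also have "(\<Sum>A\<in>insert x ` Pow E. q ^ card A) = (\<Sum>A\<in>Pow E. q * q ^ card A)"
      unfolding sum.reindex[OF inj] o_def
    proof (intro sum.cong refl)
      fix A assume "A \<in> Pow E"
      then have "finite A" "x \<notin> A" using insert by (auto intro: finite_subset)
      then show "q ^ card (insert x A) = q * q ^ card A" by simp
    qed
    also have "\<dots> = q * (\<Sum>A\<in>Pow E. q ^ card A)" by (simp only: sum_distrib_left)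
    finally show ?case using insert by (simp add: algebra_simps)
  qed simp
  have "activity_sum \<I> q {} E \<le> (\<Sum>A\<in>Pow E. q ^ card A)"
    unfolding activity_sum_def using assms by (intro sum_mono2) auto
  also have "\<dots> = (1 + q) ^ card E" by (rule pw)
  also have "\<dots> \<le> exp q ^ card E" using assms(2) by (intro power_mono exp_ge_add_one_self) auto
  also have "\<dots> = exp (q * real (card E))" by (simp add: exp_of_nat_mult[symmetric] mult.commute)
  finally show ?thesis .
qed

text \<open>
  Both inequalities are equalities when \<open>D\<close> consists of all edges, of which there are \<open>card S + r * (card T - 1)\<close>. The first says that,
  with one edge per vertex of \<open>T\<close> discounted, no part of the template has more edges per vertex of \<open>S\<close> after the first; the second is 2-balancedness.
\<close>
locale balanced_template = rooted_template +
  assumes weight_bal: "\<And>D. D \<subseteq> tedges \<Longrightarrow> D \<noteq> {} \<Longrightarrow>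
      real (card D) - real (card (coverT D)) \<le> (1 + (real r - 1) * (real (card T) - 1) / (real (card S) - 1)) * (real (card (coverS D)) - 1)"
    and density_bal: "\<And>D. D \<subseteq> tedges \<Longrightarrow> D \<noteq> {} \<Longrightarrow>
      (real (card D) - 1) * (real (card S) + real (card T) - 2) \<le>
       (real (card (coverS D)) + real (card (coverT D)) - 2) * (real (card S) - 1 + real r * (real (card T) - 1))"
begin

definition \<alpha> where "\<alpha> = (real (card S) + real (card T) - 2) / (real (card S) - 1 + real r * (real (card T) - 1))"
definition \<beta> where "\<beta> = (real (card S) - 1) / (real (card S) - 1 + real r * (real (card T) - 1))"

text \<open>Every touched vertex of \<open>T\<close> lies in an edge of \<open>D\<close>, and no edge contains two of them.\<close>
lemma card_coverT_le:
  assumes "D \<subseteq> tedges"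
  shows "card (coverT D) \<le> card D"
proof -
  have finD: "finite D" using assms finite_tedges finite_subset by blast
  have "\<exists>v. v \<in> T \<and> T \<inter> e = {v}" if et: "e \<in> tedges" for e
  proof -
    obtain u v where "e = {u, v}" "v \<in> T" "u \<in> nb v" using et unfolding tedges_def by blast
    moreover have "u \<notin> T" using nbT[of v] calculation disj by auto
    ultimately show ?thesis by (intro exI[of _ v]) auto
  qed
  then obtain h where h: "\<And>e. e \<in> tedges \<Longrightarrow> T \<inter> e = {h e}" by metis
  have "coverT D \<subseteq> h ` D"
  proof
    fix v assume "v \<in> coverT D"
    then obtain e where "e \<in> D" "v \<in> T \<inter> e" by (auto simp: coverT_def)
    then show "v \<in> h ` D" using h[of e] assms by auto
  qed
  then have "card (coverT D) \<le> card (h ` D)" using finD by (intro card_mono) auto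
  also have "\<dots> \<le> card D" by (rule card_image_le[OF finD])
  finally show ?thesis .
qed

text \<open>With \<open>L = ln n\<close>, \<open>Z = ln (n / x)\<close>, \<open>ln \<rho> = L - r * Z\<close> and \<open>\<Theta> = ln \<sigma>\<close>, this is the logarithm of the condition \<open>big\<close> above. The two lower
  bounds for \<open>\<Theta>\<close> coincide at \<open>Z = t * L / w\<close>. Up to this point the second one is used: the expression is then linear in \<open>Z\<close>,
  nonnegative at \<open>Z = 0\<close> by \<open>density_bal\<close> and at \<open>Z = t * L / w\<close> by \<open>weight_bal\<close>. Beyond it, the first lower bound and
  \<open>weight_bal\<close> alone suffice.\<close>
lemma exponent_inequality:
  fixes L Z \<Theta> :: real
  assumes D: "D \<subseteq> tedges" "D \<noteq> {}" and L: "0 < L" and Z: "0 \<le> Z" "Z \<le> L" "0 \<le> L - real r * Z"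
    and \<Theta>: "- (L - real r * Z) \<le> \<Theta>" "Z - \<alpha> * L \<le> \<Theta>"
  shows "0 \<le> (real (card D) - 1) * \<Theta> + (real (card (coverS D)) - 1) * (L - Z) + (real (card (coverT D)) - 1) * (L - real r * Z)"
proof -
  define s t where "s = real (card S) - 1" and "t = real (card T) - 1"
  define l a b where "l = real (card D) - 1" and "a = real (card (coverS D)) - 1" and "b = real (card (coverT D)) - 1"
  have s1: "1 \<le> s" and t1: "1 \<le> t" using S2 T2 by (auto simp: s_def t_def)
  have R2: "2 \<le> real r" using r2 by simp
  have finD: "finite D" using D finite_tedges finite_subset by blast
  have l0: "0 \<le> l" using D finD by (simp add: l_def Suc_le_eq card_gt_0_iff)
  have a0: "0 \<le> a"
  proof -
    have "finite (coverS D)" using finS by (simp add: coverS_def)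
    then show ?thesis using tedges_cover[OF D] by (simp add: a_def Suc_le_eq card_gt_0_iff)
  qed
  define w where "w = s + real r * t"
  have "0 < real r * t" using R2 t1 by simp
  then have w0: "0 < w" using s1 by (simp add: w_def)
  have W: "s * (l - b) \<le> (s + (real r - 1) * t) * a"
  proof -
    have "l - b \<le> (1 + (real r - 1) * t / s) * a" using weight_bal[OF D] by (simp add: l_def a_def b_def s_def t_def)
    then have "s * (l - b) \<le> s * ((1 + (real r - 1) * t / s) * a)" using s1 by (intro mult_left_mono) auto
    also have "\<dots> = (s + (real r - 1) * t) * a" using s1 by (simp add: field_simps)
    finally show ?thesis .
  qed
  have De: "l * (s + t) \<le> (a + b) * w"
    using density_bal[OF D] by (simp add: l_def a_def b_def s_def t_def w_def algebra_simps)
  have \<alpha>: "\<alpha> * w = s + t" using w0 by (simp add: \<alpha>_def s_def t_def w_def)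
  show ?thesis
  proof (cases "w * Z \<le> t * L")
    case True
    define f where "f z = l * (z - \<alpha> * L) + a * (L - z) + b * (L - real r * z)" for z
    have f0: "0 \<le> w * f 0"
    proof -
      have "w * f 0 = ((a + b) * w - l * (\<alpha> * w)) * L" by (simp add: f_def algebra_simps)
      also have "\<dots> \<ge> 0" unfolding \<alpha> using De L by (intro mult_nonneg_nonneg) auto
      finally show ?thesis .
    qed
    have f1: "0 \<le> w * f (t * L / w)"
    proof -
      have "w * f (t * L / w) = l * (t * L - \<alpha> * w * L) + a * (w * L - t * L) + b * (w * L - real r * (t * L))"
        using w0 by (simp add: f_def field_simps)
      also have "\<dots> = ((s + (real r - 1) * t) * a - s * (l - b)) * L" unfolding \<alpha> by (simp add: w_def algebra_simps)
      also have "\<dots> \<ge> 0" using W L by (intro mult_nonneg_nonneg) auto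
      finally show ?thesis .
    qed
    have "(t * L) * f Z = (w * Z) * f (t * L / w) + (t * L - w * Z) * f 0"
      using w0 by (simp add: f_def field_simps)
    moreover have "0 \<le> (w * Z) * f (t * L / w)"
      using f1 w0 Z by (metis mult.assoc mult.commute mult_nonneg_nonneg)
    moreover have "0 \<le> f 0" using f0 w0 by (simp add: zero_le_mult_iff)
    then have "0 \<le> (t * L - w * Z) * f 0" using True by (intro mult_nonneg_nonneg) auto
    ultimately have "0 \<le> (t * L) * f Z" by linarith
    moreover have "0 < t * L" using t1 L by simp
    ultimately have "0 \<le> f Z" by (metis zero_le_mult_iff not_less)
    also have "f Z \<le> l * \<Theta> + a * (L - Z) + b * (L - real r * Z)"
      unfolding f_def using \<Theta>(2) l0 by (intro add_right_mono mult_left_mono)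
    finally show ?thesis by (simp add: l_def a_def b_def)
  next
    case False
    define R where "R = L - real r * Z"
    have XR: "0 \<le> s * (L - Z) - (s + (real r - 1) * t) * R"
    proof -
      have "s * (L - Z) - (s + (real r - 1) * t) * R = (real r - 1) * (w * Z - t * L)"
        by (simp add: R_def w_def algebra_simps)
      also have "\<dots> \<ge> 0" using False R2 by (intro mult_nonneg_nonneg) auto
      finally show ?thesis .
    qed
    have "0 \<le> a * (s * (L - Z) - (s + (real r - 1) * t) * R)" using a0 XR by (intro mult_nonneg_nonneg)
    also have "\<dots> = s * (a * (L - Z)) - ((s + (real r - 1) * t) * a) * R" by (simp add: algebra_simps)
    also have "\<dots> \<le> s * (a * (L - Z)) - (s * (l - b)) * R"
      using W Z(3) by (intro diff_left_mono mult_right_mono) (auto simp: R_def)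
    also have "\<dots> = s * (a * (L - Z) + b * R - l * R)" by (simp add: algebra_simps)
    finally have "0 \<le> a * (L - Z) + b * R - l * R" using s1 by (simp add: zero_le_mult_iff)
    moreover have "l * (- R) \<le> l * \<Theta>" using \<Theta>(1) l0 by (intro mult_left_mono) (auto simp: R_def)
    then have "- (l * R) \<le> l * \<Theta>" by simp
    ultimately have "0 \<le> l * \<Theta> + a * (L - Z) + b * R" by linarith
    then show ?thesis by (simp add: l_def a_def b_def R_def)
  qed
qed

text \<open>This factor makes \<open>\<rho> = n * (x / n) ^ r / A0\<close> the largest codegree threshold for which most stars are good.\<close>
definition A0 where "A0 = 4 * real (card T)"

text \<open>Exponentiates \<open>exponent_inequality\<close> for \<open>\<rho> * A0\<close> and \<open>\<sigma> / A0\<close>. The powers of \<open>A0\<close> work in the right direction, as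
  \<open>card (coverT D) \<le> card D\<close>.\<close>
lemma balance_condition:
  fixes n x :: nat and \<sigma> \<rho> :: real
  assumes D: "D \<subseteq> tedges" "D \<noteq> {}" and n: "2 \<le> n" and x: "0 < x" "x \<le> n"
    and \<rho>: "\<rho> = real n * (real x / real n) ^ r / A0" "1 \<le> \<rho>"
    and \<sigma>: "1 / \<rho> \<le> \<sigma>" "A0 * real n powr (1 - \<alpha>) / real x \<le> \<sigma>"
  shows "1 \<le> \<sigma> ^ (card D - 1) * real x ^ (card (coverS D) - 1) * \<rho> ^ (card (coverT D) - 1)"
proof -
  have A0: "1 \<le> A0" using T2 by (simp add: A0_def)
  have pos: "0 < real x" "0 < real n" using x n by auto
  define \<rho>1 where "\<rho>1 = A0 * \<rho>"
  define \<theta> where "\<theta> = \<sigma> / A0"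
  have \<rho>1: "1 \<le> \<rho>1" using A0 \<rho>(2) mult_mono[of 1 A0 1 \<rho>] by (simp add: \<rho>1_def)
  have \<rho>1e: "\<rho>1 = real n * (real x / real n) ^ r" using A0 by (simp add: \<rho>1_def \<rho>(1))
  have \<sigma>0: "0 < \<sigma>" using \<sigma>(1) \<rho>(2) by (smt (verit) divide_pos_pos)
  have \<theta>0: "0 < \<theta>" using \<sigma>0 A0 by (simp add: \<theta>_def)
  have finD: "finite D" using D finite_tedges finite_subset by blast
  have l1: "1 \<le> card D" using D finD by (simp add: Suc_le_eq card_gt_0_iff)
  have a1: "1 \<le> card (coverS D)" "1 \<le> card (coverT D)"
    using tedges_cover[OF D] finS finT by (simp_all add: Suc_le_eq card_gt_0_iff coverS_def coverT_def)
  define L Z where "L = ln (real n)" and "Z = ln (real n) - ln (real x)"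
  have lnx: "ln (real x) = L - Z" by (simp add: L_def Z_def)
  have ln\<rho>: "ln \<rho>1 = L - real r * Z"
    unfolding \<rho>1e using pos by (simp add: ln_mult ln_realpow ln_div L_def Z_def algebra_simps)
  have "0 \<le> (real (card D) - 1) * ln \<theta> + (real (card (coverS D)) - 1) * (L - Z) + (real (card (coverT D)) - 1) * (L - real r * Z)"
  proof (rule exponent_inequality[OF D])
    show "0 < L" using n by (simp add: L_def)
    show "0 \<le> Z" using x pos by (simp add: Z_def)
    show "Z \<le> L" using x by (simp add: Z_def L_def)
    show "0 \<le> L - real r * Z" unfolding ln\<rho>[symmetric] using \<rho>1 by simp
    have "1 / \<rho>1 \<le> \<theta>" using \<sigma>(1) A0 by (simp add: \<rho>1_def \<theta>_def field_simps)
    then have "ln (1 / \<rho>1) \<le> ln \<theta>" using \<rho>1 \<theta>0 by (intro ln_mono) auto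
    then show "- (L - real r * Z) \<le> ln \<theta>" unfolding ln\<rho>[symmetric] using \<rho>1 by (simp add: ln_div)
    have "real n powr (1 - \<alpha>) / real x \<le> \<theta>" using \<sigma>(2) A0 by (simp add: \<theta>_def field_simps)
    then have "ln (real n powr (1 - \<alpha>) / real x) \<le> ln \<theta>" using pos \<theta>0 by (intro ln_mono) auto
    then show "Z - \<alpha> * L \<le> ln \<theta>" using pos by (simp add: ln_div ln_powr L_def Z_def algebra_simps)
  qed
  also have "\<dots> = ln (\<theta> ^ (card D - 1) * real x ^ (card (coverS D) - 1) * \<rho>1 ^ (card (coverT D) - 1))"
    using \<theta>0 pos \<rho>1 l1 a1 by (simp add: ln_mult ln_realpow lnx[symmetric] ln\<rho>[symmetric] of_nat_diff)
  finally have "1 \<le> \<theta> ^ (card D - 1) * real x ^ (card (coverS D) - 1) * \<rho>1 ^ (card (coverT D) - 1)"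
    using \<theta>0 pos \<rho>1 by (subst (asm) ln_ge_zero_iff) auto
  also have "\<dots> = (\<sigma> ^ (card D - 1) * real x ^ (card (coverS D) - 1) * \<rho> ^ (card (coverT D) - 1)) * (A0 ^ (card (coverT D) - 1) / A0 ^ (card D - 1))"
    by (simp add: \<theta>_def \<rho>1_def power_mult_distrib power_divide)
  also have "\<dots> \<le> (\<sigma> ^ (card D - 1) * real x ^ (card (coverS D) - 1) * \<rho> ^ (card (coverT D) - 1)) * 1"
  proof (intro mult_left_mono)
    have "A0 ^ (card (coverT D) - 1) \<le> A0 ^ (card D - 1)"
      using A0 card_coverT_le[OF D(1)] by (intro power_increasing) auto
    then show "A0 ^ (card (coverT D) - 1) / A0 ^ (card D - 1) \<le> 1" using A0 by simp
  qed (use \<sigma>0 \<rho> pos in auto)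
  finally show ?thesis by simp
qed

text \<open>The logarithm is absorbed into \<open>(q / u) powr (1/4)\<close>, so that the main term of the final bound is free of logarithms.\<close>
lemma cost_bound:
  fixes u q :: real
  assumes "0 < u" "u \<le> q" "0 \<le> k"
  shows "u * (2 + k * ln (q / u)) \<le> (2 + 4 * k) * (q powr (1/4) * u powr (3/4))"
proof -
  define y where "y = q / u"
  have y1: "1 \<le> y" using assms by (simp add: y_def)
  have "ln (y powr (1/4)) \<le> y powr (1/4) - 1" using y1 by (intro ln_le_minus_one) auto
  then have "ln y \<le> 4 * y powr (1/4)" using y1 by (simp add: ln_powr)
  moreover have "1 \<le> y powr (1/4)" using y1 by (simp add: ge_one_powr_ge_zero)
  ultimately have "2 + k * ln y \<le> 2 * y powr (1/4) + k * (4 * y powr (1/4))"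
    using assms by (intro add_mono mult_left_mono) auto
  then have "u * (2 + k * ln y) \<le> u * ((2 + 4 * k) * y powr (1/4))"
    using assms by (intro mult_left_mono) (auto simp: algebra_simps)
  also have "\<dots> = (2 + 4 * k) * (q powr (1/4) * (u / u powr (1/4)))"
    using assms by (simp add: y_def powr_divide)
  also have "u / u powr (1/4) = u powr (3/4)"
    using assms powr_diff[of u 1 "1/4"] by simp
  finally show ?thesis by (simp add: y_def)
qed

text \<open>A discrete form of the fact that \<open>e powr (-3/2) / 2\<close> is the derivative of \<open>- 1 / sqrt e\<close>; it lets costs proportional to
  \<open>e powr (-3/2)\<close> per edge telescope.\<close>
lemma inverse_sqrt_gap:
  fixes e e' :: real
  assumes "0 < e'" "e' \<le> e"
  shows "(e - e') / (2 * e powr (3/2)) \<le> 1 / sqrt e' - 1 / sqrt e"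
proof -
  define u v where "u = sqrt e'" and "v = sqrt e"
  have u0: "0 < u" and uv: "u \<le> v" using assms by (auto simp: u_def v_def)
  have e: "e = v\<^sup>2" "e' = u\<^sup>2" using assms by (auto simp: u_def v_def)
  have v0: "0 < v" using u0 uv by linarith
  have "v ^ 3 = v powr 3" using v0 by simp
  moreover have veq: "v = e powr (1/2)" using assms by (simp add: v_def powr_half_sqrt)
  have "v powr 3 = e powr (3/2)" unfolding veq by (simp add: powr_powr)
  ultimately have e32: "e powr (3/2) = v ^ 3" by simp
  have "u * (u + v) * v \<le> v * (v + v) * v" using u0 uv by (intro mult_mono) auto
  then have "(v - u) * (v + u) * (u * v) \<le> (v - u) * (2 * v ^ 3)"
    using mult_left_mono[of "(v + u) * (u * v)" "2 * v ^ 3" "v - u"] uv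
    by (simp add: power3_eq_cube algebra_simps)
  then have "(v\<^sup>2 - u\<^sup>2) * (u * v) \<le> (v - u) * (2 * v ^ 3)"
    by (simp add: power2_eq_square algebra_simps)
  then have "(v\<^sup>2 - u\<^sup>2) / (2 * v ^ 3) \<le> (v - u) / (u * v)"
    using u0 v0 by (simp add: pos_divide_le_eq pos_le_divide_eq mult_ac)
  also have "(v - u) / (u * v) = 1 / u - 1 / v" using u0 v0 by (simp add: field_simps)
  finally show ?thesis unfolding e32 by (simp add: e u_def[symmetric] v_def[symmetric] u0 v0 less_imp_le)
qed

text \<open>
  The three parts of \<open>A1\<close> ensure in turn that \<open>\<sigma> \<le> q / 8\<close>, that \<open>\<rho>\<close> is large enough for injective copies, and that
  \<open>x \<ge> 4 * (card S)\<^sup>2\<close>. The two parts of \<open>c1\<close> belong to the two lower bounds for the density \<open>\<sigma>\<close> of the picks.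
\<close>
definition A1 :: real where
  "A1 = max (max (4 * (8 * A0)) (4 * (A0 * (4 * (real (card S) + real (card T)))))) (32 * real ((card S)\<^sup>2) + 8)"
definition c1 :: real where
  "c1 = 2 / \<delta>0 * max (2 + 4 * real kk) (4 * A0 * (2 + 2 * real kk))"

lemma A1_bounds:
  "32 * A0 \<le> A1" "4 * (A0 * (4 * (real (card S) + real (card T)))) \<le> A1" "32 * real ((card S)\<^sup>2) + 8 \<le> A1" "8 \<le> A1"
proof -
  have "4 * (8 * A0) \<le> A1" and b: "4 * (A0 * (4 * (real (card S) + real (card T)))) \<le> A1"
    and c: "32 * real ((card S)\<^sup>2) + 8 \<le> A1"
    unfolding A1_def le_max_iff_disj by (simp_all only: order.refl simp_thms)
  then show "32 * A0 \<le> A1" by (simp only: mult.assoc[symmetric])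
  show "4 * (A0 * (4 * (real (card S) + real (card T)))) \<le> A1" by (rule b)
  show "32 * real ((card S)\<^sup>2) + 8 \<le> A1" by (rule c)
  then show "8 \<le> A1" by (smt (verit) of_nat_0_le_iff)
qed

lemma c1_nonneg: "0 \<le> c1"
  using constants(3) by (simp add: c1_def le_max_iff_disj)

lemma edge_threshold_ge:
  assumes n: "2 \<le> n" and q: "0 < q" "q \<le> 2"
  shows "A1 / 2 * real n \<le> A1 * real n powr (2 - 1 / real r) * q powr (- (1 / real r))"
proof -
  have r2r: "2 \<le> real r" using r2 by simp
  have "(1/2 :: real) \<le> 2 powr (-1)" by (simp add: powr_minus)
  also have "\<dots> \<le> 2 powr (- (1 / real r))" using r2r by (intro powr_mono) auto
  also have "\<dots> \<le> q powr (- (1 / real r))" using q by (intro powr_mono2') auto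
  finally have "1/2 \<le> q powr (- (1 / real r))" .
  moreover have "real n powr 1 \<le> real n powr (2 - 1 / real r)" using n r2r by (intro powr_mono) (auto simp: field_simps)
  ultimately have "A1 * (real n powr 1) * (1/2) \<le> A1 * real n powr (2 - 1 / real r) * q powr (- (1 / real r))"
    using A1_bounds(4) by (intro mult_mono) auto
  then show ?thesis using n by simp
qed

text \<open>Take \<open>\<sigma>\<close> to be the larger of the two lower bounds in \<open>balance_condition\<close>. If it is \<open>1 / \<rho>\<close>, which is at most \<open>q * (e0 / e) ^ r\<close> for
  \<open>e = card E\<close>, then \<open>cost_bound\<close> and \<open>r \<ge> 2\<close> give the cost \<open>q * (e0 / e) powr (3/2)\<close> per removed edge. If it is the other one, which
  is of order \<open>n powr (2 - \<alpha>) / e\<close>, the logarithm in the cost is estimated trivially by \<open>ln n\<close>.\<close>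
lemma one_step_cost:
  fixes n :: nat and q :: real and E :: "nat set set"
  defines "e0 \<equiv> A1 * real n powr (2 - 1 / real r) * q powr (- (1 / real r))"
  assumes n: "2 \<le> n" and q: "0 < q" "q \<le> 2" and dense: "32 * A0 * real n powr (2 - \<alpha>) \<le> q * e0"
    and E: "E \<subseteq> nsets {..<n} 2" "e0 \<le> real (card E)"
  shows "\<exists>Y\<subseteq>E. 0 < card (E - Y) \<and> 2 * card (E - Y) \<le> card E \<and>
    activity_sum (free_sets {..<n}) q {} E
     \<le> exp (c1 * (q * (e0 / real (card E)) powr (3/2) + real n powr (2 - \<alpha>) * (1 + ln (real n)) / real (card E)) * real (card (E - Y)))
        * activity_sum (free_sets {..<n}) q {} Y"
proof -
  define e where "e = card E"
  \<comment> \<open>the requirement \<open>2 * n * x \<le> card E\<close> with the largest possible \<open>x\<close>\<close>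
  define x where "x = e div (2 * n)"
  have T2r: "2 \<le> real (card T)" "2 \<le> real (card S)" using T2 S2 by auto
  have A0: "8 \<le> A0" using T2r by (simp add: A0_def)
  note A1 = A1_bounds(1-3) and A1p = A1_bounds(4)
  have npos: "0 < real n" using n by simp
  have r2r: "2 \<le> real r" using r2 by simp
  have e0r: "e0 ^ r = A1 ^ r * real n ^ (2 * r - 1) / q"
  proof -
    have "(real n powr (2 - 1 / real r)) ^ r = real n powr (real (2 * r - 1))"
    proof -
      have "(2 - 1 / real r) * real r = real (2 * r - 1)" using r2 by (simp add: of_nat_diff left_diff_distrib)
      then show ?thesis using npos by (simp add: powr_realpow[symmetric] powr_powr)
    qed
    also have "\<dots> = real n ^ (2 * r - 1)" using npos by (rule powr_realpow)
    finally have 1: "(real n powr (2 - 1 / real r)) ^ r = real n ^ (2 * r - 1)" .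
    have "(q powr (- (1 / real r))) ^ r = q powr (-1)"
      using q r2 by (simp add: powr_realpow[symmetric] powr_powr)
    also have "\<dots> = 1 / q" using q by (simp add: powr_minus_divide)
    finally show ?thesis by (simp add: e0_def power_mult_distrib 1)
  qed
  have e0n: "A1 / 2 * real n \<le> e0" unfolding e0_def by (rule edge_threshold_ge[OF n q])
  have e0pos: "0 < e0" using e0n A1p npos by (smt (verit) mult_pos_pos divide_pos_pos)
  have ee: "e0 \<le> real e" using E by (simp add: e_def)
  have e4: "4 * n \<le> e"
  proof -
    have "4 * real n \<le> A1 / 2 * real n" using A1p by (intro mult_right_mono) auto
    then have "real (4 * n) \<le> real e" using e0n ee by simp
    then show ?thesis by (simp only: of_nat_le_iff)
  qed
  have x2: "2 * n * x \<le> e" unfolding x_def by (rule times_div_less_eq_dividend)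
  have xe: "real e \<le> 4 * real n * real x"
  proof -
    have "e < 2 * n * x + 2 * n" using n unfolding x_def
      by (metis add.commute dividend_less_times_div mult.commute mult_2 nat_0_less_mult_iff zero_less_numeral less_le_trans n pos2)
    then have "e \<le> 4 * n * x" using e4 by (cases x) auto
    then have "real e \<le> real (4 * n * x)" by (rule of_nat_mono)
    then show ?thesis by simp
  qed
  have epos: "0 < real e" using ee e0pos by linarith
  have x0: "0 < x" using xe epos by (cases "x = 0") auto
  have xn: "x \<le> n"
  proof -
    have "card E \<le> n * n" by (rule card_pairs_le_square[OF E(1)])
    then have "2 * n * x \<le> n * n" by (rule order_trans[OF x2[unfolded e_def]])
    then have "n * (2 * x) \<le> n * n" by (simp add: mult_ac)
    moreover have "0 < n" using n by simp
    ultimately have "2 * x \<le> n" by (simp only: mult_le_cancel1 simp_thms)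
    then show ?thesis by simp
  qed
  define \<rho> where "\<rho> = real n * (real x / real n) ^ r / A0"
  define \<sigma> where "\<sigma> = max (1 / \<rho>) (A0 * real n powr (1 - \<alpha>) / real x)"
  have \<rho>0: "0 < \<rho>" using npos x0 A0 by (simp add: \<rho>_def)
  define \<kappa> where "\<kappa> = A0 * (4 / A1) ^ r"
  have u1: "1 / \<rho> \<le> \<kappa> * q * (e0 / real e) ^ r"
  proof -
    have "1 / \<rho> = A0 * (real n ^ r / real n) / real x ^ r" using npos x0 A0 by (simp add: \<rho>_def field_simps)
    also have "\<dots> \<le> A0 * (real n ^ r / real n) / (real e / (4 * real n)) ^ r"
      using xe npos x0 A0 epos by (intro divide_left_mono power_mono mult_nonneg_nonneg) (auto simp: field_simps)
    also have "\<dots> = A0 * 4 ^ r * (real n ^ (2 * r - 1)) / real e ^ r"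
    proof -
      have "real n ^ r * real n ^ r = real n * real n ^ (2 * r - 1)"
        using r2 by (simp add: power_add[symmetric] power_Suc[symmetric] mult_2 del: power_Suc)
      then show ?thesis using npos epos by (simp add: power_divide power_mult_distrib field_simps)
    qed
    also have "\<dots> = \<kappa> * q * (e0 / real e) ^ r"
      using q A1p epos by (simp add: power_divide e0r \<kappa>_def)
    finally show ?thesis .
  qed
  have \<kappa>: "\<kappa> \<le> 1/8" "\<kappa> * (4 * (real (card S) + real (card T))) \<le> 1" "0 < \<kappa>"
  proof -
    have le: "(4 / A1) ^ r \<le> (4 / A1) ^ 1" using A1p r2 by (intro power_decreasing) auto
    then have k: "\<kappa> \<le> 4 * A0 / A1" using A0 mult_left_mono[OF le, of A0] by (simp add: \<kappa>_def mult.commute[of A0 4])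
    also have "4 * A0 / A1 \<le> 1/8" using A1 A1p by (simp add: field_simps)
    finally show "\<kappa> \<le> 1/8" .
    have "\<kappa> * (4 * (real (card S) + real (card T))) \<le> 4 * A0 / A1 * (4 * (real (card S) + real (card T)))"
      using k by (intro mult_right_mono) auto
    also have "\<dots> = (4 * (A0 * (4 * (real (card S) + real (card T))))) / A1" by (simp only: times_divide_eq_left mult.assoc)
    also have "\<dots> \<le> 1" using A1(2) A1p by (subst divide_le_eq_1_pos) auto
    finally show "\<kappa> * (4 * (real (card S) + real (card T))) \<le> 1" .
    show "0 < \<kappa>" using A0 A1p by (simp add: \<kappa>_def)
  qed
  have er1: "e0 / real e \<le> 1" "0 < e0 / real e" using ee e0pos epos by auto
  have u1q: "1 / \<rho> \<le> \<kappa> * q"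
  proof -
    have "\<kappa> * q * (e0 / real e) ^ r \<le> \<kappa> * q * 1" using er1 \<kappa> q by (intro mult_left_mono power_le_one) auto
    then show ?thesis using u1 by simp
  qed
  have u2: "A0 * real n powr (1 - \<alpha>) / real x \<le> 4 * A0 * real n powr (2 - \<alpha>) / real e"
  proof -
    have "A0 * real n powr (1 - \<alpha>) / real x \<le> A0 * real n powr (1 - \<alpha>) / (real e / (4 * real n))"
      using xe npos x0 A0 epos by (intro divide_left_mono mult_nonneg_nonneg mult_pos_pos) (auto simp: field_simps)
    also have "\<dots> = 4 * A0 * (real n powr (1 - \<alpha>) * real n) / real e" by simp
    also have "real n powr (1 - \<alpha>) * real n = real n powr (2 - \<alpha>)"
      using npos powr_add[of "real n" "1 - \<alpha>" 1] by simp
    finally show ?thesis .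
  qed
  have u2q: "A0 * real n powr (1 - \<alpha>) / real x \<le> q / 8"
  proof -
    have "4 * A0 * real n powr (2 - \<alpha>) / real e \<le> (q * e0 / 8) / real e"
      using dense epos by (intro divide_right_mono) auto
    also have "\<dots> = q / 8 * (e0 / real e)" by simp
    also have "\<dots> \<le> q / 8 * 1" using er1 q by (intro mult_left_mono) auto
    finally have a: "4 * A0 * real n powr (2 - \<alpha>) / real e \<le> q / 8" by (simp only: mult_1_right)
    show ?thesis by (rule order_trans[OF u2 a])
  qed
  have \<sigma>q: "\<sigma> \<le> q / 8"
  proof -
    have "\<kappa> * q \<le> 1/8 * q" using \<kappa> q by (intro mult_right_mono) auto
    then show ?thesis using u1q u2q by (simp add: \<sigma>_def)
  qed
  have \<sigma>0: "0 < \<sigma>" using \<rho>0 by (simp add: \<sigma>_def less_max_iff_disj)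
  have \<rho>big: "2 * (real (card S) + real (card T)) \<le> \<rho>"
  proof -
    have "\<kappa> * q \<le> \<kappa> * 2" using q \<kappa> by (intro mult_left_mono) auto
    then have "1 / \<rho> \<le> \<kappa> * 2" by (rule order_trans[OF u1q])
    then have "1 \<le> \<kappa> * 2 * \<rho>" using \<rho>0 by (simp add: field_simps)
    moreover have "\<kappa> * 2 * (2 * (real (card S) + real (card T))) \<le> 1" using \<kappa>(2) by (simp add: algebra_simps)
    ultimately have "\<kappa> * 2 * (2 * (real (card S) + real (card T))) \<le> \<kappa> * 2 * \<rho>" by linarith
    then show ?thesis using \<kappa>(3) by simp
  qed
  have "2 * (2 + 2) \<le> 2 * (real (card S) + real (card T))" using T2r by (intro mult_left_mono add_mono) auto
  then have \<rho>1: "1 \<le> \<rho>" using \<rho>big by simp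
  have xl: "4 * (card S)\<^sup>2 \<le> x"
  proof -
    have "32 * real ((card S)\<^sup>2) / 2 * real n \<le> A1 / 2 * real n" using A1(3) by (intro mult_right_mono divide_right_mono) auto
    also have "\<dots> \<le> 4 * real n * real x" using e0n ee xe by linarith
    finally have "4 * real n * (4 * real ((card S)\<^sup>2)) \<le> 4 * real n * real x" by (simp add: mult_ac)
    then have "4 * real ((card S)\<^sup>2) \<le> real x" using npos by (subst (asm) mult_le_cancel_left_pos) auto
    then have "real (4 * (card S)\<^sup>2) \<le> real x" by simp
    then show ?thesis by (simp only: of_nat_le_iff)
  qed
  have "\<exists>Y\<subseteq>E. 0 < card (E - Y) \<and> 2 * card (E - Y) \<le> card E \<and>
    activity_sum (free_sets {..<n}) q {} E
     \<le> exp (2 / \<delta>0 * \<sigma> * (2 + real kk * ln (q / \<sigma>)) * real (card (E - Y))) * activity_sum (free_sets {..<n}) q {} Y"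
  proof (rule graph_container_step[where x=x and \<rho>=\<rho>])
    show "4 * real (card T) * \<rho> * real n ^ r \<le> real n * real x ^ r"
      using npos T2r by (simp add: \<rho>_def A0_def power_divide)
    show "1 / \<rho> \<le> \<sigma>" by (simp add: \<sigma>_def)
    show "4 * \<sigma> \<le> 1" "2 * \<sigma> \<le> q" using \<sigma>q q \<sigma>0 by linarith+
    show "1 \<le> \<sigma> ^ (card D - 1) * real x ^ (card (coverS D) - 1) * \<rho> ^ (card (coverT D) - 1)"
      if "D \<subseteq> tedges" "D \<noteq> {}" for D
      by (rule balance_condition[OF that n x0 xn \<rho>_def \<rho>1]) (auto simp: \<sigma>_def)
  qed (use E n x0 x2 \<rho>big xl in \<open>auto simp: e_def\<close>)
  then obtain Y where Y: "Y \<subseteq> E" "0 < card (E - Y)" "2 * card (E - Y) \<le> card E"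
    "activity_sum (free_sets {..<n}) q {} E
     \<le> exp (2 / \<delta>0 * \<sigma> * (2 + real kk * ln (q / \<sigma>)) * real (card (E - Y))) * activity_sum (free_sets {..<n}) q {} Y"
    by blast
  define \<Lambda> where "\<Lambda> = 1 + ln (real n)"
  have \<Lambda>1: "1 \<le> \<Lambda>" using n by (simp add: \<Lambda>_def)
  have cst: "\<sigma> * (2 + real kk * ln (q / \<sigma>)) \<le> max (2 + 4 * real kk) (4 * A0 * (2 + 2 * real kk)) * (q * (e0 / real e) powr (3/2) + real n powr (2 - \<alpha>) * \<Lambda> / real e)"
  proof (cases "A0 * real n powr (1 - \<alpha>) / real x \<le> 1 / \<rho>")
    case True
    then have \<sigma>: "\<sigma> = 1 / \<rho>" by (simp add: \<sigma>_def)
    have "\<sigma> * (2 + real kk * ln (q / \<sigma>)) \<le> (2 + 4 * real kk) * (q powr (1/4) * \<sigma> powr (3/4))"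
      using \<sigma>0 \<sigma>q q by (intro cost_bound) auto
    also have "\<dots> \<le> (2 + 4 * real kk) * (q * (e0 / real e) powr (3/2))"
    proof (intro mult_left_mono)
      have "\<sigma> powr (3/4) \<le> (q * (e0 / real e)\<^sup>2) powr (3/4)"
      proof (intro powr_mono2)
        have "\<kappa> * q * (e0 / real e) ^ r \<le> 1 * q * (e0 / real e) ^ 2"
          using \<kappa> q er1 r2 by (intro mult_mono power_decreasing) auto
        then show "\<sigma> \<le> q * (e0 / real e)\<^sup>2" using u1 \<sigma> by simp
      qed (use \<sigma>0 in auto)
      also have "(q * (e0 / real e)\<^sup>2) powr (3/4) = q powr (3/4) * (e0 / real e) powr (3/2)"
      proof -
        have w: "(e0 / real e)\<^sup>2 = (e0 / real e) powr 2" using er1 by simp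
        have "((e0 / real e) powr 2) powr (3/4) = (e0 / real e) powr (3/2)" by (simp only: powr_powr) simp
        then show ?thesis using er1 q unfolding w by (simp only: powr_mult)
      qed
      finally have "q powr (1/4) * \<sigma> powr (3/4) \<le> q powr (1/4) * (q powr (3/4) * (e0 / real e) powr (3/2))"
        by (intro mult_left_mono) auto
      also have "\<dots> = q * (e0 / real e) powr (3/2)"
        using q by (simp add: powr_add[symmetric] mult.assoc[symmetric])
      finally show "q powr (1/4) * \<sigma> powr (3/4) \<le> q * (e0 / real e) powr (3/2)" .
    qed auto
    also have "\<dots> \<le> max (2 + 4 * real kk) (4 * A0 * (2 + 2 * real kk)) * (q * (e0 / real e) powr (3/2) + real n powr (2 - \<alpha>) * \<Lambda> / real e)"
      using q \<Lambda>1 by (intro mult_mono) auto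
    finally show ?thesis by simp
  next
    case False
    then have \<sigma>: "\<sigma> = A0 * real n powr (1 - \<alpha>) / real x" by (simp add: \<sigma>_def)
    have n1\<alpha>: "1 \<le> real n * real n powr (1 - \<alpha>)"
    proof -
      have t1: "1 \<le> real (card T) - 1" and s1: "1 \<le> real (card S) - 1" using T2r by auto
      have "1 * (real (card T) - 1) \<le> real r * (real (card T) - 1)" using r2r t1 by (intro mult_right_mono) auto
      moreover define a b c where "a = real (card S) - 1" and "b = real (card T) - 1" and "c = real r * (real (card T) - 1)"
      ultimately have abc: "1 \<le> a" "1 \<le> b" "b \<le> c" using s1 t1 by auto
      have "\<alpha> = (a + b) / (a + c)" by (simp add: \<alpha>_def a_def b_def c_def)
      also have "\<dots> \<le> 1" using abc by (subst divide_le_eq_1_pos) auto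
      finally have "\<alpha> \<le> 1" .
      then have "1 \<le> real n powr (1 - \<alpha>)" using n by (intro ge_one_powr_ge_zero) auto
      then show ?thesis using n mult_mono[of 1 "real n" 1 "real n powr (1 - \<alpha>)"] by simp
    qed
    have "ln (q / \<sigma>) \<le> ln (real n ^ 2)"
    proof (intro ln_mono)
      have "q / \<sigma> = q * real x / (A0 * real n powr (1 - \<alpha>))" using \<sigma> by simp
      also have "\<dots> \<le> 2 * real n / (2 * (1 / real n))"
      proof (rule frac_le)
        show "q * real x \<le> 2 * real n" using q xn by (intro mult_mono) auto
        show "2 * (1 / real n) \<le> A0 * real n powr (1 - \<alpha>)"
          using A0 n1\<alpha> npos by (intro mult_mono) (auto simp: field_simps)
      qed (use q xn npos in auto)
      finally show "q / \<sigma> \<le> real n ^ 2" using npos by (simp add: power2_eq_square)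
    qed (use q \<sigma>0 in auto)
    then have "ln (q / \<sigma>) \<le> 2 * \<Lambda>" using npos by (simp add: ln_realpow \<Lambda>_def)
    then have "2 + real kk * ln (q / \<sigma>) \<le> 2 * \<Lambda> + real kk * (2 * \<Lambda>)"
      using \<Lambda>1 by (intro add_mono mult_left_mono) auto
    then have c2: "\<sigma> * (2 + real kk * ln (q / \<sigma>)) \<le> (4 * A0 * real n powr (2 - \<alpha>) / real e) * ((2 + 2 * real kk) * \<Lambda>)"
    proof -
      assume "2 + real kk * ln (q / \<sigma>) \<le> 2 * \<Lambda> + real kk * (2 * \<Lambda>)"
      then have "2 + real kk * ln (q / \<sigma>) \<le> (2 + 2 * real kk) * \<Lambda>" by (simp add: algebra_simps)
      then have "\<sigma> * (2 + real kk * ln (q / \<sigma>)) \<le> \<sigma> * ((2 + 2 * real kk) * \<Lambda>)"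
        using \<sigma>0 by (intro mult_left_mono) auto
      also have "\<dots> \<le> (4 * A0 * real n powr (2 - \<alpha>) / real e) * ((2 + 2 * real kk) * \<Lambda>)"
        using u2 \<Lambda>1 unfolding \<sigma> by (intro mult_right_mono) auto
      finally show ?thesis .
    qed
    also have "\<dots> = (4 * A0 * (2 + 2 * real kk)) * (real n powr (2 - \<alpha>) * \<Lambda> / real e)" by simp
    also have "\<dots> \<le> max (2 + 4 * real kk) (4 * A0 * (2 + 2 * real kk)) * (q * (e0 / real e) powr (3/2) + real n powr (2 - \<alpha>) * \<Lambda> / real e)"
      using q \<Lambda>1 A0 by (intro mult_mono) auto
    finally show ?thesis .
  qed
  have "2 / \<delta>0 * \<sigma> * (2 + real kk * ln (q / \<sigma>)) * real (card (E - Y))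
      = 2 / \<delta>0 * (\<sigma> * (2 + real kk * ln (q / \<sigma>))) * real (card (E - Y))" by simp
  also have "\<dots> \<le> 2 / \<delta>0 * (max (2 + 4 * real kk) (4 * A0 * (2 + 2 * real kk)) * (q * (e0 / real e) powr (3/2) + real n powr (2 - \<alpha>) * \<Lambda> / real e)) * real (card (E - Y))"
    using cst constants(3) by (intro mult_right_mono mult_left_mono) auto
  also have "\<dots> = c1 * (q * (e0 / real e) powr (3/2) + real n powr (2 - \<alpha>) * \<Lambda> / real e) * real (card (E - Y))"
    by (simp add: c1_def)
  finally have "activity_sum (free_sets {..<n}) q {} E
     \<le> exp (c1 * (q * (e0 / real e) powr (3/2) + real n powr (2 - \<alpha>) * \<Lambda> / real e) * real (card (E - Y))) * activity_sum (free_sets {..<n}) q {} Y"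
    using Y(4) activity_sum_nonneg[of q "free_sets {..<n}" "{}" Y] q by (smt (verit) exp_le_cancel_iff mult_right_mono)
  then show ?thesis using Y by (intro exI[of _ Y]) (auto simp: e_def \<Lambda>_def)
qed

text \<open>Starting from \<open>E\<close>, \<open>one_step_cost\<close> is applied until fewer than \<open>e0\<close> edges remain. The potential \<open>\<Phi>\<close> consists of the cost of
  these last edges and of the integrals of the two costs per edge: \<open>(e0 / e) powr (3/2)\<close> integrates to a bounded multiple of \<open>e0\<close>, and
  \<open>1 / e\<close> to a logarithm.\<close>
theorem activity_bound:
  fixes n :: nat and q :: real
  defines "e0 \<equiv> A1 * real n powr (2 - 1 / real r) * q powr (- (1 / real r))"
  assumes n: "2 \<le> n" and q: "0 < q" "q \<le> 2" and dense: "32 * A0 * real n powr (2 - \<alpha>) \<le> q * e0"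
    and E: "E \<subseteq> nsets {..<n} 2"
  shows "activity_sum (free_sets {..<n}) q {} E \<le> exp ((1 + 4 * c1) * (q * e0) + 2 * c1 * real n powr (2 - \<alpha>) * (1 + ln (real n))\<^sup>2)"
proof -
  define \<Lambda> where "\<Lambda> = 1 + ln (real n)"
  have \<Lambda>1: "1 \<le> \<Lambda>" using n by (simp add: \<Lambda>_def)
  define K where "K = real n powr (2 - \<alpha>)"
  have K0: "0 \<le> K" by (simp add: K_def)
  note c1p = c1_nonneg and A1p = A1_bounds(4)
  have e0n: "2 * real n \<le> e0"
  proof -
    have "2 * real n \<le> A1 / 2 * real n" using A1p by (intro mult_right_mono) auto
    then show ?thesis using edge_threshold_ge[OF n q] unfolding e0_def by linarith
  qed
  have e0p: "0 < e0" using e0n n by (smt (verit) of_nat_0_less_iff less_le_trans pos2)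
  \<comment> \<open>A step removes at most half of the edges, so the iteration never leaves \<open>e \<ge> e0 / 2\<close>, where \<open>\<Phi> e \<ge> q * e0\<close>.\<close>
  define \<Phi> where "\<Phi> e = q * e0 + 2 * c1 * q * e0 * (sqrt 2 - sqrt (e0 / e)) + c1 * K * \<Lambda> * ln (2 * e / e0)" for e
  have main: "activity_sum (free_sets {..<n}) q {} E \<le> exp (\<Phi> (real (card E)))"
    if "E \<subseteq> nsets {..<n} 2" "e0 / 2 \<le> real (card E)" for E
    using that
  proof (induction "card E" arbitrary: E rule: less_induct)
    case less
    define e where "e = real (card E)"
    have finE: "finite E" using less.prems(1) by (rule finite_subset) (simp add: finite_imp_finite_nsets)
    have ep: "0 < e" using less.prems(2) e0p by (simp add: e_def)
    show ?case
    proof (cases "e0 \<le> e")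
      case False
      have "activity_sum (free_sets {..<n}) q {} E \<le> exp (q * e)"
        unfolding e_def using finE q by (intro activity_sum_le_exp) auto
      also have "\<dots> \<le> exp (\<Phi> e)"
      proof -
        have "q * e \<le> q * e0" using False q by (intro mult_left_mono) auto
        moreover have "0 \<le> sqrt 2 - sqrt (e0 / e)" using less.prems(2) ep by (simp add: e_def[symmetric] field_simps)
        then have "0 \<le> 2 * c1 * q * e0 * (sqrt 2 - sqrt (e0 / e))" using c1p q e0p by (intro mult_nonneg_nonneg) auto
        moreover have "0 \<le> ln (2 * e / e0)" using less.prems(2) e0p ep by (simp add: e_def[symmetric] field_simps)
        then have "0 \<le> c1 * K * \<Lambda> * ln (2 * e / e0)" using c1p K0 \<Lambda>1 by (intro mult_nonneg_nonneg) auto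
        ultimately have "q * e \<le> \<Phi> e"
          using \<open>0 \<le> 2 * c1 * q * e0 * (sqrt 2 - sqrt (e0 / e))\<close> unfolding \<Phi>_def by linarith
        then show ?thesis by simp
      qed
      finally show ?thesis by (simp add: e_def)
    next
      case True
      obtain Y where Y: "Y \<subseteq> E" "0 < card (E - Y)" "2 * card (E - Y) \<le> card E"
        "activity_sum (free_sets {..<n}) q {} E
          \<le> exp (c1 * (q * (e0 / e) powr (3/2) + K * \<Lambda> / e) * real (card (E - Y))) * activity_sum (free_sets {..<n}) q {} Y"
        using one_step_cost[OF n q dense[unfolded e0_def] less.prems(1)] True unfolding e_def e0_def \<Lambda>_def K_def by blast
      define j where "j = real (card (E - Y))"
      define e' where "e' = real (card Y)"
      have finY: "finite Y" using finE Y(1) finite_subset by blast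
      have cY: "card Y + card (E - Y) = card E" using Y(1) finE finY
        by (metis add.commute card_Diff_subset card_mono le_add_diff_inverse2)
      have je: "e' = e - j" using cY unfolding e'_def e_def j_def by (simp flip: of_nat_add)
      have j2: "2 * j \<le> e"
      proof -
        have "real (2 * card (E - Y)) \<le> real (card E)" using Y(3) by (rule of_nat_mono)
        then show ?thesis by (simp add: j_def e_def)
      qed
      have e'p: "0 < e'" "e' \<le> e" "e0 / 2 \<le> e'" using je j2 ep True by (auto simp: j_def)
      have IH: "activity_sum (free_sets {..<n}) q {} Y \<le> exp (\<Phi> e')"
        unfolding e'_def using cY Y(1,2) less.prems(1) e'p(3) by (intro less.hyps) (auto simp: e'_def)
      have g1: "c1 * (q * (e0 / e) powr (3/2)) * j \<le> 2 * c1 * q * e0 * (sqrt (e0 / e') - sqrt (e0 / e))"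
      proof -
        have "j / (2 * e powr (3/2)) \<le> 1 / sqrt e' - 1 / sqrt e"
          using inverse_sqrt_gap[OF e'p(1,2)] je by simp
        then have "(2 * c1 * q * e0 powr (3/2)) * (j / (2 * e powr (3/2))) \<le> (2 * c1 * q * e0 powr (3/2)) * (1 / sqrt e' - 1 / sqrt e)"
          using c1p q by (intro mult_left_mono) auto
        moreover have "(2 * c1 * q * e0 powr (3/2)) * (j / (2 * e powr (3/2))) = c1 * (q * (e0 / e) powr (3/2)) * j"
          using ep e0p by (simp add: powr_divide)
        moreover have e32: "e0 powr (3/2) = e0 * sqrt e0"
        proof -
          have "e0 powr (3/2) = e0 powr (1 + 1/2)" by simp
          also have "\<dots> = e0 * sqrt e0" unfolding powr_add using e0p by (simp add: powr_half_sqrt)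
          finally show ?thesis .
        qed
        have "(2 * c1 * q * e0 powr (3/2)) * (1 / sqrt e' - 1 / sqrt e) = 2 * c1 * q * e0 * (sqrt (e0 / e') - sqrt (e0 / e))"
          unfolding e32 by (simp add: real_sqrt_divide algebra_simps)
        ultimately show ?thesis by linarith
      qed
      have g2: "c1 * (K * \<Lambda> / e) * j \<le> c1 * K * \<Lambda> * (ln (2 * e / e0) - ln (2 * e' / e0))"
      proof -
        have "ln (e' / e) \<le> e' / e - 1" using e'p ep by (intro ln_le_minus_one) auto
        also have "e' / e - 1 = - (j / e)" unfolding je using ep by (simp add: diff_divide_distrib)
        finally have "j / e \<le> ln (2 * e / e0) - ln (2 * e' / e0)" using e'p ep e0p by (simp add: ln_div ln_mult)
        then have "c1 * K * \<Lambda> * (j / e) \<le> c1 * K * \<Lambda> * (ln (2 * e / e0) - ln (2 * e' / e0))"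
          using c1p K0 \<Lambda>1 by (intro mult_left_mono) auto
        then show ?thesis by simp
      qed
      have "c1 * (q * (e0 / e) powr (3/2) + K * \<Lambda> / e) * j = c1 * (q * (e0 / e) powr (3/2)) * j + c1 * (K * \<Lambda> / e) * j"
        by (simp only: distrib_left distrib_right)
      then have "c1 * (q * (e0 / e) powr (3/2) + K * \<Lambda> / e) * j \<le> \<Phi> e - \<Phi> e'"
        using g1 g2 unfolding \<Phi>_def by (simp only: right_diff_distrib)
      then have "exp (c1 * (q * (e0 / e) powr (3/2) + K * \<Lambda> / e) * j) * activity_sum (free_sets {..<n}) q {} Y \<le> exp (\<Phi> e - \<Phi> e') * exp (\<Phi> e')"
        using IH q by (intro mult_mono activity_sum_nonneg) auto
      then show ?thesis using Y(4) by (simp add: j_def exp_add[symmetric] e_def[symmetric])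
    qed
  qed
  have finE: "finite E" using E by (rule finite_subset) (simp add: finite_imp_finite_nsets)
  show ?thesis
  proof (cases "e0 / 2 \<le> real (card E)")
    case False
    have "activity_sum (free_sets {..<n}) q {} E \<le> exp (q * real (card E))"
      using finE q by (intro activity_sum_le_exp) auto
    also have "\<dots> \<le> exp ((1 + 4 * c1) * (q * e0) + 2 * c1 * K * \<Lambda>\<^sup>2)"
    proof -
      have "q * real (card E) \<le> q * e0" using False q e0p by (intro mult_left_mono) auto
      moreover have "0 \<le> 4 * c1 * (q * e0) + 2 * c1 * K * \<Lambda>\<^sup>2" using c1p q e0p K0 by (intro add_nonneg_nonneg mult_nonneg_nonneg) auto
      ultimately show ?thesis by (simp add: algebra_simps)
    qed
    finally show ?thesis by (simp add: K_def \<Lambda>_def)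
  next
    case True
    define e where "e = real (card E)"
    have ep: "0 < e" using True e0p by (simp add: e_def)
    have en: "2 * e / e0 \<le> real n ^ 2"
    proof -
      have "real (card E) \<le> real (n * n)" using card_pairs_le_square[OF E] by (rule of_nat_mono)
      then have "2 * e \<le> 2 * real n * real n" by (simp add: e_def)
      also have "\<dots> \<le> e0 * real n" using e0n by (intro mult_right_mono) auto
      also have "\<dots> \<le> e0 * (real n)\<^sup>2" using n e0p by (intro mult_left_mono) (auto simp: power2_eq_square)
      finally show ?thesis using e0p by (simp add: field_simps)
    qed
    have "ln (2 * e / e0) \<le> ln (real n ^ 2)" using en ep e0p by (intro ln_mono) auto
    then have l: "ln (2 * e / e0) \<le> 2 * \<Lambda>" using n by (simp add: ln_realpow \<Lambda>_def)
    have "activity_sum (free_sets {..<n}) q {} E \<le> exp (\<Phi> e)" unfolding e_def by (rule main[OF E True])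
    also have "\<dots> \<le> exp ((1 + 4 * c1) * (q * e0) + 2 * c1 * K * \<Lambda>\<^sup>2)"
    proof -
      have "sqrt 2 \<le> sqrt 4" by (intro real_sqrt_le_mono) auto
      then have "sqrt 2 \<le> 2" by simp
      then have "sqrt 2 - sqrt (e0 / e) \<le> 2" using ep e0p by (smt (verit) real_sqrt_ge_zero divide_nonneg_nonneg)
      then have "2 * c1 * q * e0 * (sqrt 2 - sqrt (e0 / e)) \<le> 2 * c1 * q * e0 * 2"
        using c1p q e0p by (intro mult_left_mono) auto
      moreover have "c1 * K * \<Lambda> * ln (2 * e / e0) \<le> c1 * K * \<Lambda> * (2 * \<Lambda>)" using l c1p K0 \<Lambda>1 by (intro mult_left_mono) auto
      ultimately have "\<Phi> e \<le> q * e0 + 2 * c1 * q * e0 * 2 + c1 * K * \<Lambda> * (2 * \<Lambda>)" unfolding \<Phi>_def by linarith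
      also have "\<dots> = (1 + 4 * c1) * (q * e0) + 2 * c1 * K * \<Lambda>\<^sup>2" by (simp add: power2_eq_square algebra_simps)
      finally show ?thesis by simp
    qed
    finally show ?thesis by (simp add: K_def \<Lambda>_def)
  qed
qed

end

section \<open>Random subsets and moment bounds\<close>

definition rset :: "'x set \<Rightarrow> real \<Rightarrow> 'x set pmf" where
  "rset X p = map_pmf (\<lambda>f. {x \<in> X. f x}) (Pi_pmf X False (\<lambda>_. bernoulli_pmf p))"

lemma gnp_rset: "gnp n p = map_pmf (\<lambda>R. ({..<n}, R)) (rset (nsets {..<n} 2) p)"
  by (simp add: gnp_def rset_def pmf.map_comp o_def)

lemma prob_gnp: "measure_pmf.prob (gnp n p) {G. A G} = measure_pmf.prob (rset (nsets {..<n} 2) p) {R. A ({..<n}, R)}"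
  by (simp add: gnp_rset vimage_def)

lemma set_rset: "set_pmf (rset X p) \<subseteq> Pow X"
  by (auto simp: rset_def)

lemma finite_rset: "finite X \<Longrightarrow> finite (set_pmf (rset X p))"
  by (rule finite_subset[OF set_rset]) simp

lemma rset_mono_event:
  assumes "\<And>R. R \<subseteq> X \<Longrightarrow> A R \<Longrightarrow> B R"
  shows "measure_pmf.prob (rset X p) {R. A R} \<le> measure_pmf.prob (rset X p) {R. B R}"
proof -
  have "measure_pmf.prob (rset X p) {R. A R} = measure_pmf.prob (rset X p) ({R. A R} \<inter> set_pmf (rset X p))"
    by (simp add: measure_Int_set_pmf)
  also have "\<dots> \<le> measure_pmf.prob (rset X p) {R. B R}"
    using assms set_rset[of X p] by (intro measure_pmf.finite_measure_mono) auto
  finally show ?thesis .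
qed

lemma prob_cylinder:
  assumes "finite X" "A \<subseteq> X" "B \<subseteq> X" "A \<inter> B = {}" "0 \<le> p" "p \<le> 1"
  shows "measure_pmf.prob (rset X p) {R. A \<subseteq> R \<and> R \<inter> B = {}} = p ^ card A * (1 - p) ^ card B"
proof -
  define Y where "Y x = (if x \<in> A then {True} else if x \<in> B then {False} else UNIV)" for x
  have ev: "(\<lambda>f. {x \<in> X. f x}) -` {R. A \<subseteq> R \<and> R \<inter> B = {}} = Pi X Y"
    using assms(2-4) by (auto simp: Pi_def Y_def split: if_splits)
  have "measure_pmf.prob (rset X p) {R. A \<subseteq> R \<and> R \<inter> B = {}} = measure_pmf.prob (Pi_pmf X False (\<lambda>_. bernoulli_pmf p)) (Pi X Y)"
    unfolding rset_def measure_map_pmf ev ..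
  also have "\<dots> = (\<Prod>x\<in>X. measure_pmf.prob (bernoulli_pmf p) (Y x))"
    using assms(1) by (rule measure_Pi_pmf_Pi)
  also have "\<dots> = (\<Prod>x\<in>X. (if x \<in> A then p else 1) * (if x \<in> B then 1 - p else 1))"
    using assms(4-6) by (intro prod.cong refl) (auto simp: Y_def measure_pmf_single)
  also have "\<dots> = (\<Prod>x\<in>A. p) * (\<Prod>x\<in>B. 1 - p)"
    unfolding prod.distrib using assms(1-3)
    by (intro arg_cong2[where f="(*)"] prod.mono_neutral_cong_right) auto
  finally show ?thesis by simp
qed

lemma prob_contains:
  assumes "finite X" "A \<subseteq> X" "0 \<le> p" "p \<le> 1"
  shows "measure_pmf.prob (rset X p) {R. A \<subseteq> R} = p ^ card A"
  using prob_cylinder[of X A "{}" p] assms by simp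

lemma rset_insert:
  assumes "finite X" "x \<notin> X" "0 \<le> p" "p \<le> 1"
  shows "measure_pmf.prob (rset (insert x X) p) {R. Q R}
     = p * measure_pmf.prob (rset X p) {R. Q (insert x R)} + (1 - p) * measure_pmf.prob (rset X p) {R. Q R}"
proof -
  define g where "g b = map_pmf (\<lambda>R. if b then insert x R else R) (rset X p)" for b
  have upd: "{z \<in> insert x X. (f(x := b)) z} = (if b then insert x {z \<in> X. f z} else {z \<in> X. f z})" for f :: "'a \<Rightarrow> bool" and b
    using assms(2) by auto
  have "rset (insert x X) p = bernoulli_pmf p \<bind> g"
    unfolding rset_def Pi_pmf_insert'[OF assms(1,2)] g_def map_bind_pmf map_return_pmf upd
    by (simp add: map_pmf_def bind_assoc_pmf bind_return_pmf)
  then have "measure_pmf.prob (rset (insert x X) p) {R. Q R} = measure_pmf.expectation (bernoulli_pmf p \<bind> g) (indicator {R. Q R})"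
    by simp
  also have "\<dots> = (\<Sum>b\<in>UNIV. pmf (bernoulli_pmf p) b *\<^sub>R measure_pmf.expectation (g b) (indicator {R. Q R}))"
    using finite_rset[OF assms(1)] by (intro pmf_expectation_bind) (auto simp: g_def)
  also have "\<dots> = p * measure_pmf.prob (g True) {R. Q R} + (1 - p) * measure_pmf.prob (g False) {R. Q R}"
    using assms by (simp add: UNIV_bool)
  also have "measure_pmf.prob (g True) {R. Q R} = measure_pmf.prob (rset X p) {R. Q (insert x R)}"
    by (simp add: g_def vimage_def)
  also have "measure_pmf.prob (g False) {R. Q R} = measure_pmf.prob (rset X p) {R. Q R}"
    by (simp add: g_def)
  finally show ?thesis .
qed

text \<open>Condition on one element at a time. The event is at least as likely given that the element is present, so raising the
  probability of its presence helps.\<close>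
lemma increasing_event_mono:
  assumes "finite X" and up: "\<And>R R'. R \<subseteq> R' \<Longrightarrow> Q R \<Longrightarrow> Q R'" and p: "0 \<le> p" "p \<le> p'" "p' \<le> 1"
  shows "measure_pmf.prob (rset X p) {R. Q R} \<le> measure_pmf.prob (rset X p') {R. Q R}"
  using assms(1) up
proof (induction X arbitrary: Q rule: finite_induct)
  case empty
  then show ?case by (simp add: rset_def)
next
  case (insert x X)
  define a a' b b' where "a = measure_pmf.prob (rset X p) {R. Q (insert x R)}" and "a' = measure_pmf.prob (rset X p') {R. Q (insert x R)}"
    and "b = measure_pmf.prob (rset X p) {R. Q R}" and "b' = measure_pmf.prob (rset X p') {R. Q R}"
  have up': "Q (insert x R')" if "R \<subseteq> R'" "Q (insert x R)" for R R'
    using insert.prems[of "insert x R" "insert x R'"] that by auto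
  have aa: "a \<le> a'" unfolding a_def a'_def by (rule insert.IH) (erule up', assumption)
  have bb: "b \<le> b'" unfolding b_def b'_def by (rule insert.IH) (erule insert.prems, assumption)
  have ba: "b \<le> a"
    unfolding a_def b_def
  proof (rule rset_mono_event)
    show "Q (insert x R)" if "Q R" for R by (rule insert.prems[OF _ that]) auto
  qed
  have "p * a + (1 - p) * b = b + p * (a - b)" by (simp add: algebra_simps)
  also have "\<dots> \<le> b + p' * (a - b)" using ba p by (intro add_left_mono mult_right_mono) auto
  also have "\<dots> = p' * a + (1 - p') * b" by (simp add: algebra_simps)
  also have "\<dots> \<le> p' * a' + (1 - p') * b'" using aa bb p by (intro add_mono mult_left_mono) auto
  finally show ?case using insert.hyps p unfolding a_def a'_def b_def b'_def
    by (simp add: rset_insert)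
qed

text \<open>Union bound over all members with at least \<open>m\<close> elements; for these the factor \<open>2 ^ card A / 2 ^ m\<close> is at least 1, which lets the
  sum be extended to the whole family at activity \<open>2 * q\<close>.\<close>
lemma prob_large_free_subset:
  assumes X: "finite X" and p: "0 \<le> p" "p \<le> q" "p \<le> 1"
  shows "measure_pmf.prob (rset X p) {R. \<exists>A\<in>\<I>. A \<subseteq> R \<and> m \<le> card A} \<le> activity_sum \<I> (2 * q) {} X / 2 ^ m"
proof -
  define \<A> where "\<A> = {A. A \<in> \<I> \<and> A \<subseteq> X \<and> m \<le> card A}"
  have fin: "finite \<A>" unfolding \<A>_def by (rule finite_subset[of _ "Pow X"]) (use X in auto)
  have "measure_pmf.prob (rset X p) {R. \<exists>A\<in>\<I>. A \<subseteq> R \<and> m \<le> card A} \<le> measure_pmf.prob (rset X p) {R. R \<in> (\<Union>A\<in>\<A>. {R. A \<subseteq> R})}"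
    by (rule rset_mono_event) (auto simp: \<A>_def)
  also have "\<dots> \<le> (\<Sum>A\<in>\<A>. measure_pmf.prob (rset X p) {R. A \<subseteq> R})"
    using fin by (simp only: Collect_mem_eq) (intro measure_pmf.finite_measure_subadditive_finite, auto)
  also have "\<dots> = (\<Sum>A\<in>\<A>. p ^ card A)"
    using X p by (intro sum.cong refl prob_contains) (auto simp: \<A>_def)
  also have "\<dots> \<le> (\<Sum>A\<in>\<A>. (2 * q) ^ card A / 2 ^ m)"
  proof (intro sum_mono)
    fix A assume "A \<in> \<A>"
    then have "(2::real) ^ m \<le> 2 ^ card A" by (intro power_increasing) (auto simp: \<A>_def)
    then have "p ^ card A * 2 ^ m \<le> q ^ card A * 2 ^ card A" using p by (intro mult_mono power_mono) auto
    then show "p ^ card A \<le> (2 * q) ^ card A / 2 ^ m" by (simp add: field_simps power_mult_distrib)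
  qed
  also have "\<dots> = (\<Sum>A\<in>\<A>. (2 * q) ^ card A) / 2 ^ m" by (simp add: sum_divide_distrib)
  also have "\<dots> \<le> activity_sum \<I> (2 * q) {} X / 2 ^ m"
    unfolding activity_sum_def using X p by (intro divide_right_mono sum_mono2 finite_activity) (auto simp: \<A>_def)
  finally show ?thesis .
qed

text \<open>Chebyshev's inequality for a number of events. The hypothesis on pairs says that the variance is at most \<open>v\<close>.\<close>
lemma second_moment:
  fixes M :: "'w pmf" and Ev :: "'i \<Rightarrow> 'w set"
  assumes I: "finite I" and a: "0 < a"
    and v: "(\<Sum>i\<in>I. \<Sum>j\<in>I. measure_pmf.prob M (Ev i \<inter> Ev j)) \<le> \<mu>\<^sup>2 + v"
    and \<mu>: "\<mu> = (\<Sum>i\<in>I. measure_pmf.prob M (Ev i))"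
  shows "measure_pmf.prob M {\<omega>. a \<le> \<bar>real (card {i\<in>I. \<omega> \<in> Ev i}) - \<mu>\<bar>} \<le> v / a\<^sup>2"
proof -
  define f where "f \<omega> = real (card {i\<in>I. \<omega> \<in> Ev i})" for \<omega>
  have f: "f = (\<lambda>\<omega>. \<Sum>i\<in>I. indicator (Ev i) \<omega>)"
    using I by (auto simp: f_def indicator_def sum.If_cases Int_def)
  have int: "integrable (measure_pmf M) (indicator (Ev i) :: 'w \<Rightarrow> real)" for i
    by (rule measure_pmf.integrable_const_bound[where B=1]) auto
  have int2: "integrable (measure_pmf M) (indicator (Ev i \<inter> Ev j) :: 'w \<Rightarrow> real)" for i j
    by (rule measure_pmf.integrable_const_bound[where B=1]) auto
  have Ef: "measure_pmf.expectation M f = \<mu>"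
    unfolding f \<mu> using int by (subst Bochner_Integration.integral_sum) auto
  have f2: "(\<lambda>\<omega>. (f \<omega>)\<^sup>2) = (\<lambda>\<omega>. \<Sum>i\<in>I. \<Sum>j\<in>I. indicator (Ev i \<inter> Ev j) \<omega>)"
    unfolding f power2_eq_square sum_product by (simp add: indicator_inter_arith)
  have intf2: "integrable (measure_pmf M) (\<lambda>\<omega>. (f \<omega>)\<^sup>2)"
    unfolding f2 by (intro Bochner_Integration.integrable_sum int2)
  have intf: "integrable (measure_pmf M) f" unfolding f by (intro Bochner_Integration.integrable_sum int)
  have "measure_pmf.expectation M (\<lambda>\<omega>. (f \<omega>)\<^sup>2) = (\<Sum>i\<in>I. \<Sum>j\<in>I. measure_pmf.prob M (Ev i \<inter> Ev j))"
    unfolding f2 using int2 by (subst Bochner_Integration.integral_sum) (auto simp: Bochner_Integration.integrable_sum)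
  then have Ef2: "measure_pmf.expectation M (\<lambda>\<omega>. (f \<omega>)\<^sup>2) \<le> \<mu>\<^sup>2 + v" using v by simp
  have "measure_pmf.variance M f = measure_pmf.expectation M (\<lambda>\<omega>. (f \<omega>)\<^sup>2) - \<mu>\<^sup>2"
    using measure_pmf.variance_eq[OF intf intf2] Ef by simp
  then have var: "measure_pmf.variance M f \<le> v" using Ef2 by simp
  have "measure_pmf.prob M {\<omega>\<in>space (measure_pmf M). a \<le> \<bar>f \<omega> - measure_pmf.expectation M f\<bar>} \<le> measure_pmf.variance M f / a\<^sup>2"
    using a intf2 by (intro measure_pmf.Chebyshev_inequality) auto
  also have "\<dots> \<le> v / a\<^sup>2" using var by (intro divide_right_mono) auto
  finally show ?thesis by (simp add: Ef f_def)
qed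

lemma first_moment:
  fixes M :: "'w pmf" and Ev :: "'i \<Rightarrow> 'w set"
  assumes I: "finite I" and a: "0 < a" and \<mu>: "(\<Sum>i\<in>I. measure_pmf.prob M (Ev i)) \<le> \<mu>"
  shows "measure_pmf.prob M {\<omega>. a \<le> real (card {i\<in>I. \<omega> \<in> Ev i})} \<le> \<mu> / a"
proof -
  define f where "f \<omega> = real (card {i\<in>I. \<omega> \<in> Ev i})" for \<omega>
  have f: "f = (\<lambda>\<omega>. \<Sum>i\<in>I. indicator (Ev i) \<omega>)"
    using I by (auto simp: f_def indicator_def sum.If_cases Int_def)
  have int: "integrable (measure_pmf M) (indicator (Ev i) :: 'w \<Rightarrow> real)" for i
    by (rule measure_pmf.integrable_const_bound[where B=1]) auto
  have intf: "integrable (measure_pmf M) f" unfolding f by (intro Bochner_Integration.integrable_sum int)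
  have Ef: "measure_pmf.expectation M f = (\<Sum>i\<in>I. measure_pmf.prob M (Ev i))"
    unfolding f using int by (subst Bochner_Integration.integral_sum) auto
  have f0: "0 \<le> f \<omega>" for \<omega> by (simp add: f_def)
  have "measure_pmf.prob M {\<omega>\<in>space (measure_pmf M). a \<le> f \<omega>} \<le> measure_pmf.expectation M f / a"
    using a intf f0 by (intro integral_Markov_inequality_measure[where A="{}"]) auto
  also have "\<dots> \<le> \<mu> / a" using \<mu> a by (simp add: Ef divide_right_mono)
  finally show ?thesis by (simp add: f_def)
qed

section \<open>Deleting one edge from each copy\<close>

definition embeds :: "'a ugraph \<Rightarrow> 'b set \<Rightarrow> 'b set set \<Rightarrow> bool" where
  "embeds F U A \<longleftrightarrow> (\<exists>\<phi>. inj_on \<phi> (verts F) \<and> \<phi> ` verts F \<subseteq> U \<and> (\<forall>e\<in>edges F. \<phi> ` e \<in> A))"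

lemma simple_edge: "simple_graph G \<Longrightarrow> e \<in> edges G \<Longrightarrow> e \<subseteq> verts G \<and> card e = 2"
  by (auto simp: simple_graph_def nsets_def)

text \<open>A subgraph isomorphic to \<open>F\<close> is the image of \<open>F\<close> under an embedding, with exactly the image edges kept.\<close>
lemma contains_copy_iff:
  fixes F :: "'a ugraph" and G :: "'b ugraph"
  assumes F: "simple_graph F" and G: "simple_graph G"
  shows "contains_copy G F \<longleftrightarrow> embeds F (verts G) (edges G)"
proof
  assume "contains_copy G F"
  then obtain H f where H: "subgraph H G" "bij_betw f (verts H) (verts F)" "edges F = (\<lambda>e. f ` e) ` edges H"
    unfolding contains_copy_def graph_iso_def by blast
  define \<phi> where "\<phi> = inv_into (verts H) f"
  have b: "bij_betw \<phi> (verts F) (verts H)" unfolding \<phi>_def using H(2) by (rule bij_betw_inv_into)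
  have "\<phi> ` e \<in> edges G" if eF: "e \<in> edges F" for e
  proof -
    obtain e' where e': "e' \<in> edges H" "e = f ` e'" using H(3) eF by auto
    have "e' \<subseteq> verts H" using simple_edge[of H e'] H(1) e'(1) by (simp add: subgraph_def)
    then have "\<phi> ` e = e'" unfolding e'(2) \<phi>_def using H(2) by (simp add: bij_betw_def inv_into_image_cancel)
    then show ?thesis using e'(1) H(1) by (auto simp: subgraph_def)
  qed
  then show "embeds F (verts G) (edges G)" unfolding embeds_def using b H(1)
    by (intro exI[of _ \<phi>]) (auto simp: bij_betw_def subgraph_def)
next
  assume "embeds F (verts G) (edges G)"
  then obtain \<phi> where \<phi>: "inj_on \<phi> (verts F)" "\<phi> ` verts F \<subseteq> verts G" "\<And>e. e \<in> edges F \<Longrightarrow> \<phi> ` e \<in> edges G"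
    unfolding embeds_def by blast
  define H where "H = (\<phi> ` verts F, (\<lambda>e. \<phi> ` e) ` edges F)"
  have sub: "subgraph H G"
  proof -
    have "\<phi> ` e \<in> nsets (\<phi> ` verts F) 2" if "e \<in> edges F" for e
      using simple_edge[OF F that] \<phi>(1) finite_subset[of e "verts F"] F
      by (auto simp: nsets_def simple_graph_def card_image inj_on_subset)
    then show ?thesis using F \<phi> by (auto simp: subgraph_def H_def simple_graph_def)
  qed
  define f where "f = inv_into (verts F) \<phi>"
  have "bij_betw f (verts H) (verts F)" unfolding f_def H_def using \<phi>(1)
    by (simp add: bij_betw_inv_into inj_on_imp_bij_betw)
  moreover have "edges F = (\<lambda>e. f ` e) ` edges H"
  proof -
    have "f ` \<phi> ` e = e" if "e \<in> edges F" for e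
      unfolding f_def using simple_edge[OF F that] \<phi>(1) by (simp add: inv_into_image_cancel)
    then have "(\<lambda>e. f ` e) ` edges H = (\<lambda>e. e) ` edges F" unfolding H_def snd_conv image_image
      by (intro image_cong) auto
    then show ?thesis by simp
  qed
  ultimately show "contains_copy G F" using sub unfolding contains_copy_def graph_iso_def by blast
qed

lemma simple_subset_graph: "R \<subseteq> nsets {..<n} 2 \<Longrightarrow> simple_graph ({..<n::nat}, R)"
  by (simp add: simple_graph_def)

lemma finite_ex_set:
  assumes "R \<subseteq> nsets {..<n::nat} 2"
  shows "finite {e_num H | H. subgraph H ({..<n}, R) \<and> \<not> contains_copy H F}"
proof (rule finite_subset)
  have "finite R" using assms by (rule finite_subset) (simp add: finite_imp_finite_nsets)
  then show "{e_num H | H. subgraph H ({..<n}, R) \<and> \<not> contains_copy H F} \<subseteq> {..card R}"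
    by (auto simp: subgraph_def intro: card_mono)
qed simp

lemma ex_in_lower:
  assumes F: "simple_graph F" and R: "R \<subseteq> nsets {..<n::nat} 2" and A: "A \<subseteq> R" "\<not> embeds F {..<n} A"
  shows "card A \<le> ex_in ({..<n}, R) F"
  unfolding ex_in_def
proof (rule Max_ge[OF finite_ex_set[OF R]])
  have "simple_graph ({..<n}, A)" using A R by (intro simple_subset_graph) auto
  moreover then have "\<not> contains_copy ({..<n}, A) F" using A F by (simp add: contains_copy_iff)
  ultimately have "subgraph ({..<n}, A) ({..<n}, R) \<and> \<not> contains_copy ({..<n}, A) F" using A by (simp add: subgraph_def)
  then show "card A \<in> {e_num H | H. subgraph H ({..<n}, R) \<and> \<not> contains_copy H F}"
    by (intro CollectI exI[of _ "({..<n}, A)"]) simp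
qed

text \<open>An isolated vertex of \<open>F\<close> would make containment depend on the vertex set of the subgraph. Without such vertices, a maximal
  subgraph can be taken to be spanning.\<close>
lemma ex_in_attained:
  fixes F :: "'a ugraph"
  assumes F: "simple_graph F" "edges F \<noteq> {}" "\<And>v. v \<in> verts F \<Longrightarrow> \<exists>e\<in>edges F. v \<in> e"
    and R: "R \<subseteq> nsets {..<n::nat} 2"
  shows "\<exists>A\<subseteq>R. \<not> embeds F {..<n} A \<and> card A = ex_in ({..<n}, R) F"
proof -
  have "({..<n}, {}) \<in> {H. subgraph H ({..<n}, R) \<and> \<not> contains_copy H F}"
    using F by (simp add: subgraph_def simple_graph_def contains_copy_iff[OF F(1)] embeds_def ex_in_conv[symmetric])
  then have "{e_num H | H. subgraph H ({..<n}, R) \<and> \<not> contains_copy H F} \<noteq> {}" by auto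
  then have "ex_in ({..<n}, R) F \<in> {e_num H | H. subgraph H ({..<n}, R) \<and> \<not> contains_copy H F}"
    unfolding ex_in_def by (intro Max_in finite_ex_set R)
  then obtain H where H: "subgraph H ({..<n}, R)" "\<not> contains_copy H F" "ex_in ({..<n}, R) F = e_num H" by auto
  have sH: "simple_graph H" using H(1) by (simp add: subgraph_def)
  have "\<not> embeds F {..<n} (edges H)"
  proof
    assume "embeds F {..<n} (edges H)"
    then obtain \<phi> where \<phi>: "inj_on \<phi> (verts F)" "\<And>e. e \<in> edges F \<Longrightarrow> \<phi> ` e \<in> edges H" unfolding embeds_def by blast
    have "\<phi> v \<in> verts H" if v: "v \<in> verts F" for v
    proof -
      obtain e where "e \<in> edges F" "v \<in> e" using F(3)[OF v] by auto
      then show ?thesis using simple_edge[OF sH \<phi>(2), of e] by auto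
    qed
    then have "embeds F (verts H) (edges H)" unfolding embeds_def using \<phi> by (intro exI[of _ \<phi>]) auto
    then show False using H(2) by (simp add: contains_copy_iff[OF F(1) sH])
  qed
  then show ?thesis using H by (intro exI[of _ "edges H"]) (auto simp: subgraph_def)
qed

lemma ex_in_le_card:
  fixes F :: "'a ugraph"
  assumes "simple_graph F" "edges F \<noteq> {}" "\<And>v. v \<in> verts F \<Longrightarrow> \<exists>e\<in>edges F. v \<in> e" and R: "R \<subseteq> nsets {..<n::nat} 2"
  shows "ex_in ({..<n}, R) F \<le> card R"
proof -
  obtain A where A: "A \<subseteq> R" "card A = ex_in ({..<n}, R) F" using ex_in_attained[OF assms(1,2) _ R] assms(3) by metis
  have "finite R" using R by (rule finite_subset) (simp add: finite_imp_finite_nsets)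
  then show ?thesis using A card_mono by metis
qed

definition placements :: "'a ugraph \<Rightarrow> nat \<Rightarrow> ('a \<Rightarrow> nat) set" where
  "placements F n = {\<phi> \<in> PiE (verts F) (\<lambda>_. {..<n}). inj_on \<phi> (verts F)}"

lemma finite_placements: "simple_graph F \<Longrightarrow> finite (placements F n)"
  unfolding placements_def simple_graph_def by (intro finite_Collect_conjI disjI1) (auto intro!: finite_PiE)

lemma card_placements:
  assumes "simple_graph F"
  shows "card (placements F n) \<le> n ^ v_num F"
proof -
  have "finite (verts F)" using assms by (simp add: simple_graph_def)
  then have "card (placements F n) \<le> card (PiE (verts F) (\<lambda>_. {..<n}))"
    by (intro card_mono finite_PiE) (auto simp: placements_def)
  then show ?thesis using \<open>finite (verts F)\<close> by (simp add: card_PiE)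
qed

text \<open>Deleting from \<open>R\<close> the image of one fixed edge of \<open>F\<close> under every placement destroys all copies.\<close>
lemma deletion_bound:
  fixes F :: "'a ugraph"
  assumes F: "simple_graph F" "edges F \<noteq> {}" and R: "R \<subseteq> nsets {..<n::nat} 2"
  shows "card R \<le> ex_in ({..<n}, R) F + card {\<phi> \<in> placements F n. image \<phi> ` edges F \<subseteq> R}"
proof -
  obtain e0 where e0: "e0 \<in> edges F" using F by auto
  define X where "X = {\<phi> \<in> placements F n. image \<phi> ` edges F \<subseteq> R}"
  define A where "A = R - (\<lambda>\<phi>. \<phi> ` e0) ` X"
  have finX: "finite X" using finite_placements[OF F(1)] by (simp add: X_def)
  have finR: "finite R" using R by (rule finite_subset) (simp add: finite_imp_finite_nsets)
  have "\<not> embeds F {..<n} A"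
  proof
    assume "embeds F {..<n} A"
    then obtain \<phi> where \<phi>: "inj_on \<phi> (verts F)" "\<phi> ` verts F \<subseteq> {..<n}" "\<And>e. e \<in> edges F \<Longrightarrow> \<phi> ` e \<in> A"
      unfolding embeds_def by blast
    define \<psi> where "\<psi> = restrict \<phi> (verts F)"
    have im: "\<psi> ` e = \<phi> ` e" if "e \<in> edges F" for e
      using simple_edge[OF F(1) that] by (auto simp: \<psi>_def intro!: image_cong)
    have "inj_on \<psi> (verts F)" using \<phi>(1) by (simp add: \<psi>_def inj_on_def)
    then have "\<psi> \<in> X" using \<phi> im by (auto simp: X_def placements_def \<psi>_def[symmetric] A_def) (auto simp: \<psi>_def)
    then have "\<phi> ` e0 \<in> (\<lambda>\<phi>. \<phi> ` e0) ` X" using im[OF e0] by (metis imageI)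
    then show False using \<phi>(3)[OF e0] by (simp add: A_def)
  qed
  then have "card A \<le> ex_in ({..<n}, R) F" by (intro ex_in_lower F R) (auto simp: A_def)
  moreover have "card R \<le> card A + card X"
  proof -
    have "card R - card ((\<lambda>\<phi>. \<phi> ` e0) ` X) \<le> card A" unfolding A_def using finX by (intro diff_card_le_card_Diff) auto
    then show ?thesis using card_image_le[OF finX, of "\<lambda>\<phi>. \<phi> ` e0"] by linarith
  qed
  ultimately show ?thesis by (simp add: X_def)
qed

lemma edge_count_deviation:
  assumes p: "0 \<le> p" "p \<le> 1" and a: "0 < a"
  shows "measure_pmf.prob (rset (nsets {..<n::nat} 2) p) {R. a \<le> \<bar>real (card R) - p * real (n choose 2)\<bar>} \<le> p * real (n choose 2) / a\<^sup>2"
proof -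
  define X where "X = nsets {..<n} 2"
  have finX: "finite X" by (simp add: X_def finite_imp_finite_nsets)
  have cX: "card X = n choose 2" by (simp add: X_def card_nsets)
  have P: "measure_pmf.prob (rset X p) {R. e \<in> R} = p" if "e \<in> X" for e
    using prob_contains[of X "{e}" p] finX p that by simp
  have P2: "measure_pmf.prob (rset X p) ({R. e \<in> R} \<inter> {R. e' \<in> R}) \<le> p * p + (if e = e' then p else 0)"
    if "e \<in> X" "e' \<in> X" for e e'
  proof (cases "e = e'")
    case True
    then show ?thesis using P[OF that(1)] p by simp
  next
    case False
    have "{R. e \<in> R} \<inter> {R. e' \<in> R} = {R. {e, e'} \<subseteq> R}" by auto
    then show ?thesis using prob_contains[of X "{e, e'}" p] finX p that False by (simp add: power2_eq_square)
  qed
  have "measure_pmf.prob (rset X p) {R. a \<le> \<bar>real (card {e\<in>X. R \<in> {R. e \<in> R}}) - p * real (card X)\<bar>} \<le> p * real (card X) / a\<^sup>2"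
  proof (rule second_moment[OF finX a])
    have "(\<Sum>e\<in>X. \<Sum>e'\<in>X. measure_pmf.prob (rset X p) ({R. e \<in> R} \<inter> {R. e' \<in> R})) \<le> (\<Sum>e\<in>X. \<Sum>e'\<in>X. p * p + (if e = e' then p else 0))"
      by (intro sum_mono P2)
    also have "\<dots> = (p * real (card X))\<^sup>2 + p * real (card X)"
      using finX by (simp add: sum.distrib power2_eq_square algebra_simps)
    finally show "(\<Sum>e\<in>X. \<Sum>e'\<in>X. measure_pmf.prob (rset X p) ({R. e \<in> R} \<inter> {R. e' \<in> R})) \<le> (p * real (card X))\<^sup>2 + p * real (card X)" .
    show "p * real (card X) = (\<Sum>e\<in>X. measure_pmf.prob (rset X p) {R. e \<in> R})" using P by simp
  qed
  moreover have "measure_pmf.prob (rset X p) {R. a \<le> \<bar>real (card R) - p * real (card X)\<bar>}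
     \<le> measure_pmf.prob (rset X p) {R. a \<le> \<bar>real (card {e\<in>X. R \<in> {R. e \<in> R}}) - p * real (card X)\<bar>}"
  proof (rule rset_mono_event)
    fix R assume R: "R \<subseteq> X" and a: "a \<le> \<bar>real (card R) - p * real (card X)\<bar>"
    have "{e\<in>X. R \<in> {R. e \<in> R}} = R" using R by auto
    then show "a \<le> \<bar>real (card {e\<in>X. R \<in> {R. e \<in> R}}) - p * real (card X)\<bar>" using a by simp
  qed
  ultimately show ?thesis unfolding cX[symmetric] by (simp only: X_def[symmetric])
qed

lemma copy_count:
  fixes F :: "'a ugraph"
  assumes F: "simple_graph F" and p: "0 \<le> p" "p \<le> 1" and b: "0 < b"
  shows "measure_pmf.prob (rset (nsets {..<n::nat} 2) p) {R. b \<le> real (card {\<phi> \<in> placements F n. image \<phi> ` edges F \<subseteq> R})}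
     \<le> real n ^ v_num F * p ^ e_num F / b"
proof -
  define X where "X = nsets {..<n} 2"
  have finX: "finite X" by (simp add: X_def finite_imp_finite_nsets)
  have P: "measure_pmf.prob (rset X p) {R. image \<phi> ` edges F \<subseteq> R} = p ^ e_num F" if \<phi>: "\<phi> \<in> placements F n" for \<phi>
  proof -
    have inj: "inj_on \<phi> (verts F)" "\<phi> ` verts F \<subseteq> {..<n}" using \<phi> by (auto simp: placements_def)
    have "\<phi> ` e \<in> X" if "e \<in> edges F" for e
      using simple_edge[OF F that] inj finite_subset[of e "verts F"] F
      by (auto simp: X_def nsets_def simple_graph_def card_image inj_on_subset)
    then have sub: "image \<phi> ` edges F \<subseteq> X" by auto
    have "inj_on (image \<phi>) (edges F)"
      by (rule inj_on_subset[OF inj_on_image_Pow[OF inj(1)]]) (use simple_edge[OF F] in blast)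
    then have "card (image \<phi> ` edges F) = e_num F" by (rule card_image)
    then show ?thesis using prob_contains[OF finX sub p] by simp
  qed
  have "measure_pmf.prob (rset X p) {R. b \<le> real (card {\<phi> \<in> placements F n. R \<in> {R. image \<phi> ` edges F \<subseteq> R}})} \<le> real n ^ v_num F * p ^ e_num F / b"
  proof (rule first_moment[OF finite_placements[OF F] b])
    have "real (card (placements F n)) \<le> real (n ^ v_num F)" by (intro of_nat_mono card_placements F)
    then show "(\<Sum>\<phi>\<in>placements F n. measure_pmf.prob (rset X p) {R. image \<phi> ` edges F \<subseteq> R}) \<le> real n ^ v_num F * p ^ e_num F"
      using P p by (simp add: mult_right_mono)
  qed
  then show ?thesis by (simp add: X_def)
qed

text \<open>\<open>ex_in\<close> differs from the number of edges by at most the number of copies. So the number of edges deviates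
  by \<open>a\<close> or there are at least \<open>b\<close> copies, and these events are bounded by the second and the first moment.\<close>
lemma sparse_deviation:
  fixes F :: "'a ugraph"
  assumes F: "simple_graph F" "edges F \<noteq> {}" "\<And>v. v \<in> verts F \<Longrightarrow> \<exists>e\<in>edges F. v \<in> e"
    and p: "0 \<le> p" "p \<le> 1" and a: "0 < a" and b: "0 < b"
  shows "measure_pmf.prob (gnp n p) {G. a + b \<le> \<bar>real (ex_in G F) - p * real (n choose 2)\<bar>}
     \<le> p * real (n choose 2) / a\<^sup>2 + real n ^ v_num F * p ^ e_num F / b"
proof -
  define X where "X = nsets {..<n} 2"
  define E1 where "E1 = {R :: nat set set. a \<le> \<bar>real (card R) - p * real (n choose 2)\<bar>}"
  define E2 where "E2 = {R. b \<le> real (card {\<phi> \<in> placements F n. image \<phi> ` edges F \<subseteq> R})}"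
  have "measure_pmf.prob (rset X p) {R. a + b \<le> \<bar>real (ex_in ({..<n}, R) F) - p * real (n choose 2)\<bar>}
      \<le> measure_pmf.prob (rset X p) {R. R \<in> E1 \<union> E2}"
  proof (rule rset_mono_event)
    fix R assume R: "R \<subseteq> X" and d: "a + b \<le> \<bar>real (ex_in ({..<n}, R) F) - p * real (n choose 2)\<bar>"
    define c where "c = card {\<phi> \<in> placements F n. image \<phi> ` edges F \<subseteq> R}"
    have "ex_in ({..<n}, R) F \<le> card R" using ex_in_le_card[OF F] R by (simp add: X_def)
    moreover have "card R \<le> ex_in ({..<n}, R) F + c" unfolding c_def using deletion_bound[OF F(1,2)] R by (simp add: X_def)
    ultimately have "real (ex_in ({..<n}, R) F) \<le> real (card R)" "real (card R) \<le> real (ex_in ({..<n}, R) F) + real c" by simp_all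
    then have le: "real c < b \<Longrightarrow> a \<le> \<bar>real (card R) - p * real (n choose 2)\<bar>" using d by linarith
    show "R \<in> E1 \<union> E2"
    proof (cases "real c < b")
      case True
      then show ?thesis using le by (simp add: E1_def)
    next
      case False
      then show ?thesis by (simp add: E2_def c_def)
    qed
  qed
  also have "\<dots> \<le> measure_pmf.prob (rset X p) E1 + measure_pmf.prob (rset X p) E2"
    by (simp only: Collect_mem_eq) (rule measure_Un_le, auto)
  also have "\<dots> \<le> p * real (n choose 2) / a\<^sup>2 + real n ^ v_num F * p ^ e_num F / b"
    unfolding E1_def E2_def X_def by (intro add_mono edge_count_deviation copy_count F p a b)
  finally show ?thesis unfolding prob_gnp X_def .
qed

section \<open>Blowing up an extremal graph\<close>

lemma simple_complete_bipartite: "simple_graph (complete_bipartite r t)"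
  by (auto simp: simple_graph_def complete_bipartite_def nsets_def)

text \<open>
  The vertices \<open>{..<m * s}\<close> are divided into \<open>m\<close> consecutive classes of size \<open>s\<close>, and each edge of the graph \<open>J\<close> on the classes is
  replaced by all pairs between the two classes. Two such pairs are rivals if they lie between the same classes and
  share a vertex; an edge of a random graph is isolated if none of its rivals is present.
\<close>
context
  fixes s m n :: nat and J :: "nat set set"
  assumes s: "0 < s" and ms: "m * s \<le> n" and J: "J \<subseteq> nsets {..<m} 2"
begin

definition cls :: "nat \<Rightarrow> nat" where "cls v = v div s"
definition blown :: "nat set set" where "blown = {e \<in> nsets {..<n} 2. cls ` e \<in> J}"
definition rivals :: "nat set \<Rightarrow> nat set set" where
  "rivals e = {e' \<in> blown. e' \<noteq> e \<and> e' \<inter> e \<noteq> {} \<and> cls ` e' = cls ` e}"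
definition isolated :: "nat set \<Rightarrow> nat set set set" where
  "isolated e = {R. {e} \<subseteq> R \<and> R \<inter> rivals e = {}}"

lemma cls_class: "{v. cls v = a} = {a * s..<a * s + s}"
proof (intro equalityI subsetI)
  fix v assume "v \<in> {v. cls v = a}"
  then have a: "v div s = a" by (simp add: cls_def)
  have "v = v div s * s + v mod s" by simp
  moreover have "v mod s < s" using s by simp
  ultimately show "v \<in> {a * s..<a * s + s}" unfolding a by simp
next
  fix v assume "v \<in> {a * s..<a * s + s}"
  then have "v div s = a" by (intro div_nat_eqI) (auto simp: mult.commute)
  then show "v \<in> {v. cls v = a}" by (simp add: cls_def)
qed

lemma card_class: "card {v. cls v = a} = s" "finite {v. cls v = a}"
  by (simp_all add: cls_class)

lemma class_bound: "a < m \<Longrightarrow> cls v = a \<Longrightarrow> v < n"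
  using s ms by (auto simp: cls_def div_less_iff_less_mult)

lemma J_edge: "j \<in> J \<Longrightarrow> \<exists>a b. j = {a, b} \<and> a \<noteq> b \<and> a < m \<and> b < m"
proof -
  assume "j \<in> J"
  then have "j \<subseteq> {..<m}" "card j = 2" using J by (auto simp: nsets_def)
  then show ?thesis by (auto simp: card_2_iff)
qed

lemma finite_blown: "finite blown"
  unfolding blown_def by (rule finite_subset[of _ "nsets {..<n} 2"]) (auto simp: finite_imp_finite_nsets)

lemma blown_edge:
  assumes "e \<in> blown" "cls ` e = {a, b}" "a \<noteq> b"
  shows "\<exists>u w. e = {u, w} \<and> cls u = a \<and> cls w = b"
proof -
  have "card e = 2" using assms(1) by (auto simp: blown_def nsets_def)
  then obtain x y where e: "e = {x, y}" by (auto simp: card_2_iff)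
  then have "{cls x, cls y} = {a, b}" using assms(2) by simp
  then consider "cls x = a" "cls y = b" | "cls x = b" "cls y = a" by (auto simp: doubleton_eq_iff)
  then show ?thesis using e by cases (blast, blast)
qed

lemma card_block:
  assumes "j \<in> J"
  shows "card {e \<in> blown. cls ` e = j} = s * s"
proof -
  obtain a b where ab: "j = {a, b}" "a \<noteq> b" "a < m" "b < m" using J_edge[OF assms] by blast
  define h where "h = (\<lambda>(u :: nat, w). {u, w})"
  have inj: "inj_on h ({v. cls v = a} \<times> {v. cls v = b})"
    using ab(2) by (auto simp: inj_on_def h_def doubleton_eq_iff)
  have im: "h ` ({v. cls v = a} \<times> {v. cls v = b}) = {e \<in> blown. cls ` e = j}"
  proof (intro equalityI subsetI)
    fix e assume "e \<in> h ` ({v. cls v = a} \<times> {v. cls v = b})"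
    then obtain u w where e: "e = {u, w}" "cls u = a" "cls w = b" by (auto simp: h_def)
    then have "u \<noteq> w" using ab(2) by auto
    moreover have "u < n" "w < n" using class_bound[OF ab(3) e(2)] class_bound[OF ab(4) e(3)] by auto
    ultimately show "e \<in> {e \<in> blown. cls ` e = j}" using e assms ab by (auto simp: blown_def nsets_def)
  next
    fix e assume "e \<in> {e \<in> blown. cls ` e = j}"
    then obtain u w where "e = {u, w}" "cls u = a" "cls w = b" using blown_edge[of e a b] ab by auto
    then show "e \<in> h ` ({v. cls v = a} \<times> {v. cls v = b})" by (auto simp: h_def)
  qed
  have "card {e \<in> blown. cls ` e = j} = card ({v. cls v = a} \<times> {v. cls v = b})"
    unfolding im[symmetric] by (rule card_image[OF inj])
  then show ?thesis by (simp add: card_cartesian_product card_class)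
qed

lemma card_blown: "card blown = card J * (s * s)"
proof -
  have finJ: "finite J" using J by (rule finite_subset) (simp add: finite_imp_finite_nsets)
  have "card blown = (\<Sum>j\<in>J. card {e \<in> blown. cls ` e = j})"
    unfolding card_eq_sum using finite_blown finJ by (intro sum.group[symmetric]) (auto simp: blown_def)
  then show ?thesis by (simp add: card_block)
qed

lemma card_rivals:
  assumes "e \<in> blown"
  shows "card (rivals e) \<le> 2 * (s - 1)"
proof -
  have "cls ` e \<in> J" using assms by (simp add: blown_def)
  then obtain a b where ab: "cls ` e = {a, b}" "a \<noteq> b" using J_edge by metis
  obtain u w where e: "e = {u, w}" "cls u = a" "cls w = b" using blown_edge[OF assms ab] by blast
  have sub: "rivals e \<subseteq> (\<lambda>w'. {u, w'}) ` ({v. cls v = b} - {w}) \<union> (\<lambda>u'. {u', w}) ` ({v. cls v = a} - {u})"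
  proof
    fix e' assume e': "e' \<in> rivals e"
    then have "e' \<in> blown" "cls ` e' = {a, b}" using ab by (auto simp: rivals_def)
    then obtain x y where xy: "e' = {x, y}" "cls x = a" "cls y = b" using blown_edge[of e' a b] ab(2) by blast
    have "e' \<noteq> e" "e' \<inter> e \<noteq> {}" using e' by (auto simp: rivals_def)
    then have "(x = u \<and> y \<noteq> w) \<or> (y = w \<and> x \<noteq> u)" using xy e ab(2) by auto
    then show "e' \<in> (\<lambda>w'. {u, w'}) ` ({v. cls v = b} - {w}) \<union> (\<lambda>u'. {u', w}) ` ({v. cls v = a} - {u})"
      using xy by auto
  qed
  have c1: "card ((\<lambda>w'. {u, w'}) ` ({v. cls v = b} - {w})) \<le> s - 1"
    using card_image_le[of "{v. cls v = b} - {w}" "\<lambda>w'. {u, w'}"] e card_class by simp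
  have c2: "card ((\<lambda>u'. {u', w}) ` ({v. cls v = a} - {u})) \<le> s - 1"
    using card_image_le[of "{v. cls v = a} - {u}" "\<lambda>u'. {u', w}"] e card_class by simp
  have "card (rivals e) \<le> card ((\<lambda>w'. {u, w'}) ` ({v. cls v = b} - {w}) \<union> (\<lambda>u'. {u', w}) ` ({v. cls v = a} - {u}))"
    using sub card_class by (intro card_mono) auto
  also have "\<dots> \<le> 2 * (s - 1)" using card_Un_le[of "(\<lambda>w'. {u, w'}) ` ({v. cls v = b} - {w})" "(\<lambda>u'. {u', w}) ` ({v. cls v = a} - {u})"] c1 c2 by linarith
  finally show ?thesis .
qed

text \<open>Two isolated edges with a common vertex lead to different classes. Hence, on a copy of a complete bipartite graph with edges
  among the isolated ones, the map to classes is injective, and its image is a copy inside \<open>J\<close>.\<close>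
lemma isolated_edges_free:
  fixes F :: "'a ugraph"
  assumes F: "simple_graph F" and K: "contains_copy F (complete_bipartite r t)" and rt: "0 < r" "0 < t"
    and JK: "\<not> contains_copy ({..<m}, J) (complete_bipartite r t)"
  shows "\<not> embeds F {..<n} {e \<in> blown. R \<in> isolated e}"
proof
  define H where "H = {e \<in> blown. R \<in> isolated e}"
  assume "embeds F {..<n} {e \<in> blown. R \<in> isolated e}"
  then obtain \<phi> where \<phi>: "inj_on \<phi> (verts F)" "\<And>e. e \<in> edges F \<Longrightarrow> \<phi> ` e \<in> H" unfolding embeds_def H_def by blast
  have vk: "verts (complete_bipartite r t) = {..<r} <+> {..<t}" by (simp add: complete_bipartite_def)
  obtain \<xi> where \<xi>: "inj_on \<xi> ({..<r} <+> {..<t})" "\<xi> ` ({..<r} <+> {..<t}) \<subseteq> verts F"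
    "\<And>e. e \<in> edges (complete_bipartite r t) \<Longrightarrow> \<xi> ` e \<in> edges F"
    using K unfolding contains_copy_iff[OF simple_complete_bipartite F] embeds_def vk by blast
  define \<psi> where "\<psi> x = \<phi> (\<xi> x)" for x
  have inj: "inj_on \<psi> ({..<r} <+> {..<t})"
    unfolding \<psi>_def using \<xi>(1,2) \<phi>(1)
    by (intro inj_onI) (metis image_subset_iff inj_on_eq_iff)
  have ed: "{\<psi> (Inl i), \<psi> (Inr j)} \<in> H" if "i < r" "j < t" for i j
  proof -
    have "{Inl i, Inr j} \<in> edges (complete_bipartite r t)" using that by (auto simp: complete_bipartite_def)
    then have "\<phi> ` \<xi> ` {Inl i, Inr j} \<in> H" by (intro \<phi>(2) \<xi>(3))
    then show ?thesis by (simp add: \<psi>_def)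
  qed
  define g where "g x = cls (\<psi> x)" for x
  have no_rival: "x = y" if "{x, z} \<in> H" "{y, z} \<in> H" "cls x = cls y" for x y z
  proof (rule ccontr)
    assume "x \<noteq> y"
    then have "{y, z} \<noteq> {x, z}" by (auto simp: doubleton_eq_iff)
    then have "{y, z} \<in> rivals {x, z}" using that by (auto simp: rivals_def H_def)
    moreover have "{y, z} \<in> R" "R \<inter> rivals {x, z} = {}" using that by (auto simp: H_def isolated_def)
    ultimately show False by blast
  qed
  have gJ: "{g (Inl i), g (Inr j)} \<in> J" if "i < r" "j < t" for i j
    using ed[OF that] by (simp add: H_def blown_def g_def)
  have gne: "g (Inl i) \<noteq> g (Inr j)" if "i < r" "j < t" for i j
    using J_edge[OF gJ[OF that]] by (metis doubleton_eq_iff)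
  have gl: "i = i'" if "i < r" "i' < r" "g (Inl i) = g (Inl i')" for i i'
  proof -
    have "\<psi> (Inl i) = \<psi> (Inl i')" using no_rival[OF ed[OF that(1) rt(2)] ed[OF that(2) rt(2)]] that(3) by (simp add: g_def)
    then show ?thesis using inj_onD[OF inj, of "Inl i" "Inl i'"] that by auto
  qed
  have gr: "j = j'" if "j < t" "j' < t" "g (Inr j) = g (Inr j')" for j j'
  proof -
    have "\<psi> (Inr j) = \<psi> (Inr j')"
      using no_rival[of "\<psi> (Inr j)" "\<psi> (Inl 0)" "\<psi> (Inr j')"] ed[OF rt(1) that(1)] ed[OF rt(1) that(2)] that(3)
      by (simp add: g_def insert_commute)
    then show ?thesis using inj_onD[OF inj, of "Inr j" "Inr j'"] that by auto
  qed
  have "inj_on g ({..<r} <+> {..<t})"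
    using gl gr gne by (intro inj_onI) (auto elim!: PlusE dest: gne[symmetric])
  moreover have "g ` ({..<r} <+> {..<t}) \<subseteq> {..<m}"
  proof -
    have "g (Inl i) < m" if "i < r" for i using J_edge[OF gJ[OF that rt(2)]] by (auto simp: doubleton_eq_iff)
    moreover have "g (Inr j) < m" if "j < t" for j using J_edge[OF gJ[OF rt(1) that]] by (auto simp: doubleton_eq_iff)
    ultimately show ?thesis by auto
  qed
  moreover have "g ` e \<in> J" if "e \<in> edges (complete_bipartite r t)" for e
    using that gJ by (auto simp: complete_bipartite_def)
  ultimately have "embeds (complete_bipartite r t) {..<m} J"
    unfolding embeds_def by (intro exI[of _ g]) (auto simp: complete_bipartite_def)
  then show False using JK J by (simp add: contains_copy_iff[OF simple_complete_bipartite simple_subset_graph[OF J]])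
qed

text \<open>For \<open>s\<close> about \<open>1 / (4 * p)\<close> an edge has at most \<open>1 / (2 * p)\<close> rivals, so given that it is present it is isolated with probability
  at least 1/2. Different blocks are independent, and within a block the number of pairs of edges is small enough for the second
  moment method.\<close>
lemma many_isolated_edges:
  assumes p: "0 < p" "p \<le> 1" and sp: "1 / (4 * p) \<le> real s" "real s \<le> 1 / (4 * p) + 1" and J0: "J \<noteq> {}"
  shows "measure_pmf.prob (rset (nsets {..<n} 2) p) {R. real (card {e \<in> blown. R \<in> isolated e}) \<le> real (card J) / (64 * p)}
    \<le> 80 / real (card J)"
proof -
  define X where "X = nsets {..<n} 2"
  define M where "M = rset X p"
  have finX: "finite X" by (simp add: X_def finite_imp_finite_nsets)
  have bX: "blown \<subseteq> X" by (auto simp: blown_def X_def)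
  have rX: "rivals e \<subseteq> X" for e using bX by (auto simp: rivals_def)
  have finr: "finite (rivals e)" for e using rX finX finite_subset by blast
  have finJ: "finite J" using J by (rule finite_subset) (simp add: finite_imp_finite_nsets)
  have cJ: "1 \<le> real (card J)" using J0 finJ by (simp add: Suc_le_eq card_gt_0_iff)
  define P where "P e = measure_pmf.prob M (isolated e)" for e
  have Pe: "P e = p * (1 - p) ^ card (rivals e)" if "e \<in> blown" for e
    unfolding P_def M_def isolated_def using that bX rX p finX
    by (subst prob_cylinder) (auto simp: rivals_def)
  have Plow: "p / 2 \<le> P e" if e: "e \<in> blown" for e
  proof -
    have "real (card (rivals e)) \<le> 2 * (real s - 1)"
    proof -
      have "real (card (rivals e)) \<le> real (2 * (s - 1))" using card_rivals[OF e] by (rule of_nat_mono)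
      then show ?thesis using s by (simp add: of_nat_diff)
    qed
    then have "real (card (rivals e)) * p \<le> 2 * (real s - 1) * p" using p by (intro mult_right_mono) auto
    also have "\<dots> \<le> 2 * (1 / (4 * p)) * p" using sp p by (intro mult_right_mono mult_left_mono) auto
    also have "\<dots> = 1 / 2" using p by simp
    finally have "1 / 2 \<le> 1 + real (card (rivals e)) * (- p)" by simp
    also have "\<dots> \<le> (1 + (- p)) ^ card (rivals e)" using p by (intro Bernoulli_inequality) auto
    finally have "p * (1 / 2) \<le> p * (1 - p) ^ card (rivals e)" using p by (intro mult_left_mono) auto
    then show ?thesis by (simp add: Pe[OF e])
  qed
  define \<mu> where "\<mu> = (\<Sum>e\<in>blown. P e)"
  define N where "N = real (card blown)"
  have NJ: "N = real (card J) * (real s * real s)" by (simp add: N_def card_blown)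
  have N0: "0 < N" using cJ s by (simp add: NJ)
  have \<mu>N: "N * p / 2 \<le> \<mu>"
  proof -
    have "(\<Sum>e\<in>blown. p / 2) \<le> \<mu>" unfolding \<mu>_def by (intro sum_mono Plow)
    then show ?thesis by (simp add: N_def)
  qed
  have \<mu>0: "0 < \<mu>" using \<mu>N N0 p by (smt (verit) mult_pos_pos half_gt_zero)
  define S2 where "S2 = real s * real s"
  have pair: "measure_pmf.prob M (isolated e \<inter> isolated e') \<le> P e * P e' + (if cls ` e = cls ` e' then p * p + (if e = e' then p else 0) else 0)"
    if e: "e \<in> blown" "e' \<in> blown" for e e'
  proof (cases "cls ` e = cls ` e'")
    case True
    have PP: "0 \<le> P e * P e'" by (simp add: P_def)
    have "measure_pmf.prob M (isolated e \<inter> isolated e') \<le> p * p + (if e = e' then p else 0)"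
    proof (cases "e = e'")
      case True
      have "measure_pmf.prob M (isolated e \<inter> isolated e') \<le> measure_pmf.prob M {R. {e} \<subseteq> R}"
        by (intro measure_pmf.finite_measure_mono) (auto simp: isolated_def)
      also have "\<dots> = p" unfolding M_def using finX e bX p by (subst prob_contains) auto
      finally show ?thesis using True p by (simp add: add_increasing)
    next
      case False
      have "measure_pmf.prob M (isolated e \<inter> isolated e') \<le> measure_pmf.prob M {R. {e, e'} \<subseteq> R}"
        by (intro measure_pmf.finite_measure_mono) (auto simp: isolated_def)
      also have "\<dots> = p * p" unfolding M_def using finX e bX p False by (subst prob_contains) (auto simp: power2_eq_square)
      finally show ?thesis using False by simp
    qed
    then show ?thesis using True PP by simp
  next
    case False
    have ne: "e \<noteq> e'" using False by auto
    have dis: "rivals e \<inter> rivals e' = {}" using False by (auto simp: rivals_def)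
    have "isolated e \<inter> isolated e' = {R. {e, e'} \<subseteq> R \<and> R \<inter> (rivals e \<union> rivals e') = {}}"
      by (auto simp: isolated_def)
    then have "measure_pmf.prob M (isolated e \<inter> isolated e') = p ^ card {e, e'} * (1 - p) ^ card (rivals e \<union> rivals e')"
      unfolding M_def using e bX rX p finX False
      by (simp only:) (intro prob_cylinder, auto simp: rivals_def)
    also have "\<dots> = P e * P e'"
      using ne finr dis by (simp add: Pe e card_Un_disjoint power_add power2_eq_square)
    finally show ?thesis using False by simp
  qed
  have "measure_pmf.prob M {R. \<mu> / 2 \<le> \<bar>real (card {e \<in> blown. R \<in> isolated e}) - \<mu>\<bar>} \<le> (N * (S2 * (p * p) + p)) / (\<mu> / 2)\<^sup>2"
  proof (rule second_moment[OF finite_blown])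
    have "(\<Sum>e\<in>blown. \<Sum>e'\<in>blown. measure_pmf.prob M (isolated e \<inter> isolated e'))
       \<le> (\<Sum>e\<in>blown. \<Sum>e'\<in>blown. P e * P e' + (if cls ` e = cls ` e' then p * p + (if e = e' then p else 0) else 0))"
      by (intro sum_mono pair)
    also have "\<dots> = \<mu>\<^sup>2 + (\<Sum>e\<in>blown. \<Sum>e'\<in>blown. if cls ` e = cls ` e' then p * p + (if e = e' then p else 0) else 0)"
      by (simp only: sum.distrib \<mu>_def power2_eq_square sum_product)
    also have "(\<Sum>e\<in>blown. \<Sum>e'\<in>blown. if cls ` e = cls ` e' then p * p + (if e = e' then p else 0) else 0) \<le> (\<Sum>e\<in>blown. S2 * (p * p) + p)"
    proof (intro sum_mono)
      fix e assume e: "e \<in> blown"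
      have "(\<Sum>e'\<in>blown. if cls ` e = cls ` e' then p * p + (if e = e' then p else 0) else 0)
         = (\<Sum>e'\<in>blown. (if cls ` e' = cls ` e then p * p else 0) + (if e = e' then p else 0))"
        by (intro sum.cong refl) auto
      also have "\<dots> = real (card {e' \<in> blown. cls ` e' = cls ` e}) * (p * p) + p"
        using finite_blown e by (simp add: sum.distrib sum.If_cases Int_def)
      also have "card {e' \<in> blown. cls ` e' = cls ` e} = s * s" using e by (intro card_block) (simp add: blown_def)
      finally show "(\<Sum>e'\<in>blown. if cls ` e = cls ` e' then p * p + (if e = e' then p else 0) else 0) \<le> S2 * (p * p) + p"
        by (simp add: S2_def)
    qed
    finally show "(\<Sum>e\<in>blown. \<Sum>e'\<in>blown. measure_pmf.prob M (isolated e \<inter> isolated e')) \<le> \<mu>\<^sup>2 + N * (S2 * (p * p) + p)"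
      by (simp add: N_def)
    show "\<mu> = (\<Sum>e\<in>blown. measure_pmf.prob M (isolated e))" by (simp add: \<mu>_def P_def)
  qed (use \<mu>0 in simp)
  also have "\<dots> \<le> (N * (S2 * (p * p) + p)) / (N * p / 4)\<^sup>2"
    using \<mu>N N0 p \<mu>0 by (intro divide_left_mono power_mono mult_pos_pos zero_less_power mult_nonneg_nonneg) (auto simp: S2_def)
  also have "\<dots> = 16 * (S2 * p + 1) / (N * p)" using N0 p by (simp add: field_simps power2_eq_square)
  also have "\<dots> = 16 * (1 + 1 / (S2 * p)) / real (card J)"
  proof -
    have "0 < S2" using s by (simp add: S2_def)
    then show ?thesis unfolding NJ S2_def[symmetric] using p cJ by (simp add: field_simps)
  qed
  also have "\<dots> \<le> 80 / real (card J)"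
  proof (intro divide_right_mono)
    have "1 / 4 * 1 \<le> (real s * p) * real s" using sp p s by (intro mult_mono) (auto simp: field_simps)
    then have S: "1 / 4 \<le> S2 * p" by (simp add: S2_def mult_ac)
    then have "1 / (S2 * p) \<le> 1 / (1/4)" by (intro divide_left_mono) auto
    then show "16 * (1 + 1 / (S2 * p)) \<le> 80" by simp
  qed auto
  finally have fin: "measure_pmf.prob M {R. \<mu> / 2 \<le> \<bar>real (card {e \<in> blown. R \<in> isolated e}) - \<mu>\<bar>} \<le> 80 / real (card J)" .
  have "real (card J) / (64 * p) \<le> \<mu> / 2"
  proof -
    have "1 / (4 * p) * (1 / (4 * p)) \<le> real s * real s" using sp p by (intro mult_mono) auto
    then have "real (card J) * (1 / (4 * p) * (1 / (4 * p))) * p / 4 \<le> N * p / 4"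
      unfolding NJ using p by (intro divide_right_mono mult_right_mono mult_left_mono) auto
    moreover have "real (card J) * (1 / (4 * p) * (1 / (4 * p))) * p / 4 = real (card J) / (64 * p)" using p by (simp add: field_simps)
    ultimately show ?thesis using \<mu>N by linarith
  qed
  then have "measure_pmf.prob M {R. real (card {e \<in> blown. R \<in> isolated e}) \<le> real (card J) / (64 * p)}
     \<le> measure_pmf.prob M {R. \<mu> / 2 \<le> \<bar>real (card {e \<in> blown. R \<in> isolated e}) - \<mu>\<bar>}"
    by (intro measure_pmf.finite_measure_mono) auto
  then show ?thesis using fin by (simp add: M_def X_def)
qed

end

lemma blow_up_lower_bound:
  fixes F :: "'a ugraph" and p :: real
  assumes F: "simple_graph F" and K: "contains_copy F (complete_bipartite r t)" and rt: "0 < r" "0 < t"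
    and s: "0 < s" "m * s \<le> n" and J: "J \<subseteq> nsets {..<m} 2" "J \<noteq> {}"
    and JK: "\<not> contains_copy ({..<m}, J) (complete_bipartite r t)"
    and p: "0 < p" "p \<le> 1" and sp: "1 / (4 * p) \<le> real s" "real s \<le> 1 / (4 * p) + 1"
  shows "measure_pmf.prob (gnp n p) {G. real (ex_in G F) \<le> real (card J) / (64 * p)} \<le> 80 / real (card J)"
proof -
  have "measure_pmf.prob (gnp n p) {G. real (ex_in G F) \<le> real (card J) / (64 * p)}
     \<le> measure_pmf.prob (rset (nsets {..<n} 2) p) {R. real (card {e \<in> blown s n J. R \<in> isolated s n J e}) \<le> real (card J) / (64 * p)}"
    unfolding prob_gnp
  proof (rule rset_mono_event)
    fix R assume R: "R \<subseteq> nsets {..<n} 2" and le: "real (ex_in ({..<n}, R) F) \<le> real (card J) / (64 * p)"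
    have "card {e \<in> blown s n J. R \<in> isolated s n J e} \<le> ex_in ({..<n}, R) F"
      using isolated_edges_free[OF s J(1) F K rt JK]
      by (intro ex_in_lower F R) (auto simp: isolated_def[OF s J(1)])
    then have "real (card {e \<in> blown s n J. R \<in> isolated s n J e}) \<le> real (ex_in ({..<n}, R) F)" by (rule of_nat_mono)
    then show "real (card {e \<in> blown s n J. R \<in> isolated s n J e}) \<le> real (card J) / (64 * p)" using le by linarith
  qed
  also have "\<dots> \<le> 80 / real (card J)" by (rule many_isolated_edges[OF s J(1) p sp J(2)])
  finally show ?thesis .
qed

section \<open>From the hypotheses to a balanced template\<close>

lemma ex_num_attained:
  fixes K :: "'b ugraph"
  assumes K: "simple_graph K" "edges K \<noteq> {}"
  shows "\<exists>A\<subseteq>nsets {..<n::nat} 2. \<not> contains_copy ({..<n}, A) K \<and> card A = ex_num n K"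
proof -
  define Z where "Z = {e_num G | G :: nat ugraph. simple_graph G \<and> verts G = {..<n} \<and> \<not> contains_copy G K}"
  have "finite Z"
  proof (rule finite_subset)
    have fin: "finite (nsets {..<n} 2)" by (simp add: finite_imp_finite_nsets)
    show "Z \<subseteq> {..card (nsets {..<n} 2)}"
    proof
      fix z assume "z \<in> Z"
      then obtain G :: "nat ugraph" where G: "z = e_num G" "simple_graph G" "verts G = {..<n}" by (auto simp: Z_def)
      then have "edges G \<subseteq> nsets {..<n} 2" by (simp add: simple_graph_def)
      then show "z \<in> {..card (nsets {..<n} 2)}" using card_mono[OF fin] G(1) by auto
    qed
  qed simp
  moreover have "e_num ({..<n}, {}) \<in> Z"
  proof -
    have s: "simple_graph ({..<n}, {})" by (simp add: simple_graph_def)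
    then have "\<not> contains_copy ({..<n}, {}) K" using K by (auto simp: contains_copy_iff embeds_def)
    then show ?thesis unfolding Z_def using s by (intro CollectI exI[of _ "({..<n}, {})"]) auto
  qed
  ultimately have "Max Z \<in> Z" by (intro Max_in) auto
  then obtain G :: "nat ugraph" where G: "ex_num n K = e_num G" "simple_graph G" "verts G = {..<n}" "\<not> contains_copy G K"
    unfolding ex_num_def Z_def by auto
  have "G = ({..<n}, edges G)" using G(3) by (metis prod.collapse)
  then show ?thesis using G by (intro exI[of _ "edges G"]) (auto simp: simple_graph_def)
qed

text \<open>A graph without a star with \<open>r\<close> leaves has all degrees below \<open>r\<close>.\<close>
lemma ex_num_star:
  assumes "0 < r"
  shows "ex_num n (complete_bipartite r 1) \<le> n * r"
proof -
  define K where "K = complete_bipartite r 1"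
  have "{Inl 0, Inr 0} \<in> edges K" using assms by (auto simp: K_def complete_bipartite_def)
  then obtain A where A: "A \<subseteq> nsets {..<n} 2" "\<not> contains_copy ({..<n}, A) K" "card A = ex_num n K"
    using ex_num_attained[of K n] simple_complete_bipartite by (auto simp: K_def)
  have "card (nbrs A v) \<le> r" if v: "v < n" for v
  proof (rule ccontr)
    assume "\<not> card (nbrs A v) \<le> r"
    then obtain W where W: "W \<subseteq> nbrs A v" "card W = r" using obtain_subset_with_card_n[of r "nbrs A v"] by auto
    have "finite W" using W(1) finite_nbrs[OF A(1)] finite_subset by metis
    then obtain h where "bij_betw h {0..<card W} W" using ex_bij_betw_nat_finite by metis
    then have h: "bij_betw h {..<r} W" by (simp add: W(2) lessThan_atLeast0)
    have hW: "h i \<in> nbrs A v" if "i < r" for i using h W(1) that by (auto simp: bij_betw_def)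
    have hn: "h i < n" "h i \<noteq> v" "{h i, v} \<in> A" if "i < r" for i
      using hW[OF that] nbrs_bound[OF A(1), of v] by (auto simp: nbrs_def)
    define \<phi> where "\<phi> x = (case x of Inl i \<Rightarrow> h i | Inr j \<Rightarrow> v)" for x :: "nat + nat"
    have "inj_on \<phi> (verts K)"
    proof -
      have "h i = h j \<longleftrightarrow> i = j" if "i < r" "j < r" for i j
        using h that by (auto simp: bij_betw_def inj_on_def)
      then show ?thesis using hn(2) not_sym[OF hn(2)]
        by (auto simp: K_def complete_bipartite_def inj_on_def \<phi>_def)
    qed
    moreover have "\<phi> ` verts K \<subseteq> {..<n}" using hn(1) v by (auto simp: K_def complete_bipartite_def \<phi>_def)
    moreover have "\<forall>e\<in>edges K. \<phi> ` e \<in> A" using hn(3) by (auto simp: K_def complete_bipartite_def \<phi>_def)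
    ultimately have "embeds K {..<n} A" unfolding embeds_def by (intro exI[of _ \<phi>] conjI)
    then show False using A(2) simple_complete_bipartite A(1)
      by (simp add: K_def contains_copy_iff simple_subset_graph)
  qed
  then have "(\<Sum>v<n. card (nbrs A v)) \<le> (\<Sum>v<n. r)" by (intro sum_mono) auto
  then have "2 * card A \<le> n * r" using sum_degrees[OF A(1)] by simp
  then show ?thesis using A(3) by (simp add: K_def)
qed

text \<open>A linear upper bound contradicts an exponent \<open>2 - 1/r > 1\<close>. This is what rules out \<open>T = {v*}\<close> later.\<close>
lemma star_not_theta:
  assumes "2 \<le> r"
  shows "(\<lambda>n. real (ex_num n (complete_bipartite r 1))) \<notin> \<Theta>(\<lambda>n. real n powr (2 - 1 / real r))"
proof
  assume "(\<lambda>n. real (ex_num n (complete_bipartite r 1))) \<in> \<Theta>(\<lambda>n. real n powr (2 - 1 / real r))"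
  then have "(\<lambda>n. real (ex_num n (complete_bipartite r 1))) \<in> \<Omega>(\<lambda>n. real n powr (2 - 1 / real r))" by (rule bigthetaD2)
  then obtain c where c: "0 < c" "eventually (\<lambda>n. c * norm (real n powr (2 - 1 / real r)) \<le> norm (real (ex_num n (complete_bipartite r 1)))) sequentially"
    by (elim landau_omega.bigE)
  have e0: "0 < 1 - 1 / real r" using assms by simp
  have "filterlim (\<lambda>n. real n powr (1 - 1 / real r)) at_top sequentially"
    using e0 by (intro filterlim_compose[OF real_powr_at_top filterlim_real_sequentially])
  then have "eventually (\<lambda>n. real r / c + 1 \<le> real n powr (1 - 1 / real r)) sequentially" by (simp add: filterlim_at_top)
  with c(2) have "eventually (\<lambda>n. False) sequentially"
    using eventually_gt_at_top[of 0]
  proof eventually_elim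
    case (elim n)
    have "real (ex_num n (complete_bipartite r 1)) \<le> real (n * r)" using assms by (intro of_nat_mono ex_num_star) auto
    moreover have "real n powr (2 - 1 / real r) = real n * real n powr (1 - 1 / real r)"
      using elim(3) powr_add[of "real n" 1 "1 - 1 / real r"] by simp
    ultimately have "c * (real n * real n powr (1 - 1 / real r)) \<le> real n * real r" using elim(1) by simp
    then have "c * real n powr (1 - 1 / real r) \<le> real r" using elim(3) by simp
    moreover have "c * (real r / c + 1) \<le> c * real n powr (1 - 1 / real r)" using elim(2) c(1) by (intro mult_left_mono) auto
    ultimately show False using c(1) by (simp add: distrib_left)
  qed
  then show False by simp
qed

locale rooted_graph =
  fixes F :: "'a ugraph" and S T :: "'a set" and vstar :: 'a and r :: nat
  assumes simple: "simple_graph F"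
    and bip: "bipartition F S T"
    and vT: "vstar \<in> T"
    and vS: "\<forall>u \<in> S. adjacent F vstar u"
    and r2: "r \<ge> 2"
    and deg: "\<forall>v \<in> T - {vstar}. vdegree F v = r"
    and turan: "\<exists>t \<ge> 1. contains_copy F (complete_bipartite r t) \<and>
           (\<lambda>n. real (ex_num n (complete_bipartite r t))) \<in> \<Theta>(\<lambda>n. real n powr (2 - 1 / real r))"
    and bal: "two_balanced F"
    and wbal: "Max {(real (e_num (induced F (\<mu> \<union> nbhd_in F T \<mu>))) - real (card (nbhd_in F T \<mu>)))
                / (real (card \<mu>) - 1) | \<mu>. \<mu> \<subseteq> S \<and> card \<mu> \<ge> 2}
           = (real (e_num F) - real (card T)) / (real (card S) - 1)"
begin

definition nb where "nb v = {u \<in> S. {u, v} \<in> edges F}"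

lemma verts_F: "verts F = S \<union> T" "S \<inter> T = {}" using bip by (auto simp: bipartition_def)
lemma fin: "finite S" "finite T" using simple verts_F(1) by (auto simp: simple_graph_def)
lemma edge_form: "e \<in> edges F \<Longrightarrow> \<exists>u v. e = {u, v} \<and> v \<in> T \<and> u \<in> nb v"
proof -
  assume e: "e \<in> edges F"
  then obtain u v where "u \<in> S" "v \<in> T" "e = {u, v}" using bip unfolding bipartition_def by blast
  then show ?thesis using e by (auto simp: nb_def)
qed
lemma edges_F: "edges F = {{u, v} | u v. v \<in> T \<and> u \<in> nb v}"
  using edge_form by (fastforce simp: nb_def)
lemma nb_root: "nb vstar = S" using vS by (auto simp: nb_def adjacent_def insert_commute)
lemma card_nb: "v \<in> T - {vstar} \<Longrightarrow> nb v \<subseteq> S \<and> card (nb v) = r"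
proof -
  assume v: "v \<in> T - {vstar}"
  have "{u \<in> verts F. adjacent F v u} = nb v"
  proof (intro equalityI subsetI)
    fix u assume "u \<in> {u \<in> verts F. adjacent F v u}"
    then have "{u, v} \<in> edges F" by (simp add: adjacent_def insert_commute)
    then obtain a b where ab: "{u, v} = {a, b}" "b \<in> T" "a \<in> nb b" using edge_form by blast
    moreover have "a \<noteq> v" using v ab(3) verts_F(2) by (auto simp: nb_def)
    ultimately show "u \<in> nb v" by (auto simp: doubleton_eq_iff)
  qed (auto simp: nb_def adjacent_def insert_commute verts_F)
  then have "card (nb v) = vdegree F v" by (simp add: vdegree_def)
  then show ?thesis using deg v by (auto simp: nb_def)
qed

text \<open>If \<open>T\<close> were \<open>{v*}\<close>, then all edges of \<open>F\<close> would share \<open>v*\<close>, and the only complete bipartite subgraphs \<open>K\<^bsub>r,t\<^esub>\<close> with \<open>r \<ge> 2\<close>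
  would be stars.\<close>
lemma T_ge_2: "2 \<le> card T"
proof (rule ccontr)
  assume "\<not> 2 \<le> card T"
  moreover have "0 < card T" using vT fin(2) by (auto simp: card_gt_0_iff)
  ultimately have "card T = 1" by linarith
  then have T: "T = {vstar}" using vT by (auto simp: card_1_singleton_iff)
  obtain t where t: "1 \<le> t" "contains_copy F (complete_bipartite r t)"
    "(\<lambda>n. real (ex_num n (complete_bipartite r t))) \<in> \<Theta>(\<lambda>n. real n powr (2 - 1 / real r))" using turan by auto
  have vk: "verts (complete_bipartite r t) = {..<r} <+> {..<t}" by (simp add: complete_bipartite_def)
  obtain \<xi> where \<xi>: "inj_on \<xi> ({..<r} <+> {..<t})" "\<And>e. e \<in> edges (complete_bipartite r t) \<Longrightarrow> \<xi> ` e \<in> edges F"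
    using t(2) unfolding contains_copy_iff[OF simple_complete_bipartite simple] embeds_def vk by blast
  have ed: "vstar \<in> \<xi> ` {Inl i, Inr j}" if "i < r" "j < t" for i j
  proof -
    have "{Inl i, Inr j} \<in> edges (complete_bipartite r t)" using that by (auto simp: complete_bipartite_def)
    then have "\<xi> ` {Inl i, Inr j} \<in> edges F" by (rule \<xi>(2))
    then obtain u v where "\<xi> ` {Inl i, Inr j} = {u, v}" "v \<in> T" using edge_form by blast
    then show ?thesis using T by auto
  qed
  have "t = 1"
  proof (rule ccontr)
    assume "t \<noteq> 1"
    then have t2: "1 < t" using t(1) by linarith
    have v01: "vstar \<in> \<xi> ` {Inl 0, Inr 0}" "vstar \<in> \<xi> ` {Inl 1, Inr 1}" using ed[of 0 0] ed[of 1 1] r2 t2 by auto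
    obtain x where x: "vstar = \<xi> x" "x \<in> {Inl 0, Inr 0}" using v01(1) by (rule imageE)
    obtain y where y: "vstar = \<xi> y" "y \<in> {Inl 1, Inr 1}" using v01(2) by (rule imageE)
    have xy: "x \<in> {Inl 0, Inr 0}" "y \<in> {Inl 1, Inr 1}" "\<xi> x = \<xi> y" using x y by auto
    then have "x \<in> {..<r} <+> {..<t}" "y \<in> {..<r} <+> {..<t}" using r2 t2 by auto
    then have "x = y" using xy(3) \<xi>(1) by (auto dest: inj_onD)
    then show False using xy by auto
  qed
  then show False using t(3) star_not_theta[OF r2] by simp
qed

lemma S_ge_2: "2 \<le> card S"
proof -
  have "card (T - {vstar}) = card T - 1" using vT fin by simp
  then have "0 < card (T - {vstar})" using T_ge_2 by simp
  then have "T - {vstar} \<noteq> {}" by (metis card.empty less_irrefl)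
  then obtain v where v: "v \<in> T - {vstar}" by auto
  have "card (nb v) \<le> card S" using card_nb[OF v] fin by (intro card_mono) auto
  then show ?thesis using card_nb[OF v] r2 by simp
qed

sublocale R: rooted_template S T nb vstar r
  using fin verts_F(2) vT nb_root card_nb S_ge_2 T_ge_2 r2 by unfold_locales auto

lemma tedges_eq: "R.tedges = edges F" by (simp add: R.tedges_def edges_F)
lemma finite_edges: "finite (edges F)" using R.finite_tedges by (simp add: tedges_eq)

lemma card_edges: "card (edges F) = card S + r * (card T - 1)"
proof -
  define h where "h = (\<lambda>(v, u). {u, v} :: 'a set)"
  have finb: "finite (nb v)" for v using fin by (simp add: nb_def)
  have inj: "inj_on h (Sigma T nb)"
    using verts_F(2) by (auto simp: inj_on_def h_def doubleton_eq_iff nb_def)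
  have im: "h ` Sigma T nb = edges F" by (auto simp: h_def edges_F)
  have "card (edges F) = card (Sigma T nb)" unfolding im[symmetric] by (rule card_image[OF inj])
  also have "\<dots> = (\<Sum>v\<in>T. card (nb v))" using fin finb by (subst card_SigmaI) auto
  also have "\<dots> = card (nb vstar) + (\<Sum>v\<in>T - {vstar}. card (nb v))" using fin vT by (simp add: sum.remove)
  also have "(\<Sum>v\<in>T - {vstar}. card (nb v)) = (\<Sum>v\<in>T - {vstar}. r)" by (intro sum.cong refl) (use card_nb in auto)
  finally show ?thesis using fin vT nb_root by simp
qed

lemma real_card_edges: "real (card (edges F)) = real (card S) + real r * (real (card T) - 1)"
  using T_ge_2 by (simp add: card_edges of_nat_diff)

lemma real_card_verts: "real (v_num F) = real (card S) + real (card T)"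
  using fin verts_F by (simp add: card_Un_disjoint)

lemma edge_cover:
  assumes "D \<subseteq> edges F" "e \<in> D"
  shows "\<exists>u v. e = {u, v} \<and> u \<in> R.coverS D \<and> v \<in> R.coverT D \<and> u \<in> nb v"
proof -
  obtain u v where "e = {u, v}" "v \<in> T" "u \<in> nb v" using edge_form assms by blast
  moreover then have "u \<in> S" by (simp add: nb_def)
  ultimately show ?thesis using assms(2) by (intro exI[of _ u] exI[of _ v]) (auto simp: R.coverS_def R.coverT_def)
qed

lemma single_cover:
  assumes D: "D \<subseteq> edges F" and c: "card (R.coverS D) = 1"
  shows "card D \<le> card (R.coverT D)"
proof -
  obtain u where u: "R.coverS D = {u}" using c by (auto simp: card_1_singleton_iff)
  have "D \<subseteq> (\<lambda>v. {u, v}) ` R.coverT D"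
  proof
    fix e assume "e \<in> D"
    then obtain a v where "e = {a, v}" "a \<in> R.coverS D" "v \<in> R.coverT D" using edge_cover[OF D] by blast
    then show "e \<in> (\<lambda>v. {u, v}) ` R.coverT D" using u by auto
  qed
  moreover have "finite (R.coverT D)" using fin by (simp add: R.coverT_def)
  ultimately show ?thesis by (metis card_image_le card_mono finite_imageI le_trans)
qed

lemma cover_pos:
  assumes D: "D \<subseteq> edges F" "D \<noteq> {}"
  shows "1 \<le> card (R.coverS D)" "1 \<le> card (R.coverT D)"
  using R.tedges_cover[of D] D fin by (simp_all add: tedges_eq Suc_le_eq card_gt_0_iff R.coverS_def R.coverT_def)

text \<open>Let \<open>\<mu>\<close> be the set of vertices of \<open>S\<close> touched by \<open>D\<close>. Adding to \<open>D\<close> one edge to \<open>\<mu>\<close> from each vertex of its neighbourhood not touched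
  by \<open>D\<close> does not change \<open>card D - card (coverT D)\<close>, and the result lies in the subgraph induced by \<open>\<mu>\<close> and its
  neighbourhood. The hypothesis on \<open>\<mu>\<close> then applies, unless \<open>\<mu>\<close> is a single vertex, where the left-hand side is at most 0.\<close>
lemma weight:
  assumes D: "D \<subseteq> edges F" "D \<noteq> {}"
  shows "real (card D) - real (card (R.coverT D)) \<le> (1 + (real r - 1) * (real (card T) - 1) / (real (card S) - 1)) * (real (card (R.coverS D)) - 1)"
proof (cases "card (R.coverS D) = 1")
  case True
  then show ?thesis using single_cover[OF D(1) True] by simp
next
  case False
  define \<mu> where "\<mu> = R.coverS D"
  have \<mu>2: "2 \<le> card \<mu>" using False cover_pos[OF D] by (simp add: \<mu>_def)
  have \<mu>S: "\<mu> \<subseteq> S" by (auto simp: \<mu>_def R.coverS_def)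
  define N where "N = nbhd_in F T \<mu>"
  define I where "I = edges (induced F (\<mu> \<union> N))"
  define val where "val \<mu> = (real (e_num (induced F (\<mu> \<union> nbhd_in F T \<mu>))) - real (card (nbhd_in F T \<mu>))) / (real (card \<mu>) - 1)" for \<mu>
  have Ie: "I = {e \<in> edges F. e \<subseteq> \<mu> \<union> N}" by (simp add: I_def induced_def)
  have finN: "finite N" using fin by (simp add: N_def nbhd_in_def)
  have finI: "finite I" using finite_edges by (simp add: Ie)
  have \<nu>N: "R.coverT D \<subseteq> N"
  proof
    fix v assume "v \<in> R.coverT D"
    then obtain e where e: "e \<in> D" "v \<in> e" "v \<in> T" by (auto simp: R.coverT_def)
    obtain a b where ab: "e = {a, b}" "a \<in> \<mu>" "b \<in> R.coverT D" "a \<in> nb b" using edge_cover[OF D(1) e(1)] unfolding \<mu>_def by blast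
    have "a \<noteq> v" using ab(2) \<mu>S e(3) verts_F(2) by auto
    then have "b = v" using e(2) ab(1) by auto
    then show "v \<in> N" using ab e(3) by (auto simp: N_def nbhd_in_def adjacent_def nb_def)
  qed
  have DI: "D \<subseteq> I"
  proof
    fix e assume e: "e \<in> D"
    then obtain a b where "e = {a, b}" "a \<in> \<mu>" "b \<in> R.coverT D" using edge_cover[OF D(1) e] unfolding \<mu>_def by blast
    then show "e \<in> I" using e D(1) \<nu>N by (auto simp: Ie)
  qed
  have "\<exists>u. u \<in> \<mu> \<and> {u, v} \<in> edges F" if "v \<in> N" for v using that by (auto simp: N_def nbhd_in_def adjacent_def)
  then obtain h where h: "\<And>v. v \<in> N \<Longrightarrow> h v \<in> \<mu> \<and> {h v, v} \<in> edges F" by metis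
  define X where "X = (\<lambda>v. {h v, v}) ` (N - R.coverT D)"
  have NT: "N \<subseteq> T" by (auto simp: N_def nbhd_in_def)
  have injX: "inj_on (\<lambda>v. {h v, v}) (N - R.coverT D)"
  proof (rule inj_onI)
    fix v v' assume v: "v \<in> N - R.coverT D" "v' \<in> N - R.coverT D" and eq: "{h v, v} = {h v', v'}"
    have "v' \<noteq> h v" using h[of v] \<mu>S v NT verts_F(2) by auto
    then show "v = v'" using eq by (auto simp: doubleton_eq_iff)
  qed
  have "X \<inter> D = {}"
  proof (rule ccontr)
    assume "X \<inter> D \<noteq> {}"
    then obtain v where v: "v \<in> N" "v \<notin> R.coverT D" "{h v, v} \<in> D" by (auto simp: X_def)
    then show False using NT by (auto simp: R.coverT_def)
  qed
  moreover have "X \<subseteq> I" using h by (auto simp: X_def Ie)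
  ultimately have "card D + card X \<le> card I"
    using DI finI by (metis Int_commute Un_subset_iff card_Un_disjoint card_mono finite_subset)
  moreover have "card X = card N - card (R.coverT D)"
    unfolding X_def card_image[OF injX] using \<nu>N finN by (simp add: card_Diff_subset finite_subset)
  moreover have "card (R.coverT D) \<le> card N" using \<nu>N finN by (rule card_mono[rotated])
  ultimately have "card D + card N \<le> card I + card (R.coverT D)" by linarith
  then have "real (card D + card N) \<le> real (card I + card (R.coverT D))" by (rule of_nat_mono)
  then have le: "real (card D) - real (card (R.coverT D)) \<le> real (card I) - real (card N)" by simp
  have "{val \<mu> | \<mu>. \<mu> \<subseteq> S \<and> card \<mu> \<ge> 2} \<subseteq> val ` Pow S" by auto
  then have "finite {val \<mu> | \<mu>. \<mu> \<subseteq> S \<and> card \<mu> \<ge> 2}" using fin by (meson finite_Pow_iff finite_imageI finite_subset)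
  then have "val \<mu> \<le> Max {val \<mu> | \<mu>. \<mu> \<subseteq> S \<and> card \<mu> \<ge> 2}" using \<mu>S \<mu>2 by (intro Max_ge) auto
  also have "\<dots> = (real (e_num F) - real (card T)) / (real (card S) - 1)" using wbal by (simp add: val_def)
  also have "\<dots> = 1 + (real r - 1) * (real (card T) - 1) / (real (card S) - 1)"
    using S_ge_2 unfolding real_card_edges by (simp add: field_simps)
  finally have v: "val \<mu> \<le> 1 + (real r - 1) * (real (card T) - 1) / (real (card S) - 1)" .
  have "real (card I) - real (card N) = val \<mu> * (real (card \<mu>) - 1)"
    using \<mu>2 by (simp add: val_def I_def N_def)
  also have "\<dots> \<le> (1 + (real r - 1) * (real (card T) - 1) / (real (card S) - 1)) * (real (card \<mu>) - 1)"
    using v \<mu>2 by (intro mult_right_mono) auto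
  finally show ?thesis using le by (simp add: \<mu>_def)
qed

text \<open>The hypothesis of 2-balancedness for the subgraph formed by \<open>D\<close> and the vertices it touches. A single edge spans too few
  vertices to be covered by it, but satisfies the inequality trivially.\<close>
lemma density:
  assumes D: "D \<subseteq> edges F" "D \<noteq> {}"
  shows "(real (card D) - 1) * (real (card S) + real (card T) - 2) \<le>
       (real (card (R.coverS D)) + real (card (R.coverT D)) - 2) * (real (card S) - 1 + real r * (real (card T) - 1))"
proof -
  define V' where "V' = R.coverS D \<union> R.coverT D"
  have cV: "card V' = card (R.coverS D) + card (R.coverT D)"
    unfolding V'_def using fin verts_F(2) by (intro card_Un_disjoint) (auto simp: R.coverS_def R.coverT_def)
  show ?thesis
  proof (cases "card V' \<ge> 3")
    case True
    define val where "val F' = (real (e_num F') - 1) / (real (v_num F') - 2)" for F' :: "'a ugraph"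
    have sub: "subgraph (V', D) F"
    proof -
      have "D \<subseteq> nsets V' 2"
      proof
        fix e assume e: "e \<in> D"
        then obtain a b where "e = {a, b}" "a \<in> V'" "b \<in> V'" using edge_cover[OF D(1) e] unfolding V'_def by blast
        moreover have c2: "card e = 2" using simple_edge[OF simple, of e] e D(1) by auto
        moreover have "finite e" by (rule card_ge_0_finite) (simp add: c2)
        ultimately show "e \<in> nsets V' 2" by (auto simp: nsets_def)
      qed
      moreover have "V' \<subseteq> verts F" "finite V'" using fin verts_F(1) by (auto simp: V'_def R.coverS_def R.coverT_def)
      ultimately show ?thesis using D(1) by (simp add: subgraph_def simple_graph_def)
    qed
    have "{val F' | F'. subgraph F' F \<and> v_num F' \<ge> 3} \<subseteq> val ` (Pow (verts F) \<times> Pow (edges F))"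
      by (force simp: subgraph_def)
    moreover have "finite (val ` (Pow (verts F) \<times> Pow (edges F)))" using finite_edges simple by (simp add: simple_graph_def)
    ultimately have "finite {val F' | F'. subgraph F' F \<and> v_num F' \<ge> 3}" by (rule finite_subset)
    then have "val (V', D) \<le> Max {val F' | F'. subgraph F' F \<and> v_num F' \<ge> 3}"
      using sub True by (intro Max_ge) auto
    also have "\<dots> = m2 F" by (simp add: m2_def val_def)
    also have "\<dots> = (real (e_num F) - 1) / (real (v_num F) - 2)" using bal by (simp add: two_balanced_def)
    finally have "(real (card D) - 1) / (real (card V') - 2) \<le> (real (e_num F) - 1) / (real (v_num F) - 2)" by (simp add: val_def)
    moreover have "0 < real (card V') - 2" using True by simp
    moreover have "0 < real (v_num F) - 2" using S_ge_2 T_ge_2 unfolding real_card_verts by simp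
    ultimately have "(real (card D) - 1) * (real (v_num F) - 2) \<le> (real (e_num F) - 1) * (real (card V') - 2)"
      by (simp add: pos_divide_le_eq pos_le_divide_eq field_simps)
    then show ?thesis unfolding real_card_verts real_card_edges cV by (simp add: algebra_simps)
  next
    case False
    then have c: "card (R.coverS D) = 1" "card (R.coverT D) = 1" using cover_pos[OF D] cV by linarith+
    have "card D \<le> 1" using single_cover[OF D(1) c(1)] c(2) by simp
    moreover have "0 < card D" using D finite_edges by (simp add: card_gt_0_iff finite_subset)
    ultimately have "card D = 1" by linarith
    then show ?thesis using c by simp
  qed
qed

sublocale B: balanced_template S T nb vstar r
  by unfold_locales (auto simp: tedges_eq intro: weight density)

lemma edges_nonempty: "edges F \<noteq> {}"
  using card_edges S_ge_2 by auto

lemma no_isolated: "v \<in> verts F \<Longrightarrow> \<exists>e\<in>edges F. v \<in> e"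
proof -
  assume v: "v \<in> verts F"
  show ?thesis
  proof (cases "v \<in> S")
    case True
    then have "{v, vstar} \<in> edges F" using vS by (simp add: adjacent_def insert_commute)
    then show ?thesis by auto
  next
    case False
    then have vT': "v \<in> T" using v verts_F by auto
    have "nb v \<noteq> {}"
    proof (cases "v = vstar")
      case True
      then show ?thesis using nb_root S_ge_2 by auto
    next
      case False
      then show ?thesis using card_nb[of v] vT' r2 by auto
    qed
    then obtain u where "u \<in> nb v" by auto
    then have "{u, v} \<in> edges F" by (simp add: nb_def)
    then show ?thesis by auto
  qed
qed

lemma free_sets_iff: "A \<in> R.free_sets U \<longleftrightarrow> \<not> embeds F U A"
  by (simp add: R.free_sets_def embeds_def tedges_eq verts_F)

end

section \<open>Asymptotics\<close>

lemma aasI: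
  assumes "eventually (\<lambda>n. measure_pmf.prob (gnp n (p n)) {G. \<not> A n G} \<le> b n) sequentially" "b \<longlonglongrightarrow> 0"
  shows "aas p A"
proof -
  have eq: "measure_pmf.prob (gnp n (p n)) {G. A n G} = 1 - measure_pmf.prob (gnp n (p n)) {G. \<not> A n G}" for n
    using measure_pmf.prob_compl[of "{G. \<not> A n G}" "gnp n (p n)"] by (simp add: Collect_neg_eq[symmetric] Compl_eq_Diff_UNIV[symmetric])
  have "(\<lambda>n. measure_pmf.prob (gnp n (p n)) {G. \<not> A n G}) \<longlonglongrightarrow> 0"
    by (rule tendsto_sandwich[OF _ assms(1) tendsto_const assms(2)]) (simp add: always_eventually)
  then have "(\<lambda>n. 1 - measure_pmf.prob (gnp n (p n)) {G. \<not> A n G}) \<longlonglongrightarrow> 1 - 0"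
    by (intro tendsto_intros)
  then show ?thesis by (simp add: aas_def eq)
qed

lemma exp_minus_tendsto: "(\<lambda>n. exp (- real n)) \<longlonglongrightarrow> 0"
  by real_asymp

lemma choose_two_lower:
  assumes "2 \<le> n"
  shows "(real n)\<^sup>2 / 4 \<le> real (n choose 2)"
proof -
  have "n * n \<le> n * (n - 1) * 2" using assms by (cases n) auto
  moreover have "2 * (n choose 2) = n * (n - 1)" unfolding choose_two by (rule dvd_mult_div_cancel) (cases n, auto)
  ultimately have "n * n \<le> 4 * (n choose 2)" by linarith
  then have "real (n * n) \<le> real (4 * (n choose 2))" by (rule of_nat_mono)
  then show ?thesis by (simp add: power2_eq_square)
qed

lemma prob_either:
  assumes "\<And>G. A G \<Longrightarrow> B G \<or> C G"
  shows "measure_pmf.prob M {G. A G} \<le> measure_pmf.prob M {G. B G} + measure_pmf.prob M {G. C G}"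
proof -
  have "measure_pmf.prob M {G. A G} \<le> measure_pmf.prob M ({G. B G} \<union> {G. C G})"
    using assms by (intro measure_pmf.finite_measure_mono) auto
  also have "\<dots> \<le> measure_pmf.prob M {G. B G} + measure_pmf.prob M {G. C G}" by (rule measure_Un_le) auto
  finally show ?thesis .
qed

context rooted_graph begin

definition main_order :: "nat \<Rightarrow> real \<Rightarrow> real" where
  "main_order n p = p powr (1 - 1 / real r) * real n powr (2 - 1 / real r)"

lemma r_half: "1 / real r \<le> 1 / 2" "0 < 1 / real r" using r2 by auto

lemma exponents: "0 < B.\<beta>" "B.\<beta> < 1" "0 < B.\<alpha>" "B.\<alpha> < 1" "B.\<alpha> = 1 / real r + B.\<beta> * (1 - 1 / real r)"
proof -
  define s t \<rho> where "s = real (card S) - 1" and "t = real (card T) - 1" and "\<rho> = real r"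
  have st: "1 \<le> s" "1 \<le> t" "2 \<le> \<rho>" using S_ge_2 T_ge_2 r2 by (auto simp: s_def t_def \<rho>_def)
  have rt: "2 * t \<le> \<rho> * t" using st by (intro mult_right_mono) auto
  have w: "0 < s + \<rho> * t" using st rt by linarith
  have b: "B.\<beta> = s / (s + \<rho> * t)" by (simp add: B.\<beta>_def s_def t_def \<rho>_def)
  have a: "B.\<alpha> = (s + t) / (s + \<rho> * t)" by (simp add: B.\<alpha>_def s_def t_def \<rho>_def)
  show "0 < B.\<beta>" using st w by (simp add: b)
  show "B.\<beta> < 1" unfolding b using st rt by (subst divide_less_eq_1_pos[OF w]) linarith
  show "0 < B.\<alpha>" using st w by (simp add: a)
  show "B.\<alpha> < 1" unfolding a using st rt by (subst divide_less_eq_1_pos[OF w]) linarith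
  have "1 / \<rho> + s / w * (1 - 1 / \<rho>) = (w + s * (\<rho> - 1)) / (\<rho> * w)" if "0 < w" for w
    using st that by (simp add: field_simps)
  from this[OF w] have "1 / \<rho> + s / (s + \<rho> * t) * (1 - 1 / \<rho>) = (\<rho> * (s + t)) / (\<rho> * (s + \<rho> * t))"
    by (simp add: algebra_simps)
  then have "1 / \<rho> + s / (s + \<rho> * t) * (1 - 1 / \<rho>) = (s + t) / (s + \<rho> * t)"
    using st by simp
  then show "B.\<alpha> = 1 / real r + B.\<beta> * (1 - 1 / real r)" by (simp add: a b \<rho>_def)
qed

lemma ln_ge_1: "3 \<le> n \<Longrightarrow> 1 \<le> ln (real n)"
proof -
  assume n: "3 \<le> n"
  have "exp 1 \<le> (3::real)" by (rule exp_le)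
  also have "\<dots> \<le> real n" using n by simp
  finally show ?thesis using n by (subst ln_ge_iff) auto
qed

text \<open>The last identity of \<open>exponents\<close> says that the two orders of magnitude meet at \<open>p = n powr (-\<beta>)\<close>. An excess of \<open>(ln n) ^ 4\<close> in \<open>p\<close>
  gives a factor \<open>(ln n) powr (4 * (1 - 1/r)) \<ge> (ln n)\<^sup>2\<close>, enough to absorb the secondary term of \<open>activity_bound\<close>.\<close>
lemma main_order_lower:
  assumes n: "3 \<le> n" and P: "real n powr (- B.\<beta>) * ln (real n) powr 4 \<le> P"
  shows "real n powr (2 - B.\<alpha>) * (ln (real n))\<^sup>2 \<le> main_order n P"
proof -
  have l1: "1 \<le> ln (real n)" by (rule ln_ge_1[OF n])
  have e: "0 \<le> 1 - 1 / real r" using r_half by simp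
  have "(real n powr (- B.\<beta>) * ln (real n) powr 4) powr (1 - 1 / real r) \<le> P powr (1 - 1 / real r)"
    using P e by (intro powr_mono2) auto
  then have "real n powr (- B.\<beta> * (1 - 1 / real r)) * ln (real n) powr (4 * (1 - 1 / real r)) \<le> P powr (1 - 1 / real r)"
    by (simp add: powr_mult powr_powr)
  moreover have "2 \<le> 4 * (1 - x)" if "x \<le> 1 / 2" for x :: real using that by simp
  from this[OF r_half(1)] have "ln (real n) powr 2 \<le> ln (real n) powr (4 * (1 - 1 / real r))"
    using l1 by (rule powr_mono)
  then have "real n powr (- B.\<beta> * (1 - 1 / real r)) * ln (real n) powr 2 \<le> real n powr (- B.\<beta> * (1 - 1 / real r)) * ln (real n) powr (4 * (1 - 1 / real r))"
    by (intro mult_left_mono) auto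
  ultimately have "real n powr (- B.\<beta> * (1 - 1 / real r)) * ln (real n) powr 2 \<le> P powr (1 - 1 / real r)" by linarith
  then have "real n powr (- B.\<beta> * (1 - 1 / real r)) * ln (real n) powr 2 * real n powr (2 - 1 / real r) \<le> main_order n P"
    unfolding main_order_def by (intro mult_right_mono) auto
  moreover have "real n powr (- B.\<beta> * (1 - 1 / real r)) * real n powr (2 - 1 / real r) = real n powr (2 - B.\<alpha>)"
    unfolding powr_add[symmetric] exponents(5) by (simp add: algebra_simps)
  then have "real n powr (- B.\<beta> * (1 - 1 / real r)) * ln (real n) powr 2 * real n powr (2 - 1 / real r) = real n powr (2 - B.\<alpha>) * ln (real n) powr 2"
    by (metis mult.assoc mult.commute)
  moreover have "ln (real n) powr 2 = (ln (real n))\<^sup>2" using l1 by simp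
  ultimately show ?thesis by (simp only:)
qed

text \<open>Allowing \<open>P > p\<close> makes the bound usable below the density at which it is meaningful for \<open>p\<close> itself.\<close>
lemma upper_tail:
  "\<exists>K>0. \<forall>n\<ge>3. \<forall>p P. 0 \<le> p \<and> p \<le> P \<and> P \<le> 1 \<and> real n powr (- B.\<beta>) * ln (real n) powr 4 \<le> P \<longrightarrow>
     measure_pmf.prob (gnp n p) {G. K * main_order n P < real (ex_in G F)} \<le> exp (- real n)"
proof -
  define C where "C = (1 + 4 * B.c1) * (2 * B.A1) + 8 * B.c1"
  define K where "K = 2 * (C + 1)"
  note c1 = B.c1_nonneg
  have A1: "0 \<le> B.A1" "32 * B.A0 \<le> B.A1" using B.A1_bounds by auto
  have C0: "0 \<le> C" using c1 A1 by (simp add: C_def)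
  have "measure_pmf.prob (gnp n p) {G. K * main_order n P < real (ex_in G F)} \<le> exp (- real n)"
    if n: "3 \<le> n" and p: "0 \<le> p" "p \<le> P" "P \<le> 1" and P: "real n powr (- B.\<beta>) * ln (real n) powr 4 \<le> P" for n p P
  proof -
    define g where "g = main_order n P"
    define X where "X = nsets {..<n} 2"
    define m where "m = nat \<lceil>K * g\<rceil>"
    define L where "L = ln (real n)"
    have l1: "1 \<le> L" unfolding L_def by (rule ln_ge_1[OF n])
    have P0: "0 < P"
    proof -
      have "0 < real n powr (- B.\<beta>) * ln (real n) powr 4" using n l1 by (intro mult_pos_pos) (auto simp: L_def)
      then show ?thesis using P by linarith
    qed
    have gl: "real n powr (2 - B.\<alpha>) * L\<^sup>2 \<le> g" unfolding g_def L_def by (rule main_order_lower[OF n P])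
    have L2: "1 \<le> L\<^sup>2" using l1 by (simp add: one_le_power)
    have gl1: "real n powr (2 - B.\<alpha>) \<le> g"
    proof -
      have "real n powr (2 - B.\<alpha>) * 1 \<le> real n powr (2 - B.\<alpha>) * L\<^sup>2" using L2 by (intro mult_left_mono) auto
      then show ?thesis using gl by linarith
    qed
    have gn: "real n \<le> g"
    proof -
      have "real n powr 1 \<le> real n powr (2 - B.\<alpha>)" using n exponents by (intro powr_mono) auto
      then show ?thesis using gl1 n by simp
    qed
    define e0 where "e0 = B.A1 * real n powr (2 - 1 / real r) * (2 * P) powr (- (1 / real r))"
    have qe: "2 * P * e0 = B.A1 * (2 powr (1 - 1 / real r)) * g"
    proof -
      have "2 * P * (2 * P) powr (- (1 / real r)) = (2 * P) powr (1 - 1 / real r)"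
        using P0 powr_add[of "2 * P" 1 "- (1 / real r)"] by simp
      also have "\<dots> = 2 powr (1 - 1 / real r) * P powr (1 - 1 / real r)" using P0 by (simp add: powr_mult)
      finally have "2 * P * (2 * P) powr (- (1 / real r)) = 2 powr (1 - 1 / real r) * P powr (1 - 1 / real r)" .
      moreover have "2 * P * e0 = B.A1 * real n powr (2 - 1 / real r) * (2 * P * (2 * P) powr (- (1 / real r)))" by (simp add: e0_def)
      ultimately show ?thesis by (simp add: g_def main_order_def)
    qed
    have two: "1 \<le> 2 powr (1 - 1 / real r)" "2 powr (1 - 1 / real r) \<le> 2"
    proof -
      show "1 \<le> 2 powr (1 - 1 / real r)" using r_half by (intro ge_one_powr_ge_zero) auto
      have "2 powr (1 - 1 / real r) \<le> 2 powr 1" using r_half by (intro powr_mono) auto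
      then show "2 powr (1 - 1 / real r) \<le> 2" by simp
    qed
    have g0: "0 \<le> g" using gn by linarith
    have qlow: "B.A1 * g \<le> 2 * P * e0"
    proof -
      have "B.A1 * 1 * g \<le> B.A1 * (2 powr (1 - 1 / real r)) * g" using two A1 g0 by (intro mult_right_mono mult_left_mono) auto
      then show ?thesis by (simp add: qe)
    qed
    have qup: "2 * P * e0 \<le> 2 * B.A1 * g"
    proof -
      have "B.A1 * (2 powr (1 - 1 / real r)) * g \<le> B.A1 * 2 * g" using two A1 g0 by (intro mult_right_mono mult_left_mono) auto
      then show ?thesis by (simp add: qe)
    qed
    have dense: "32 * B.A0 * real n powr (2 - B.\<alpha>) \<le> 2 * P * e0"
    proof -
      have "32 * B.A0 * real n powr (2 - B.\<alpha>) \<le> B.A1 * g" using A1 gl1 g0 by (intro mult_mono) auto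
      then show ?thesis using qlow by linarith
    qed
    have "activity_sum (R.free_sets {..<n}) (2 * P) {} X \<le> exp ((1 + 4 * B.c1) * (2 * P * e0) + 2 * B.c1 * real n powr (2 - B.\<alpha>) * (1 + ln (real n))\<^sup>2)"
      unfolding e0_def X_def
      by (rule B.activity_bound) (use n P0 p dense in \<open>auto simp: e0_def\<close>)
    also have "\<dots> \<le> exp (C * g)"
    proof -
      have "(1 + 4 * B.c1) * (2 * P * e0) \<le> (1 + 4 * B.c1) * (2 * B.A1 * g)" using qup c1 by (intro mult_left_mono) auto
      moreover have "2 * B.c1 * real n powr (2 - B.\<alpha>) * (1 + ln (real n))\<^sup>2 \<le> 8 * B.c1 * g"
      proof -
        have "(1 + L)\<^sup>2 \<le> (2 * L)\<^sup>2" using l1 by (intro power_mono) auto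
        then have "2 * B.c1 * real n powr (2 - B.\<alpha>) * (1 + L)\<^sup>2 \<le> 2 * B.c1 * real n powr (2 - B.\<alpha>) * (4 * L\<^sup>2)"
          using c1 by (intro mult_left_mono) (auto simp: power_mult_distrib)
        also have "\<dots> = 8 * B.c1 * (real n powr (2 - B.\<alpha>) * L\<^sup>2)" by simp
        also have "\<dots> \<le> 8 * B.c1 * g" using gl c1 by (intro mult_left_mono) auto
        finally show ?thesis by (simp add: L_def)
      qed
      ultimately have "(1 + 4 * B.c1) * (2 * P * e0) + 2 * B.c1 * real n powr (2 - B.\<alpha>) * (1 + ln (real n))\<^sup>2 \<le> C * g"
        by (simp add: C_def algebra_simps)
      then show ?thesis by simp
    qed
    finally have Z: "activity_sum (R.free_sets {..<n}) (2 * P) {} X \<le> exp (C * g)" .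
    \<comment> \<open>\<open>K = 2 * (C + 1)\<close> and \<open>ln 2 \<ge> 1/2\<close> make \<open>2 ^ m\<close> beat the activity sum by \<open>exp g\<close>\<close>
    have pow: "exp ((C + 1) * g) \<le> 2 ^ m"
    proof -
      have "K * g \<le> real m" by (simp add: m_def real_nat_ceiling_ge)
      then have "K * g * (1/2) \<le> real m * ln 2"
        using C0 g0 ln2_ge_two_thirds by (intro mult_mono) (auto simp: K_def)
      moreover have "K * g * (1/2) = (C + 1) * g" by (simp add: K_def)
      ultimately have "(C + 1) * g \<le> real m * ln 2" by (simp only:)
      then have "exp ((C + 1) * g) \<le> exp (real m * ln 2)" by (simp only: exp_le_cancel_iff)
      also have "\<dots> = 2 ^ m" by (simp add: exp_of_nat_mult)
      finally show ?thesis .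
    qed
    have "measure_pmf.prob (gnp n p) {G. K * g < real (ex_in G F)}
       \<le> measure_pmf.prob (rset X p) {R. \<exists>A\<in>R.free_sets {..<n}. A \<subseteq> R \<and> m \<le> card A}"
      unfolding prob_gnp X_def
    proof (rule rset_mono_event)
      fix R assume R: "R \<subseteq> nsets {..<n} 2" and lt: "K * g < real (ex_in ({..<n}, R) F)"
      obtain A where A: "A \<subseteq> R" "\<not> embeds F {..<n} A" "card A = ex_in ({..<n}, R) F"
        using ex_in_attained[OF simple edges_nonempty _ R] no_isolated by metis
      have "m \<le> card A" using lt unfolding m_def A(3) by (simp add: nat_le_iff ceiling_le_iff)
      then show "\<exists>A\<in>R.free_sets {..<n}. A \<subseteq> R \<and> m \<le> card A" using A by (auto simp: free_sets_iff)
    qed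
    also have "\<dots> \<le> activity_sum (R.free_sets {..<n}) (2 * P) {} X / 2 ^ m"
      using p by (intro prob_large_free_subset) (auto simp: X_def finite_imp_finite_nsets)
    also have "\<dots> \<le> exp (C * g) / exp ((C + 1) * g)" using Z pow by (intro frac_le) auto
    also have "\<dots> = exp (- g)" by (simp add: exp_diff[symmetric] algebra_simps)
    also have "\<dots> \<le> exp (- real n)" using gn by simp
    finally show ?thesis by (simp add: g_def)
  qed
  then show ?thesis using C0 by (intro exI[of _ K]) (auto simp: K_def)
qed

text \<open>\<open>blow_up_lower_bound\<close> with about \<open>n * p\<close> classes. The extremal graph has order \<open>(n * p) powr (2 - 1/r)\<close> edges, and dividing by \<open>p\<close> gives
  the order \<open>p powr (1 - 1/r) * n powr (2 - 1/r)\<close>.\<close>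
lemma lower_tail_dense:
  "\<exists>c>0. \<exists>D n0. \<forall>n p. 0 < p \<and> p \<le> 1 \<and> n0 \<le> real n * p \<longrightarrow>
     measure_pmf.prob (gnp n p) {G. real (ex_in G F) \<le> c * main_order n p} \<le> D / (real n * p)"
proof -
  obtain t where t: "1 \<le> t" "contains_copy F (complete_bipartite r t)"
    "(\<lambda>n. real (ex_num n (complete_bipartite r t))) \<in> \<Theta>(\<lambda>n. real n powr (2 - 1 / real r))" using turan by auto
  define K where "K = complete_bipartite r t"
  have "(\<lambda>n. real (ex_num n K)) \<in> \<Omega>(\<lambda>n. real n powr (2 - 1 / real r))" unfolding K_def using t(3) by (rule bigthetaD2)
  then obtain c where c: "0 < c" "eventually (\<lambda>n. c * norm (real n powr (2 - 1 / real r)) \<le> norm (real (ex_num n K))) sequentially"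
    by (elim landau_omega.bigE)
  then obtain m1 where m1: "\<And>m. m1 \<le> m \<Longrightarrow> c * real m powr (2 - 1 / real r) \<le> real (ex_num m K)"
    by (auto simp: eventually_sequentially)
  have Kne: "edges K \<noteq> {}"
  proof -
    have "{Inl 0, Inr 0} \<in> edges K" using r2 t(1) by (auto simp: K_def complete_bipartite_def intro!: exI[of _ "0::nat"])
    then show ?thesis by auto
  qed
  have "measure_pmf.prob (gnp n p) {G. real (ex_in G F) \<le> c / 256 * main_order n p} \<le> 160 / c / (real n * p)"
    if p: "0 < p" "p \<le> 1" and np: "4 + 2 * real m1 \<le> real n * p" for n p
  proof -
    define s where "s = nat \<lceil>1 / (4 * p)\<rceil>"
    have sp: "1 / (4 * p) \<le> real s" "real s \<le> 1 / (4 * p) + 1"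
    proof -
      show "1 / (4 * p) \<le> real s" by (simp add: s_def real_nat_ceiling_ge)
      have "real s = real_of_int \<lceil>1 / (4 * p)\<rceil>" using p by (simp add: s_def)
      then show "real s \<le> 1 / (4 * p) + 1" by linarith
    qed
    have s0: "0 < real s" using sp(1) p by (smt (verit) divide_pos_pos)
    have s5: "real s \<le> 5 / (4 * p)"
    proof -
      have "1 \<le> 1 / p" using p by simp
      then show ?thesis using sp(2) p by (simp add: field_simps)
    qed
    define m where "m = n div s"
    have ms: "m * s \<le> n" by (simp add: m_def)
    have mlow: "real n * p / 2 \<le> real m"
    proof -
      have "n < (m + 1) * s" using s0 by (simp add: m_def dividend_less_div_times)
      then have "real n \<le> real ((m + 1) * s)" by (intro of_nat_mono) simp
      also have "\<dots> = (real m + 1) * real s" by (simp add: algebra_simps)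
      also have "\<dots> \<le> (real m + 1) * (5 / (4 * p))" using s5 by (intro mult_left_mono) auto
      finally have "real n * p \<le> (real m + 1) * (5 / (4 * p)) * p" using p by (intro mult_right_mono) auto
      also have "\<dots> = (real m + 1) * (5 / 4)" using p by simp
      finally show ?thesis using np by simp
    qed
    have "real m1 \<le> real m" using mlow np by simp
    then have mm: "m1 \<le> m" by simp
    obtain J where J: "J \<subseteq> nsets {..<m} 2" "\<not> contains_copy ({..<m}, J) K" "card J = ex_num m K"
      using ex_num_attained[OF _ Kne, of m] simple_complete_bipartite by (auto simp: K_def)
    define h where "h = real n * p / 2"
    have h1: "1 \<le> h" using np by (simp add: h_def)
    have cJ: "c * h powr (2 - 1 / real r) \<le> real (card J)"
    proof -
      have "h powr (2 - 1 / real r) \<le> real m powr (2 - 1 / real r)"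
        using mlow h1 order_trans[OF r_half(1), of 2] by (intro powr_mono2) (auto simp: h_def)
      then have "c * h powr (2 - 1 / real r) \<le> c * real m powr (2 - 1 / real r)" using c by (intro mult_left_mono) auto
      then show ?thesis using m1[OF mm] J(3) by simp
    qed
    have cJ1: "c * h \<le> real (card J)"
    proof -
      have "h powr 1 \<le> h powr (2 - 1 / real r)" using h1 r_half by (intro powr_mono) auto
      then have "c * h \<le> c * h powr (2 - 1 / real r)" using c h1 by (intro mult_left_mono) auto
      then show ?thesis using cJ by linarith
    qed
    have ch: "0 < c * h" using c h1 by simp
    have J0: "J \<noteq> {}" using cJ1 ch by auto
    have "c / 256 * main_order n p \<le> real (card J) / (64 * p)"
    proof -
      have "2 powr (2 - 1 / real r) \<le> 2 powr (2::real)" using r_half by (intro powr_mono) auto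
      then have "2 powr (2 - 1 / real r) \<le> (4::real)" by simp
      then have "(real n * p) powr (2 - 1 / real r) / 4 \<le> (real n * p) powr (2 - 1 / real r) / 2 powr (2 - 1 / real r)"
        by (intro divide_left_mono) auto
      also have "\<dots> = h powr (2 - 1 / real r)" using p by (simp add: h_def powr_divide)
      finally have "c * ((real n * p) powr (2 - 1 / real r) / 4) \<le> c * h powr (2 - 1 / real r)" using c by (intro mult_left_mono) auto
      then have "c * ((real n * p) powr (2 - 1 / real r) / 4) / (64 * p) \<le> real (card J) / (64 * p)"
        using cJ p by (intro divide_right_mono) auto
      moreover have "(real n * p) powr (2 - 1 / real r) = main_order n p * p"
      proof -
        have "p powr (2 - 1 / real r) = p * p powr (1 - 1 / real r)" using p powr_add[of p 1 "1 - 1 / real r"] by simp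
        then show ?thesis using p by (simp add: powr_mult main_order_def)
      qed
      ultimately show ?thesis using p by simp
    qed
    then have "measure_pmf.prob (gnp n p) {G. real (ex_in G F) \<le> c / 256 * main_order n p}
        \<le> measure_pmf.prob (gnp n p) {G. real (ex_in G F) \<le> real (card J) / (64 * p)}"
      by (intro measure_pmf.finite_measure_mono) auto
    also have "\<dots> \<le> 80 / real (card J)"
      by (rule blow_up_lower_bound[OF simple t(2) _ _ _ ms J(1) J0 J(2)[unfolded K_def] p sp]) (use r2 t(1) s0 in auto)
    also have "\<dots> \<le> 80 / (c * h)" using cJ1 ch by (intro divide_left_mono) auto
    also have "\<dots> = 160 / c / (real n * p)" by (simp add: h_def)
    finally show ?thesis .
  qed
  then show ?thesis using c(1) by (intro exI[of _ "c / 256"] conjI exI[of _ "160 / c"] exI[of _ "4 + 2 * real m1"]) auto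
qed

text \<open>The ratio of the expected numbers of copies and of edges is of order \<open>(p * n powr \<alpha>) ^ (e(F) - 1)\<close>, which tends to 0, while the
  number of edges is concentrated because its mean tends to infinity.\<close>
lemma sparse_aas:
  assumes p: "\<And>n. 0 \<le> p n \<and> p n \<le> 1" and lo: "(\<lambda>n. real n powr (- 2)) \<in> o(p)"
    and up: "p \<in> o(\<lambda>n. real n powr (- B.\<alpha>))" and \<epsilon>: "0 < \<epsilon>"
  shows "aas p (\<lambda>n G. \<bar>real (ex_in G F) - p n * real (n choose 2)\<bar> \<le> \<epsilon> * (p n * real (n choose 2)))"
proof (rule aasI)
  define \<mu> where "\<mu> n = p n * real (n choose 2)" for n
  define k where "k = e_num F - 1"
  have eF: "real (e_num F) = real (card S) + real r * (real (card T) - 1)" by (rule real_card_edges)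
  have vF: "real (v_num F) = real (card S) + real (card T)" by (rule real_card_verts)
  have k1: "1 \<le> k" using R.tedges_2 by (simp add: tedges_eq k_def)
  have kr: "real k = real (card S) - 1 + real r * (real (card T) - 1)" using k1 eF by (simp add: k_def of_nat_diff)
  have \<alpha>k: "B.\<alpha> * real k = real (v_num F) - 2" using k1 unfolding B.\<alpha>_def kr[symmetric] vF by simp
  \<comment> \<open>The two hypotheses on \<open>p\<close> become \<open>x \<longlonglongrightarrow> 0\<close> and \<open>y \<longlonglongrightarrow> 0\<close>.\<close>
  define x where "x n = p n * real n powr B.\<alpha>" for n
  have xlim: "x \<longlonglongrightarrow> 0"
  proof -
    have "(\<lambda>n. p n / real n powr (- B.\<alpha>)) \<longlonglongrightarrow> 0" using up by (rule smalloD_tendsto)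
    moreover have "x = (\<lambda>n. p n / real n powr (- B.\<alpha>))" by (auto simp: x_def powr_minus divide_inverse)
    ultimately show ?thesis by simp
  qed
  define y where "y n = real n powr (- 2) / p n" for n
  have ylim: "y \<longlonglongrightarrow> 0" unfolding y_def using lo by (rule smalloD_tendsto)
  have ppos: "eventually (\<lambda>n. 0 < p n) sequentially"
  proof -
    have "eventually (\<lambda>n. norm (real n powr (- 2)) \<le> 1 * norm (p n)) sequentially" using lo by (rule landau_o.smallD) simp
    then show ?thesis using eventually_gt_at_top[of 0]
    proof eventually_elim
      case (elim n)
      have "0 < real n powr (-2)" using elim(2) by simp
      moreover have "real n powr (-2) \<le> p n" using elim(1) p[of n] by simp
      ultimately show ?case by linarith
    qed
  qed
  define b where "b n = 16 / \<epsilon>\<^sup>2 * y n + 8 / \<epsilon> * x n ^ k" for n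
  show "b \<longlonglongrightarrow> 0"
  proof -
    have "b \<longlonglongrightarrow> 16 / \<epsilon>\<^sup>2 * 0 + 8 / \<epsilon> * 0 ^ k" unfolding b_def by (intro tendsto_intros xlim ylim)
    moreover have "(0::real) ^ k = 0" using k1 by simp
    ultimately show ?thesis by simp
  qed
  show "eventually (\<lambda>n. measure_pmf.prob (gnp n (p n)) {G. \<not> \<bar>real (ex_in G F) - p n * real (n choose 2)\<bar> \<le> \<epsilon> * (p n * real (n choose 2))} \<le> b n) sequentially"
    using ppos eventually_ge_at_top[of 2]
  proof eventually_elim
    case (elim n)
    have n0: "0 < real n" using elim(2) by simp
    have ch: "(real n)\<^sup>2 / 4 \<le> real (n choose 2)" using elim(2) by (intro choose_two_lower) simp
    have ch0: "0 < real (n choose 2)" using ch n0 by (smt (verit) divide_pos_pos zero_less_power)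
    have \<mu>0: "0 < \<mu> n" using elim(1) ch0 by (simp add: \<mu>_def)
    have \<mu>l: "p n * (real n)\<^sup>2 / 4 \<le> \<mu> n" using ch elim(1) mult_left_mono[OF ch, of "p n"] by (simp add: \<mu>_def)
    have l0: "0 < p n * (real n)\<^sup>2 / 4" using elim(1) n0 by simp
    define a where "a = \<epsilon> * \<mu> n / 2"
    have a0: "0 < a" using \<epsilon> \<mu>0 by (simp add: a_def)
    have "measure_pmf.prob (gnp n (p n)) {G. \<not> \<bar>real (ex_in G F) - p n * real (n choose 2)\<bar> \<le> \<epsilon> * (p n * real (n choose 2))}
       \<le> measure_pmf.prob (gnp n (p n)) {G. a + a \<le> \<bar>real (ex_in G F) - p n * real (n choose 2)\<bar>}"
      by (intro measure_pmf.finite_measure_mono) (auto simp: a_def \<mu>_def)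
    also have "\<dots> \<le> p n * real (n choose 2) / a\<^sup>2 + real n ^ v_num F * p n ^ e_num F / a"
      using p[of n] by (intro sparse_deviation simple edges_nonempty no_isolated a0) auto
    also have "p n * real (n choose 2) / a\<^sup>2 = 4 / \<epsilon>\<^sup>2 / \<mu> n"
      using \<mu>0 \<epsilon> by (simp add: a_def \<mu>_def[symmetric] power2_eq_square field_simps)
    also have "\<dots> \<le> 4 / \<epsilon>\<^sup>2 / (p n * (real n)\<^sup>2 / 4)" using \<mu>l l0 \<epsilon> \<mu>0 by (intro divide_left_mono mult_pos_pos) auto
    also have "\<dots> = 16 / \<epsilon>\<^sup>2 * y n"
    proof -
      have "real n powr (-2) = 1 / (real n)\<^sup>2" using n0 by (simp add: powr_minus_divide)
      then show ?thesis by (simp add: y_def)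
    qed
    also have "real n ^ v_num F * p n ^ e_num F / a \<le> 8 / \<epsilon> * x n ^ k"
    proof -
      have e: "e_num F = Suc k" using k1 by (simp add: k_def)
      have "x n ^ k = p n ^ k * real n powr (B.\<alpha> * real k)"
        using n0 by (simp add: x_def power_mult_distrib powr_realpow[symmetric] powr_powr)
      also have "real n powr (B.\<alpha> * real k) = real n ^ v_num F / (real n)\<^sup>2"
        unfolding \<alpha>k powr_diff using n0 by (simp add: powr_realpow)
      finally have xk: "x n ^ k = p n ^ k * real n ^ v_num F / (real n)\<^sup>2" by simp
      have "real n ^ v_num F * p n ^ e_num F / a \<le> real n ^ v_num F * p n ^ e_num F / (\<epsilon> * (p n * (real n)\<^sup>2 / 4) / 2)"
        using \<mu>l \<epsilon> l0 a0 elim(1) by (intro divide_left_mono) (auto simp: a_def intro!: divide_right_mono mult_left_mono)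
      also have "\<dots> = 8 / \<epsilon> * x n ^ k" unfolding xk e using elim(1) n0 \<epsilon> by (simp add: field_simps)
      finally show ?thesis .
    qed
    finally show ?case by (simp add: b_def)
  qed
qed

lemma main_order_edge:
  assumes n: "3 \<le> n"
  shows "main_order n (real n powr (- B.\<beta>) * ln (real n) powr 4) = real n powr (2 - B.\<alpha>) * ln (real n) powr (4 * (1 - 1 / real r))"
proof -
  have "main_order n (real n powr (- B.\<beta>) * ln (real n) powr 4)
     = (real n powr (- B.\<beta> * (1 - 1 / real r)) * real n powr (2 - 1 / real r)) * ln (real n) powr (4 * (1 - 1 / real r))"
    by (simp add: main_order_def powr_mult powr_powr)
  also have "real n powr (- B.\<beta> * (1 - 1 / real r)) * real n powr (2 - 1 / real r) = real n powr (2 - B.\<alpha>)"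
    unfolding powr_add[symmetric] exponents(5) by (simp add: algebra_simps)
  finally show ?thesis .
qed

lemma dense_range:
  "\<exists>K > 0. \<forall>p :: nat \<Rightarrow> real.
        (\<forall>n. 0 \<le> p n \<and> p n \<le> 1) \<longrightarrow>
        (\<forall>\<^sub>F n in sequentially. real n powr (- B.\<beta>) * ln (real n) powr 4 \<le> p n) \<longrightarrow>
        aas p (\<lambda>n G. inverse K * main_order n (p n) \<le> real (ex_in G F) \<and> real (ex_in G F) \<le> K * main_order n (p n))"
proof -
  obtain K where K: "0 < K" "\<And>n p P. 3 \<le> n \<Longrightarrow> 0 \<le> p \<and> p \<le> P \<and> P \<le> 1 \<and> real n powr (- B.\<beta>) * ln (real n) powr 4 \<le> P \<Longrightarrow>
     measure_pmf.prob (gnp n p) {G. K * main_order n P < real (ex_in G F)} \<le> exp (- real n)"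
    using upper_tail by blast
  obtain c D n0 where c: "0 < c" "\<And>n p. 0 < p \<and> p \<le> 1 \<and> n0 \<le> real n * p \<Longrightarrow>
     measure_pmf.prob (gnp n p) {G. real (ex_in G F) \<le> c * main_order n p} \<le> D / (real n * p)"
    using lower_tail_dense by blast
  define K' where "K' = max K (inverse c)"
  have K': "0 < K'" "K \<le> K'" "inverse K' \<le> c"
  proof -
    show "0 < K'" "K \<le> K'" using K by (auto simp: K'_def)
    have "inverse K' \<le> inverse (inverse c)" using c by (intro le_imp_inverse_le) (auto simp: K'_def)
    then show "inverse K' \<le> c" by simp
  qed
  have "aas p (\<lambda>n G. inverse K' * main_order n (p n) \<le> real (ex_in G F) \<and> real (ex_in G F) \<le> K' * main_order n (p n))"
    if p: "\<And>n. 0 \<le> p n \<and> p n \<le> 1" and ev: "\<forall>\<^sub>F n in sequentially. real n powr (- B.\<beta>) * ln (real n) powr 4 \<le> p n" for p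
  proof (rule aasI)
    have "filterlim (\<lambda>n. real n powr (1 - B.\<beta>)) at_top sequentially"
      using exponents(2) by (intro filterlim_compose[OF real_powr_at_top filterlim_real_sequentially]) auto
    moreover have low: "\<forall>\<^sub>F n in sequentially. real n powr (1 - B.\<beta>) \<le> real n * p n"
      using ev eventually_ge_at_top[of 3]
    proof eventually_elim
      case (elim n)
      have "1 \<le> ln (real n) powr 4" using ln_ge_1[OF elim(2)] by (intro ge_one_powr_ge_zero) auto
      then have "real n powr (- B.\<beta>) * 1 \<le> real n powr (- B.\<beta>) * ln (real n) powr 4" by (intro mult_left_mono) auto
      then have "real n powr (- B.\<beta>) \<le> p n" using elim(1) by linarith
      then have "real n * real n powr (- B.\<beta>) \<le> real n * p n" by (intro mult_left_mono) auto
      moreover have "real n * real n powr (- B.\<beta>) = real n powr (1 - B.\<beta>)" using elim(2) powr_add[of "real n" 1 "- B.\<beta>"] by simp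
      ultimately show ?case by simp
    qed
    ultimately have np: "filterlim (\<lambda>n. real n * p n) at_top sequentially" by (rule filterlim_at_top_mono)
    have "(\<lambda>n. exp (- real n) + D / (real n * p n)) \<longlonglongrightarrow> 0 + 0"
      by (intro tendsto_add exp_minus_tendsto tendsto_divide_0[OF tendsto_const] filterlim_at_top_imp_at_infinity np)
    then show "(\<lambda>n. exp (- real n) + D / (real n * p n)) \<longlonglongrightarrow> 0" by simp
    have "\<forall>\<^sub>F n in sequentially. max n0 1 \<le> real n * p n" using np unfolding filterlim_at_top by (rule spec)
    with ev show "\<forall>\<^sub>F n in sequentially. measure_pmf.prob (gnp n (p n))
        {G. \<not> (inverse K' * main_order n (p n) \<le> real (ex_in G F) \<and> real (ex_in G F) \<le> K' * main_order n (p n))}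
        \<le> exp (- real n) + D / (real n * p n)"
      using eventually_ge_at_top[of 3]
    proof eventually_elim
      case (elim n)
      have m0: "0 \<le> main_order n (p n)" by (simp add: main_order_def)
      have pp: "0 < p n" using elim(2) p[of n] by (cases "p n = 0") auto
      have "measure_pmf.prob (gnp n (p n)) {G. \<not> (inverse K' * main_order n (p n) \<le> real (ex_in G F) \<and> real (ex_in G F) \<le> K' * main_order n (p n))}
        \<le> measure_pmf.prob (gnp n (p n)) {G. K * main_order n (p n) < real (ex_in G F)} + measure_pmf.prob (gnp n (p n)) {G. real (ex_in G F) \<le> c * main_order n (p n)}"
      proof (rule prob_either)
        fix G assume "\<not> (inverse K' * main_order n (p n) \<le> real (ex_in G F) \<and> real (ex_in G F) \<le> K' * main_order n (p n))"
        moreover have "K * main_order n (p n) \<le> K' * main_order n (p n)" "inverse K' * main_order n (p n) \<le> c * main_order n (p n)"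
          using K' m0 by (auto intro: mult_right_mono)
        ultimately show "K * main_order n (p n) < real (ex_in G F) \<or> real (ex_in G F) \<le> c * main_order n (p n)" by linarith
      qed
      also have "\<dots> \<le> exp (- real n) + D / (real n * p n)"
        using elim p[of n] pp by (intro add_mono K(2) c(2)) auto
      finally show ?case .
    qed
  qed
  then show ?thesis using K'(1) by blast
qed

text \<open>Containing an \<open>F\<close>-free set of a given size is an increasing event, so \<open>p\<close> may be lowered to \<open>q = n powr (-\<alpha>) / ln n\<close>, where
  \<open>sparse_aas\<close> gives at least half of the expected \<open>q * (n choose 2)\<close> edges.\<close>
lemma middle_lower:
  assumes p: "\<And>n. 0 \<le> p n \<and> p n \<le> 1" and lo: "(\<lambda>n. real n powr (- B.\<alpha>)) \<in> o(p)"
  shows "\<exists>b. b \<longlonglongrightarrow> 0 \<and> (\<forall>\<^sub>F n in sequentially. measure_pmf.prob (gnp n (p n)) {G. real (ex_in G F) < real n powr (2 - B.\<alpha>) * ln (real n) powr (- 5)} \<le> b n)"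
proof -
  define q where "q n = (if 3 \<le> n then real n powr (- B.\<alpha>) / ln (real n) else 0)" for n
  have \<alpha>: "0 < B.\<alpha>" "B.\<alpha> < 1" using exponents by auto
  have q: "0 \<le> q n \<and> q n \<le> 1" for n
  proof (cases "3 \<le> n")
    case True
    have l: "1 \<le> ln (real n)" by (rule ln_ge_1[OF True])
    have "real n powr (- B.\<alpha>) \<le> real n powr 0" using True \<alpha> by (intro powr_mono) auto
    then have "real n powr (- B.\<alpha>) \<le> 1" using True by simp
    then have "real n powr (- B.\<alpha>) / ln (real n) \<le> 1 / 1" using l by (intro frac_le) auto
    then show ?thesis using True l by (simp add: q_def)
  qed (simp add: q_def)
  have q_eq: "\<forall>\<^sub>F n in sequentially. q n = real n powr (- B.\<alpha>) / ln (real n)"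
    using eventually_ge_at_top[of 3] by eventually_elim (simp add: q_def)
  have "(\<lambda>n. real n powr (- 2)) \<in> o(\<lambda>n. real n powr (- B.\<alpha>) / ln (real n))"
    using \<alpha> by real_asymp
  then have q1: "(\<lambda>n. real n powr (- 2)) \<in> o(q)"
    using landau_o.small.cong[OF q_eq] by simp
  have "(\<lambda>n. real n powr (- B.\<alpha>) / ln (real n)) \<in> o(\<lambda>n. real n powr (- B.\<alpha>))"
    using \<alpha> by real_asymp
  then have q2: "q \<in> o(\<lambda>n. real n powr (- B.\<alpha>))"
    using landau_o.small.in_cong[OF q_eq] by simp
  have "aas q (\<lambda>n G. \<bar>real (ex_in G F) - q n * real (n choose 2)\<bar> \<le> 1/2 * (q n * real (n choose 2)))"
    by (rule sparse_aas[OF q q1 q2]) simp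
  then have lim: "(\<lambda>n. measure_pmf.prob (gnp n (q n)) {G. \<bar>real (ex_in G F) - q n * real (n choose 2)\<bar> \<le> 1/2 * (q n * real (n choose 2))}) \<longlonglongrightarrow> 1"
    by (simp only: aas_def)
  define b where "b n = 1 - measure_pmf.prob (gnp n (q n)) {G. \<bar>real (ex_in G F) - q n * real (n choose 2)\<bar> \<le> 1/2 * (q n * real (n choose 2))}" for n
  have "b \<longlonglongrightarrow> 1 - 1" unfolding b_def by (intro tendsto_diff tendsto_const lim)
  then have b0: "b \<longlonglongrightarrow> 0" by simp
  have qp: "\<forall>\<^sub>F n in sequentially. q n \<le> p n"
  proof -
    have "\<forall>\<^sub>F n in sequentially. norm (real n powr (- B.\<alpha>)) \<le> 1 * norm (p n)" using lo by (rule landau_o.smallD) simp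
    then show ?thesis using eventually_ge_at_top[of 3]
    proof eventually_elim
      case (elim n)
      have l: "1 \<le> ln (real n)" by (rule ln_ge_1[OF elim(2)])
      then have "real n powr (- B.\<alpha>) / ln (real n) \<le> real n powr (- B.\<alpha>) / 1" by (intro divide_left_mono) auto
      then show ?case using elim p[of n] by (simp add: q_def)
    qed
  qed
  have big: "\<forall>\<^sub>F n in sequentially. real n powr (2 - B.\<alpha>) * ln (real n) powr (- 5) \<le> 1 / 2 * (real n powr (- B.\<alpha>) / ln (real n) * ((real n)\<^sup>2 / 4))"
    using \<alpha> by real_asymp
  have "\<forall>\<^sub>F n in sequentially. measure_pmf.prob (gnp n (p n)) {G. real (ex_in G F) < real n powr (2 - B.\<alpha>) * ln (real n) powr (- 5)} \<le> b n"
    using qp big eventually_ge_at_top[of 3]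
  proof eventually_elim
    case (elim n)
    define x where "x = real n powr (2 - B.\<alpha>) * ln (real n) powr (- 5)"
    define X where "X = nsets {..<n} 2"
    define Q where "Q R \<longleftrightarrow> (\<exists>A\<subseteq>R. A \<subseteq> X \<and> \<not> embeds F {..<n} A \<and> x \<le> real (card A))" for R
    have ch: "(real n)\<^sup>2 / 4 \<le> real (n choose 2)" using elim(3) by (intro choose_two_lower) simp
    have xq: "x \<le> 1/2 * (q n * real (n choose 2))"
    proof -
      have "q n * ((real n)\<^sup>2 / 4) \<le> q n * real (n choose 2)" using ch q[of n] by (intro mult_left_mono) auto
      moreover have "x \<le> 1 / 2 * (q n * ((real n)\<^sup>2 / 4))" using elim(2,3) by (simp add: x_def q_def)
      ultimately show ?thesis by linarith
    qed
    have QX: "Q R \<longleftrightarrow> x \<le> real (ex_in ({..<n}, R) F)" if R: "R \<subseteq> X" for R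
    proof
      assume "Q R"
      then obtain A where A: "A \<subseteq> R" "\<not> embeds F {..<n} A" "x \<le> real (card A)" by (auto simp: Q_def)
      have "card A \<le> ex_in ({..<n}, R) F" using R by (intro ex_in_lower simple A) (simp add: X_def)
      then have "real (card A) \<le> real (ex_in ({..<n}, R) F)" by (rule of_nat_mono)
      then show "x \<le> real (ex_in ({..<n}, R) F)" using A(3) by linarith
    next
      assume x: "x \<le> real (ex_in ({..<n}, R) F)"
      obtain A where A: "A \<subseteq> R" "\<not> embeds F {..<n} A" "card A = ex_in ({..<n}, R) F"
        using ex_in_attained[OF simple edges_nonempty _ R[unfolded X_def]] no_isolated by metis
      have "A \<subseteq> X" using A(1) R by (rule order_trans)
      moreover have "x \<le> real (card A)" using x unfolding A(3) .
      ultimately show "Q R" unfolding Q_def using A(1,2) by (intro exI[of _ A] conjI)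
    qed
    have "1 - b n \<le> measure_pmf.prob (rset X (q n)) {R. Q R}"
      unfolding b_def prob_gnp X_def[symmetric] diff_diff_eq2 add_diff_cancel_left'
    proof (rule rset_mono_event)
      fix R assume R: "R \<subseteq> X" and d: "\<bar>real (ex_in ({..<n}, R) F) - q n * real (n choose 2)\<bar> \<le> 1/2 * (q n * real (n choose 2))"
      have "x \<le> real (ex_in ({..<n}, R) F)" using d xq by linarith
      then show "Q R" using QX[OF R] by simp
    qed
    also have "\<dots> \<le> measure_pmf.prob (rset X (p n)) {R. Q R}"
    proof (rule increasing_event_mono)
      show "Q R'" if "R \<subseteq> R'" "Q R" for R R' using that unfolding Q_def by (meson subset_trans)
    qed (use elim(1) p[of n] q[of n] in \<open>auto simp: X_def finite_imp_finite_nsets\<close>)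
    also have "\<dots> = 1 - measure_pmf.prob (rset X (p n)) {R. \<not> Q R}"
      using measure_pmf.prob_compl[of "{R. \<not> Q R}" "rset X (p n)"] by (simp add: Collect_neg_eq[symmetric] Compl_eq_Diff_UNIV[symmetric])
    finally have "measure_pmf.prob (rset X (p n)) {R. \<not> Q R} \<le> b n" by linarith
    moreover have "measure_pmf.prob (gnp n (p n)) {G. real (ex_in G F) < x} \<le> measure_pmf.prob (rset X (p n)) {R. \<not> Q R}"
      unfolding prob_gnp X_def[symmetric] by (rule rset_mono_event) (use QX in auto)
    ultimately show ?case by (simp add: x_def)
  qed
  then show ?thesis using b0 by blast
qed

text \<open>The upper bound is \<open>upper_tail\<close> with \<open>P = n powr (-\<beta>) * (ln n) ^ 4\<close>, where \<open>main_order\<close> exceeds \<open>n powr (2 - \<alpha>)\<close> by less than \<open>(ln n) ^ 4\<close>;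
  one more logarithm takes care of the constant.\<close>
lemma middle_range:
  "\<exists>C' > 0. \<forall>p :: nat \<Rightarrow> real.
        (\<forall>n. 0 \<le> p n \<and> p n \<le> 1) \<longrightarrow>
        (\<lambda>n. real n powr (- B.\<alpha>)) \<in> o(p) \<longrightarrow>
        (\<forall>\<^sub>F n in sequentially. p n \<le> real n powr (- B.\<beta>) * ln (real n) powr 4) \<longrightarrow>
        aas p (\<lambda>n G.
          real n powr (2 - B.\<alpha>) * ln (real n) powr (- C') \<le> real (ex_in G F) \<and>
          real (ex_in G F) \<le> real n powr (2 - B.\<alpha>) * ln (real n) powr C')"
proof -
  obtain K where K: "0 < K" "\<And>n p P. 3 \<le> n \<Longrightarrow> 0 \<le> p \<and> p \<le> P \<and> P \<le> 1 \<and> real n powr (- B.\<beta>) * ln (real n) powr 4 \<le> P \<Longrightarrow>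
     measure_pmf.prob (gnp n p) {G. K * main_order n P < real (ex_in G F)} \<le> exp (- real n)"
    using upper_tail by blast
  have \<beta>: "0 < B.\<beta>" using exponents by auto
  have P1: "\<forall>\<^sub>F n in sequentially. real n powr (- B.\<beta>) * ln (real n) powr 4 \<le> 1" using \<beta> by real_asymp
  have Kl: "\<forall>\<^sub>F n in sequentially. K \<le> ln (real n)" by real_asymp
  have "aas p (\<lambda>n G. real n powr (2 - B.\<alpha>) * ln (real n) powr (- 5) \<le> real (ex_in G F) \<and>
          real (ex_in G F) \<le> real n powr (2 - B.\<alpha>) * ln (real n) powr 5)"
    if p: "\<And>n. 0 \<le> p n \<and> p n \<le> 1" and lo: "(\<lambda>n. real n powr (- B.\<alpha>)) \<in> o(p)"
      and up: "\<forall>\<^sub>F n in sequentially. p n \<le> real n powr (- B.\<beta>) * ln (real n) powr 4" for p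
  proof -
    obtain b where b: "b \<longlonglongrightarrow> 0" "\<forall>\<^sub>F n in sequentially. measure_pmf.prob (gnp n (p n)) {G. real (ex_in G F) < real n powr (2 - B.\<alpha>) * ln (real n) powr (- 5)} \<le> b n"
      using middle_lower[OF p lo] by blast
    show ?thesis
    proof (rule aasI)
      have "(\<lambda>n. b n + exp (- real n)) \<longlonglongrightarrow> 0 + 0" by (intro tendsto_add b(1) exp_minus_tendsto)
      then show "(\<lambda>n. b n + exp (- real n)) \<longlonglongrightarrow> 0" by simp
      show "\<forall>\<^sub>F n in sequentially. measure_pmf.prob (gnp n (p n)) {G. \<not> (real n powr (2 - B.\<alpha>) * ln (real n) powr (- 5) \<le> real (ex_in G F) \<and>
          real (ex_in G F) \<le> real n powr (2 - B.\<alpha>) * ln (real n) powr 5)} \<le> b n + exp (- real n)"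
        using b(2) up P1 Kl eventually_ge_at_top[of 3]
      proof eventually_elim
        case (elim n)
        define P where "P = real n powr (- B.\<beta>) * ln (real n) powr 4"
        have l1: "1 \<le> ln (real n)" by (rule ln_ge_1[OF elim(5)])
        have "ln (real n) powr (4 * (1 - 1 / real r)) \<le> ln (real n) powr 4" using l1 r_half by (intro powr_mono) auto
        then have "K * (real n powr (2 - B.\<alpha>) * ln (real n) powr (4 * (1 - 1 / real r))) \<le> ln (real n) * (real n powr (2 - B.\<alpha>) * ln (real n) powr 4)"
          using elim(4) K(1) by (intro mult_mono) auto
        also have "\<dots> = real n powr (2 - B.\<alpha>) * ln (real n) powr 5"
          using l1 powr_add[of "ln (real n)" 1 4] by simp
        finally have KP: "K * main_order n P \<le> real n powr (2 - B.\<alpha>) * ln (real n) powr 5"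
          by (simp add: P_def main_order_edge[OF elim(5)])
        have "measure_pmf.prob (gnp n (p n)) {G. \<not> (real n powr (2 - B.\<alpha>) * ln (real n) powr (- 5) \<le> real (ex_in G F) \<and>
          real (ex_in G F) \<le> real n powr (2 - B.\<alpha>) * ln (real n) powr 5)}
          \<le> measure_pmf.prob (gnp n (p n)) {G. real (ex_in G F) < real n powr (2 - B.\<alpha>) * ln (real n) powr (- 5)}
           + measure_pmf.prob (gnp n (p n)) {G. K * main_order n P < real (ex_in G F)}"
          by (rule prob_either) (use KP in linarith)
        also have "\<dots> \<le> b n + exp (- real n)"
          using elim p[of n] by (intro add_mono K(2)) (auto simp: P_def)
        finally show ?case .
      qed
    qed
  qed
  then show ?thesis by (intro exI[of _ 5]) auto
qed

end

theorem theorem2p4: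
  fixes F :: "'a ugraph" and S T :: "'a set" and vstar :: 'a and r :: nat
  defines "\<alpha> \<equiv> (real (card S) + real (card T) - 2) / (real (card S) - 1 + real r * (real (card T) - 1))"
    and "\<beta> \<equiv> (real (card S) - 1) / (real (card S) - 1 + real r * (real (card T) - 1))"
  assumes "simple_graph F"
    and "bipartition F S T"
    and "vstar \<in> T"
    and "\<forall>u \<in> S. adjacent F vstar u"
    and "r \<ge> 2"
    and "\<forall>v \<in> T - {vstar}. vdegree F v = r"
    and "\<exists>t \<ge> 1. contains_copy F (complete_bipartite r t) \<and>
           (\<lambda>n. real (ex_num n (complete_bipartite r t))) \<in> \<Theta>(\<lambda>n. real n powr (2 - 1 / real r))"
    and "two_balanced F"
    and "Max {(real (e_num (induced F (\<mu> \<union> nbhd_in F T \<mu>))) - real (card (nbhd_in F T \<mu>)))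
                / (real (card \<mu>) - 1) | \<mu>. \<mu> \<subseteq> S \<and> card \<mu> \<ge> 2}
           = (real (e_num F) - real (card T)) / (real (card S) - 1)"
  shows "\<exists>C > 0.
     (\<exists>K > 0. \<forall>p :: nat \<Rightarrow> real.
        (\<forall>n. 0 \<le> p n \<and> p n \<le> 1) \<longrightarrow>
        (\<forall>\<^sub>F n in sequentially. real n powr (- \<beta>) * ln (real n) powr C \<le> p n) \<longrightarrow>
        aas p (\<lambda>n G.
          inverse K * (p n powr (1 - 1 / real r) * real n powr (2 - 1 / real r)) \<le> real (ex_in G F) \<and>
          real (ex_in G F) \<le> K * (p n powr (1 - 1 / real r) * real n powr (2 - 1 / real r)))) \<and>
     (\<exists>C' > 0. \<forall>p :: nat \<Rightarrow> real.
        (\<forall>n. 0 \<le> p n \<and> p n \<le> 1) \<longrightarrow>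
        (\<lambda>n. real n powr (- \<alpha>)) \<in> o(p) \<longrightarrow>
        (\<forall>\<^sub>F n in sequentially. p n \<le> real n powr (- \<beta>) * ln (real n) powr C) \<longrightarrow>
        aas p (\<lambda>n G.
          real n powr (2 - \<alpha>) * ln (real n) powr (- C') \<le> real (ex_in G F) \<and>
          real (ex_in G F) \<le> real n powr (2 - \<alpha>) * ln (real n) powr C')) \<and>
     (\<forall>p :: nat \<Rightarrow> real.
        (\<forall>n. 0 \<le> p n \<and> p n \<le> 1) \<longrightarrow>
        (\<lambda>n. real n powr (- 2)) \<in> o(p) \<longrightarrow>
        p \<in> o(\<lambda>n. real n powr (- \<alpha>)) \<longrightarrow>
        (\<forall>\<epsilon> > 0. aas p (\<lambda>n G.
          \<bar>real (ex_in G F) - p n * real (n choose 2)\<bar> \<le> \<epsilon> * (p n * real (n choose 2)))))"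
proof -
  interpret rooted_graph F S T vstar r using assms(3-) by unfold_locales
  have \<alpha>: "\<alpha> = B.\<alpha>" and \<beta>: "\<beta> = B.\<beta>" by (simp_all add: \<alpha>_def \<beta>_def B.\<alpha>_def B.\<beta>_def)
  show ?thesis
    unfolding \<alpha> \<beta> main_order_def[symmetric]
    by (intro exI[of _ 4] conjI dense_range middle_range allI impI sparse_aas) auto
qed

end
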